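(* Let $d \ge 3$ be odd and let $\pmb{\lambda} = (\lambda^{(1)},\ldots,\lambda^{(d)})$ be a $d$-tuple of partitions of the same integer $m$, where $m \le 2^{d-1}$, each with all parts at most $2$. Let $a = \max_i (\lambda^{(i)})'_1$ and $b = \min_i (\lambda^{(i)})'_2$. Then the sequence of generalized Kronecker coefficients $$\{ g(\rho_2^n\, \pmb{\lambda})\}_{n=-b,\ldots,2^{d-1}-a}$$ is unimodal.
   Context: For partitions $\mu^{(1)},\ldots,\mu^{(d)}$ of the same integer $N$, the (generalized) Kronecker coefficient $g(\mu^{(1)},\ldots,\mu^{(d)})$ is the multiplicity of the trivial representation $[(N)]$ in $[\mu^{(1)}]\otimes\cdots\otimes[\mu^{(d)}]$, where $[\mu]$ is the irreducible complex representation of the symmetric group $S_N$ indexed by $\mu$. (For $N=0$ and all $\mu^{(i)}=\varnothing$ it equals $1$.) $\lambda'$ denotes the conjugate partition, so $\lambda'_j$ is the number of parts of $\lambda$ that are at least $j$. For a partition $\lambda$ with parts at most $k$, $\rho_k\lambda = (k,\lambda_1,\lambda_2,\ldots)$ adds a first part equal to $k$; $\rho_k^{-1}$ removes a first part equal to $k$; $\rho_k^n$ is the corresponding iterate for $n\in\mathbb{Z}$ (for $n<0$, $-n$ parts equal to $k$ are removed). On tuples $\rho_k$ acts componentwise. A finite sequence $x_p,x_{p+1},\ldots,x_q$ is unimodal if $x_p\le\cdots\le x_r\ge\cdots\ge x_q$ for some $r\in[p,q]$. *)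

theory Defs
  imports
    Complex_Main
    "HOL-Library.FuncSet"
    "HOL-Library.Function_Algebras"
    "HOL-Combinatorics.Permutations"
begin

section \<open>Partitions\<close>

definition partition_of :: "nat \<Rightarrow> nat list \<Rightarrow> bool" where
  "partition_of N \<mu> \<longleftrightarrow> sorted_wrt (\<ge>) \<mu> \<and> 0 \<notin> set \<mu> \<and> sum_list \<mu> = N"

definition conj_part :: "nat list \<Rightarrow> nat \<Rightarrow> nat" where
  "conj_part \<mu> j = length (filter (\<lambda>p. j \<le> p) \<mu>)"

definition rho :: "nat \<Rightarrow> nat list \<Rightarrow> nat list" where
  "rho k \<mu> = k # \<mu>"

text \<open>
  The inverse of the injective map \<^term>\<open>rho k\<close> strips a first part equal to \<open>k\<close>.
  For \<open>n < 0\<close> the iterate is meaningful only if at least \<open>- n\<close> parts of \<open>\<mu>\<close> are equal to \<open>k\<close>.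
\<close>

definition rho_pow :: "nat \<Rightarrow> int \<Rightarrow> nat list \<Rightarrow> nat list" where
  "rho_pow k n \<mu> =
     (if 0 \<le> n then (rho k ^^ nat n) \<mu> else (inv (rho k) ^^ nat (- n)) \<mu>)"


section \<open>Complex representations\<close>

text \<open>
  All representations live in subspaces of complex function spaces. A representation of a set
  \<open>G\<close> of group elements is given by a subspace \<open>V\<close> together with an action
  \<open>act :: 'g \<Rightarrow> ('x \<Rightarrow> complex) \<Rightarrow> ('x \<Rightarrow> complex)\<close> preserving \<open>V\<close>.
\<close>

definition cscale :: "complex \<Rightarrow> ('x \<Rightarrow> complex) \<Rightarrow> ('x \<Rightarrow> complex)" where
  "cscale c f = (\<lambda>x. c * f x)"

interpretation cfun: vector_space "cscale :: complex \<Rightarrow> ('x \<Rightarrow> complex) \<Rightarrow> ('x \<Rightarrow> complex)"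
  by unfold_locales (auto simp: cscale_def fun_eq_iff algebra_simps)

definition subrep ::
    "'g set \<Rightarrow> ('g \<Rightarrow> ('x \<Rightarrow> complex) \<Rightarrow> ('x \<Rightarrow> complex)) \<Rightarrow>
     ('x \<Rightarrow> complex) set \<Rightarrow> ('x \<Rightarrow> complex) set \<Rightarrow> bool" where
  "subrep G act V W \<longleftrightarrow>
     cfun.subspace W \<and> W \<subseteq> V \<and> (\<forall>g\<in>G. \<forall>w\<in>W. act g w \<in> W)"

definition irreducible_rep ::
    "'g set \<Rightarrow> ('g \<Rightarrow> ('x \<Rightarrow> complex) \<Rightarrow> ('x \<Rightarrow> complex)) \<Rightarrow>
     ('x \<Rightarrow> complex) set \<Rightarrow> bool" where
  "irreducible_rep G act W \<longleftrightarrow>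
     W \<noteq> {0} \<and> (\<forall>U. subrep G act W U \<longrightarrow> U = {0} \<or> U = W)"

definition rep_iso ::
    "'g set \<Rightarrow> ('g \<Rightarrow> ('x \<Rightarrow> complex) \<Rightarrow> ('x \<Rightarrow> complex)) \<Rightarrow> ('x \<Rightarrow> complex) set \<Rightarrow>
     ('g \<Rightarrow> ('y \<Rightarrow> complex) \<Rightarrow> ('y \<Rightarrow> complex)) \<Rightarrow> ('y \<Rightarrow> complex) set \<Rightarrow> bool" where
  "rep_iso G act V act' U \<longleftrightarrow>
     (\<exists>\<phi>. bij_betw \<phi> V U \<and>
          (\<forall>v\<in>V. \<forall>w\<in>V. \<phi> (v + w) = \<phi> v + \<phi> w) \<and>
          (\<forall>c. \<forall>v\<in>V. \<phi> (cscale c v) = cscale c (\<phi> v)) \<and>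
          (\<forall>g\<in>G. \<forall>v\<in>V. \<phi> (act g v) = act' g (\<phi> v)))"

text \<open>
  \<open>V = W 0 \<oplus> \<dots> \<oplus> W (k - 1)\<close> with irreducible summands; the last conjunct says that every vector
  of \<open>V\<close> is in exactly one way a sum of vectors of the \<open>W j\<close>.
\<close>

definition irreducible_decomposition ::
    "'g set \<Rightarrow> ('g \<Rightarrow> ('x \<Rightarrow> complex) \<Rightarrow> ('x \<Rightarrow> complex)) \<Rightarrow>
     ('x \<Rightarrow> complex) set \<Rightarrow> nat \<Rightarrow> (nat \<Rightarrow> ('x \<Rightarrow> complex) set) \<Rightarrow> bool" where
  "irreducible_decomposition G act V k W \<longleftrightarrow>
     (\<forall>j<k. subrep G act V (W j) \<and> irreducible_rep G act (W j)) \<and>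
     bij_betw (\<lambda>w. \<Sum>j<k. w j) (PiE {..<k} W) V"

text \<open>
  The multiplicity of an irreducible representation \<open>U\<close> in \<open>V\<close>: the number of summands isomorphic
  to \<open>U\<close> in a decomposition of \<open>V\<close> into irreducibles. For a finite group acting linearly on a
  finite-dimensional \<open>V\<close> a decomposition exists (Maschke), and the number does not depend on it.
\<close>

definition multiplicity_rep ::
    "'g set \<Rightarrow> ('g \<Rightarrow> ('y \<Rightarrow> complex) \<Rightarrow> ('y \<Rightarrow> complex)) \<Rightarrow> ('y \<Rightarrow> complex) set \<Rightarrow>
     ('g \<Rightarrow> ('x \<Rightarrow> complex) \<Rightarrow> ('x \<Rightarrow> complex)) \<Rightarrow> ('x \<Rightarrow> complex) set \<Rightarrow> nat" where
  "multiplicity_rep G act' U act V =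
     (THE r. \<exists>k W. irreducible_decomposition G act V k W \<and>
                   r = card {j. j < k \<and> rep_iso G act (W j) act' U})"

definition trivial_act :: "'g \<Rightarrow> (unit \<Rightarrow> complex) \<Rightarrow> (unit \<Rightarrow> complex)" where
  "trivial_act g v = v"

definition trivial_space :: "(unit \<Rightarrow> complex) set" where
  "trivial_space = UNIV"


section \<open>Irreducible representations of the symmetric group\<close>

type_synonym perm = "nat \<Rightarrow> nat"

definition sym :: "nat \<Rightarrow> perm set" where
  "sym N = {\<sigma>. \<sigma> permutes {..<N}}"

text \<open>
  The group algebra of \<open>S_N\<close> consists of the functions vanishing outside \<^term>\<open>sym N\<close>; the function
  \<open>f\<close> stands for \<open>\<Sum>\<sigma>. f \<sigma> \<cdot> \<sigma>\<close>.
\<close>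

definition group_algebra :: "nat \<Rightarrow> (perm \<Rightarrow> complex) set" where
  "group_algebra N = {f. \<forall>\<sigma>. \<sigma> \<notin> sym N \<longrightarrow> f \<sigma> = 0}"

definition alg_mult ::
    "nat \<Rightarrow> (perm \<Rightarrow> complex) \<Rightarrow> (perm \<Rightarrow> complex) \<Rightarrow> (perm \<Rightarrow> complex)" where
  "alg_mult N f h =
     (\<lambda>\<tau>. if \<tau> \<in> sym N then \<Sum>\<sigma>\<in>sym N. f \<sigma> * h (inv \<sigma> \<circ> \<tau>) else 0)"

text \<open>
  The standard tableau of shape \<open>\<mu>\<close> that is filled row by row with \<open>0, \<dots>, N - 1\<close>: the row and the
  column (both counted from 0) of the entry \<open>x < N\<close>.
\<close>

definition row_of :: "nat list \<Rightarrow> nat \<Rightarrow> nat" where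
  "row_of \<mu> x = (LEAST r. x < sum_list (take (Suc r) \<mu>))"

definition col_of :: "nat list \<Rightarrow> nat \<Rightarrow> nat" where
  "col_of \<mu> x = x - sum_list (take (row_of \<mu> x) \<mu>)"

definition row_stab :: "nat list \<Rightarrow> perm set" where
  "row_stab \<mu> = {\<sigma> \<in> sym (sum_list \<mu>). \<forall>x<sum_list \<mu>. row_of \<mu> (\<sigma> x) = row_of \<mu> x}"

definition col_stab :: "nat list \<Rightarrow> perm set" where
  "col_stab \<mu> = {\<sigma> \<in> sym (sum_list \<mu>). \<forall>x<sum_list \<mu>. col_of \<mu> (\<sigma> x) = col_of \<mu> x}"

definition row_sym :: "nat list \<Rightarrow> perm \<Rightarrow> complex" where
  "row_sym \<mu> \<sigma> = (if \<sigma> \<in> row_stab \<mu> then 1 else 0)"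

definition col_antisym :: "nat list \<Rightarrow> perm \<Rightarrow> complex" where
  "col_antisym \<mu> \<sigma> = (if \<sigma> \<in> col_stab \<mu> then of_int (sign \<sigma>) else 0)"

definition young_symmetrizer :: "nat list \<Rightarrow> perm \<Rightarrow> complex" where
  "young_symmetrizer \<mu> = alg_mult (sum_list \<mu>) (row_sym \<mu>) (col_antisym \<mu>)"

text \<open>
  The irreducible representation \<open>[\<mu>]\<close> is the left ideal of the group algebra generated by the
  Young symmetrizer. In this convention \<open>[(N)]\<close> is the trivial representation and \<open>[(1\<^sup>N)]\<close> the sign
  representation. A permutation \<open>\<sigma>\<close> acts by left multiplication, that is by
  \<open>(\<sigma> \<cdot> f) \<tau> = f (\<sigma>\<^sup>-\<^sup>1 \<tau>)\<close>.
\<close>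

definition specht :: "nat list \<Rightarrow> (perm \<Rightarrow> complex) set" where
  "specht \<mu> =
     (\<lambda>f. alg_mult (sum_list \<mu>) f (young_symmetrizer \<mu>)) ` group_algebra (sum_list \<mu>)"


section \<open>Generalized Kronecker coefficients\<close>

text \<open>
  For subspaces \<open>V i\<close> of function spaces on a set \<open>X\<close>, the tensor product \<open>V 1 \<otimes> \<dots> \<otimes> V d\<close> is realized
  as the span of the products \<open>(x1, \<dots>, xd) \<mapsto> f1 x1 \<cdots> fd xd\<close> with \<open>fi \<in> V i\<close> inside the functions on
  \<open>X^d\<close>, the \<open>d\<close>-tuples being lists of length \<open>d\<close>. The group acts diagonally.
\<close>

definition pure_tensor :: "('x \<Rightarrow> complex) list \<Rightarrow> 'x list \<Rightarrow> complex" where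
  "pure_tensor fs xs =
     (if length xs = length fs then \<Prod>i<length fs. (fs ! i) (xs ! i) else 0)"

definition tensor_space :: "('x \<Rightarrow> complex) set list \<Rightarrow> ('x list \<Rightarrow> complex) set" where
  "tensor_space Vs =
     cfun.span {pure_tensor fs | fs. length fs = length Vs \<and> (\<forall>i<length Vs. fs ! i \<in> Vs ! i)}"

definition diag_act :: "perm \<Rightarrow> (perm list \<Rightarrow> complex) \<Rightarrow> (perm list \<Rightarrow> complex)" where
  "diag_act \<sigma> F = (\<lambda>\<tau>s. F (map (\<lambda>\<tau>. inv \<sigma> \<circ> \<tau>) \<tau>s))"

text \<open>
  The argument is a nonempty list of partitions of the same integer \<open>N\<close>, which is read off from the
  first of them.
\<close>

definition kronecker :: "nat list list \<Rightarrow> nat" where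
  "kronecker \<mu>s =
     multiplicity_rep (sym (sum_list (hd \<mu>s))) trivial_act trivial_space
       diag_act (tensor_space (map specht \<mu>s))"


section \<open>Unimodality\<close>

definition unimodal :: "int \<Rightarrow> int \<Rightarrow> (int \<Rightarrow> nat) \<Rightarrow> bool" where
  "unimodal p q x \<longleftrightarrow>
     (\<exists>r\<in>{p..q}. mono_on {p..r} x \<and> antimono_on {r..q} x)"

end

(*
Since d is odd, transposing all partitions turns the invariants of the d-fold tensor product of
Specht modules into the highest weight vectors of (sl_2)^d in the exterior power of degree N of
(C^2)^(tensor d), of a weight that rho_2 does not change while N grows by 2. For odd d this space of
dimension 2^d carries an invariant symplectic form, and the Lefschetz operator (multiplication with
the form) commutes with (sl_2)^d. Its commutator with its adjoint is 2^(d-1) - N in degree N, so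
the operator is injective for N < 2^(d-1) and its adjoint is injective for N > 2^(d-1).
*)
theory Submission
  imports Defs
begin

section \<open>Linear algebra of complex function spaces\<close>

text \<open>The obstacle is that multiplicity, Specht module and tensor product are defined by a
  decomposition, a left ideal and a span, which cannot be compared for different \<open>N\<close>.
  Each is first rewritten as a space of functions cut out by linear equations. In a two-column
  Specht module an element is the sign times a function \<open>h\<close> of the image of the first
  column, and the equations are the Garnir relations; dividing out the sign is the transposition of
  the partition. For \<open>d\<close> factors the column sets form the incidence matrix of a word of
  \<open>N\<close> subsets of \<open>{..<d}\<close>. The Garnir relation of factor \<open>i\<close>
  deletes one element from the \<open>i\<close>-th column, which is exactly the vanishing of
  \<open>raise i\<close>, and a column of length \<open>p + c\<close> among \<open>2 * p + c\<close>
  positions means weight \<open>c\<close>. Oddness is used twice: a product of \<open>d\<close>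
  equal signs is again that sign, which makes an invariant alternating, and a subset and its
  complement have opposite \<open>subset_sign\<close>, which makes the form skew. All sums run over
  ordered pairs and ordered words, hence the factors \<open>4\<close> and
  \<open>(N + 2) * (N + 1)\<close> in the Lefschetz relations.\<close>

abbreviation clinear :: "(('x \<Rightarrow> complex) \<Rightarrow> ('y \<Rightarrow> complex)) \<Rightarrow> bool" where
  "clinear \<equiv> Vector_Spaces.linear cscale cscale"

interpretation cfun_pair: vector_space_pair
  "cscale :: complex \<Rightarrow> ('x \<Rightarrow> complex) \<Rightarrow> ('x \<Rightarrow> complex)"
  "cscale :: complex \<Rightarrow> ('y \<Rightarrow> complex) \<Rightarrow> ('y \<Rightarrow> complex)"
  by unfold_locales

lemma cscale_apply [simp]: "cscale c f x = c * f x"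
  by (simp add: cscale_def)

lemma sum_fun_apply [simp]: "(\<Sum>i\<in>I. f i) x = (\<Sum>i\<in>I. f i x)"
  for f :: "'i \<Rightarrow> 'x \<Rightarrow> complex"
  by (induction I rule: infinite_finite_induct) auto

lemma clinearI:
  "(\<And>f g. T (f + g) = T f + T g) \<Longrightarrow> (\<And>c f. T (cscale c f) = cscale c (T f)) \<Longrightarrow> clinear T"
  unfolding Vector_Spaces.linear_iff by (intro conjI allI cfun.vector_space_axioms)

lemma clinear_add: "clinear T \<Longrightarrow> T (f + g) = T f + T g"
  and clinear_scale: "clinear T \<Longrightarrow> T (cscale c f) = cscale c (T f)"
  and clinear_zero: "clinear T \<Longrightarrow> T 0 = 0"
  and clinear_diff: "clinear T \<Longrightarrow> T (f - g) = T f - T g"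
  and clinear_sum: "clinear T \<Longrightarrow> T (\<Sum>i\<in>I. h i) = (\<Sum>i\<in>I. T (h i))"
  by (fact cfun_pair.linear_add cfun_pair.linear_scale cfun_pair.linear_0
      cfun_pair.linear_diff cfun_pair.linear_sum)+

definition finite_dim :: "('x \<Rightarrow> complex) set \<Rightarrow> bool" where
  "finite_dim V \<longleftrightarrow> (\<exists>S. finite S \<and> V \<subseteq> cfun.span S)"

lemma finite_dim_subset: "finite_dim W \<Longrightarrow> V \<subseteq> W \<Longrightarrow> finite_dim V"
  unfolding finite_dim_def by blast

lemma finite_dim_supported:
  assumes "finite X" "\<And>f x. f \<in> V \<Longrightarrow> f x \<noteq> 0 \<Longrightarrow> x \<in> X"
  shows "finite_dim V"
  unfolding finite_dim_def
proof (intro exI conjI subsetI)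
  let ?S = "(\<lambda>x y. if y = x then 1 else 0) ` X :: ('a \<Rightarrow> complex) set"
  show "finite ?S"
    using assms(1) by simp
  fix f assume "f \<in> V"
  have "f = (\<Sum>x\<in>X. cscale (f x) (\<lambda>y. if y = x then 1 else 0))"
  proof
    fix y
    have "(\<Sum>x\<in>X. f x * (if y = x then 1 else 0)) = (\<Sum>x\<in>X. if y = x then f x else 0)"
      by (intro sum.cong) auto
    then show "f y = (\<Sum>x\<in>X. cscale (f x) (\<lambda>y. if y = x then 1 else 0)) y"
      using assms(1) assms(2)[OF \<open>f \<in> V\<close>, of y] by auto
  qed
  also have "\<dots> \<in> cfun.span ?S"
    by (intro cfun.span_sum cfun.span_scale cfun.span_base) auto
  finally show "f \<in> cfun.span ?S" .
qed

lemma finite_independent: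
  assumes "finite_dim V" "B \<subseteq> V" "cfun.independent B"
  shows "finite B"
  using assms cfun.independent_span_bound unfolding finite_dim_def by blast

lemma finite_dim_basis:
  assumes "finite_dim V" "cfun.subspace V"
  obtains B where "finite B" "B \<subseteq> V" "cfun.independent B" "cfun.span B = V" "card B = cfun.dim V"
proof -
  obtain B where B: "B \<subseteq> V" "cfun.independent B" "V \<subseteq> cfun.span B" "card B = cfun.dim V"
    using cfun.basis_exists[of V] by blast
  moreover have "cfun.span B = V"
    using B assms(2) by (meson cfun.span_subspace)
  ultimately show ?thesis
    using that finite_independent[OF assms(1)] by blast
qed

lemma dim_mono_fun:
  assumes "finite_dim W" "V \<subseteq> W" "cfun.subspace W"
  shows "cfun.dim V \<le> cfun.dim W"
proof -
  obtain B where "finite B" "cfun.span B = W" "card B = cfun.dim W"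
    using finite_dim_basis[OF assms(1,3)] by blast
  then show ?thesis
    using cfun.dim_le_card[of V B] assms(2) by simp
qed

lemma subspace_dim_eq:
  assumes "finite_dim W" "V \<subseteq> W" "cfun.subspace V" "cfun.subspace W" "cfun.dim W \<le> cfun.dim V"
  shows "V = W"
proof (rule ccontr)
  assume "V \<noteq> W"
  then obtain w where w: "w \<in> W" "w \<notin> V"
    using assms(2) by blast
  obtain B where B: "finite B" "B \<subseteq> V" "cfun.independent B" "cfun.span B = V" "card B = cfun.dim V"
    using finite_dim_basis[OF finite_dim_subset[OF assms(1,2)] assms(3)] by blast
  obtain C where C: "finite C" "cfun.span C = W" "card C = cfun.dim W"
    using finite_dim_basis[OF assms(1,4)] by blast
  have "cfun.independent (insert w B)"
    using B w by (intro cfun.independent_insertI) auto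
  moreover have "insert w B \<subseteq> cfun.span C"
    using B C w assms(2) by auto
  ultimately have "card (insert w B) \<le> card C"
    using C(1) cfun.independent_span_bound by blast
  moreover have "w \<notin> B"
    using B w by blast
  ultimately show False
    using B C assms(5) by simp
qed

lemma dim_image_inj:
  assumes "clinear T" "cfun.subspace V" "inj_on T V"
  shows "cfun.dim (T ` V) = cfun.dim V"
proof -
  obtain B where B: "B \<subseteq> V" "cfun.independent B" "V \<subseteq> cfun.span B" "card B = cfun.dim V"
    using cfun.basis_exists[of V] by blast
  have span: "cfun.span B = V"
    using B assms(2) by (meson cfun.span_subspace)
  have "cfun.independent (T ` B)"
    using cfun_pair.linear_independent_injective_image[OF assms(1) B(2)] assms(3) span by simp
  moreover have "cfun.span (T ` B) = T ` V"
    using cfun_pair.linear_span_image[OF assms(1), of B] span by simp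
  ultimately have "cfun.dim (T ` V) = card (T ` B)"
    using cfun.dim_eq_card by (metis cfun.span_span)
  also have "\<dots> = card B"
    using assms(3) B(1) by (meson card_image inj_on_subset)
  finally show ?thesis
    using B(4) by simp
qed

lemma dim_le_of_injective:
  assumes "clinear T" "cfun.subspace V" "inj_on T V" "T ` V \<subseteq> W" "finite_dim W" "cfun.subspace W"
  shows "cfun.dim V \<le> cfun.dim W"
  using dim_mono_fun[OF assms(5,4,6)] dim_image_inj[OF assms(1-3)] by simp

section \<open>The multiplicity of the trivial representation\<close>

lemma finite_sym [simp]: "finite (sym N)"
  by (simp add: sym_def finite_permutations)

lemma sym_id [simp]: "id \<in> sym N"
  by (simp add: sym_def permutes_id)

lemma sym_comp: "g \<in> sym N \<Longrightarrow> h \<in> sym N \<Longrightarrow> g \<circ> h \<in> sym N"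
  by (simp add: sym_def permutes_compose)

lemma sym_inv: "g \<in> sym N \<Longrightarrow> inv g \<in> sym N"
  by (simp add: sym_def permutes_inv)

lemma sym_bij: "g \<in> sym N \<Longrightarrow> bij g"
  unfolding sym_def by (metis mem_Collect_eq permutes_bij)

lemma sym_inv_comp: "g \<in> sym N \<Longrightarrow> inv g \<circ> g = id" and sym_comp_inv: "g \<in> sym N \<Longrightarrow> g \<circ> inv g = id"
  using sym_bij[of g N] by (auto simp: bij_is_inj inv_o_cancel bij_is_surj surj_iff[symmetric])

lemma sym_inv_inv: "g \<in> sym N \<Longrightarrow> inv (inv g) = g"
  using sym_bij inv_inv_eq by blast

lemma sum_sym_comp_left:
  assumes "h \<in> sym N"
  shows "(\<Sum>g\<in>sym N. F (h \<circ> g)) = (\<Sum>g\<in>sym N. F g)"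
  by (rule sum.reindex_bij_witness[of _ "\<lambda>g. inv h \<circ> g" "\<lambda>g. h \<circ> g"])
    (use assms in \<open>auto simp: sym_comp sym_inv o_assoc sym_inv_comp sym_comp_inv\<close>)

definition fixed_space ::
    "'g set \<Rightarrow> ('g \<Rightarrow> ('x \<Rightarrow> complex) \<Rightarrow> ('x \<Rightarrow> complex)) \<Rightarrow> ('x \<Rightarrow> complex) set \<Rightarrow> ('x \<Rightarrow> complex) set"
  where "fixed_space G act V = {v\<in>V. \<forall>g\<in>G. act g v = v}"

locale sym_action =
  fixes N :: nat and act :: "perm \<Rightarrow> ('x \<Rightarrow> complex) \<Rightarrow> ('x \<Rightarrow> complex)"
  assumes act_linear: "g \<in> sym N \<Longrightarrow> clinear (act g)"
    and act_id: "act id v = v"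
    and act_comp: "g \<in> sym N \<Longrightarrow> h \<in> sym N \<Longrightarrow> act (g \<circ> h) v = act g (act h v)"
begin

definition invariant :: "('x \<Rightarrow> complex) set \<Rightarrow> bool" where
  "invariant V \<longleftrightarrow> cfun.subspace V \<and> (\<forall>g\<in>sym N. \<forall>v\<in>V. act g v \<in> V)"

lemma subrep_iff: "subrep (sym N) act V W \<longleftrightarrow> invariant W \<and> W \<subseteq> V"
  unfolding subrep_def invariant_def by blast

text \<open>The average \<open>q\<close> over the group of the conjugates of a linear projection
  onto \<open>W\<close> is an equivariant projection onto \<open>W\<close>; its kernel in
  \<open>V\<close> is the complement.\<close>

lemma maschke:
  assumes "invariant W" "invariant V" "W \<subseteq> V"
  obtains U where "invariant U" "U \<subseteq> V" "W \<inter> U = {0}" "\<And>v. v \<in> V \<Longrightarrow> \<exists>w\<in>W. \<exists>u\<in>U. v = w + u"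
proof -
  have sW: "cfun.subspace W" and sV: "cfun.subspace V"
    using assms by (auto simp: invariant_def)
  \<comment> \<open>The identity of \<open>W\<close> has a linear left inverse with values in
    \<open>W\<close>: a projection onto \<open>W\<close>, not yet equivariant.\<close>
  obtain p where p: "range p \<subseteq> W" "clinear p" "\<And>v. v \<in> W \<Longrightarrow> p v = v"
    using cfun_pair.linear_exists_left_inverse_on[of "\<lambda>x. x" W] sW
    using clinearI[of "\<lambda>x. x"] by auto
  define q where "q v = cscale (1 / of_nat (card (sym N))) (\<Sum>g\<in>sym N. act g (p (act (inv g) v)))" for v
  have q_lin: "clinear q"
  proof (rule clinearI)
    fix f g
    have "act h (p (act (inv h) (f + g))) = act h (p (act (inv h) f)) + act h (p (act (inv h) g))"
      if "h \<in> sym N" for h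
      using clinear_add[OF act_linear] clinear_add[OF p(2)] that sym_inv by metis
    then show "q (f + g) = q f + q g"
      by (simp add: q_def sum.distrib cfun.scale_right_distrib)
  next
    fix c f
    have "act h (p (act (inv h) (cscale c f))) = cscale c (act h (p (act (inv h) f)))"
      if "h \<in> sym N" for h
      using clinear_scale[OF act_linear] clinear_scale[OF p(2)] that sym_inv by metis
    then show "q (cscale c f) = cscale c (q f)"
      by (simp add: q_def cfun.scale_sum_right mult.commute)
  qed
  have q_in: "q v \<in> W" for v
    unfolding q_def using assms(1) p(1)
    by (intro cfun.subspace_scale sW cfun.subspace_sum) (auto simp: invariant_def)
  have q_W: "q v = v" if "v \<in> W" for v
  proof -
    have "act g (p (act (inv g) v)) = v" if "g \<in> sym N" for g
    proof -
      have "act (inv g) v \<in> W"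
        using assms(1) that \<open>v \<in> W\<close> sym_inv unfolding invariant_def by blast
      then have "act g (p (act (inv g) v)) = act (g \<circ> inv g) v"
        using p(3) act_comp that sym_inv by metis
      then show ?thesis
        using sym_comp_inv[OF that] act_id by simp
    qed
    then have "q v = cscale (1 / of_nat (card (sym N))) (\<Sum>g\<in>sym N. v)"
      by (simp add: q_def)
    moreover have "card (sym N) \<noteq> 0"
      using sym_id[of N] finite_sym[of N] by (metis card_0_eq empty_iff)
    ultimately show ?thesis
      by (simp only: cfun.sum_constant_scale cfun.scale_scale) simp
  qed
  have q_act: "q (act h v) = act h (q v)" if h: "h \<in> sym N" for h v
  proof -
    have "(\<Sum>g\<in>sym N. act g (p (act (inv g) (act h v)))) =
        (\<Sum>g\<in>sym N. act (h \<circ> g) (p (act (inv (h \<circ> g)) (act h v))))"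
      using sum_sym_comp_left[OF h, of "\<lambda>g. act g (p (act (inv g) (act h v)))"] by simp
    also have "\<dots> = (\<Sum>g\<in>sym N. act h (act g (p (act (inv g) v))))"
    proof (rule sum.cong[OF refl])
      fix g assume g: "g \<in> sym N"
      have "inv (h \<circ> g) = inv g \<circ> inv h"
        using sym_bij g h o_inv_distrib by blast
      then have "act (inv (h \<circ> g)) (act h v) = act (inv g) (act (inv h \<circ> h) v)"
        using act_comp g h sym_inv by (metis sym_comp)
      then show "act (h \<circ> g) (p (act (inv (h \<circ> g)) (act h v))) = act h (act g (p (act (inv g) v)))"
        using act_comp g h sym_inv_comp act_id by metis
    qed
    finally show ?thesis
      unfolding q_def using clinear_scale[OF act_linear[OF h]] clinear_sum[OF act_linear[OF h]]
      by metis
  qed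
  define U where "U = {v\<in>V. q v = 0}"
  have "cfun.subspace U"
    unfolding cfun.subspace_def U_def
    using sV clinear_add[OF q_lin] clinear_scale[OF q_lin] clinear_zero[OF q_lin]
    by (auto simp: cfun.subspace_def)
  moreover have "act g v \<in> U" if "g \<in> sym N" "v \<in> U" for g v
    using that assms(2) q_act clinear_zero[OF act_linear[OF that(1)]]
    unfolding U_def invariant_def by auto
  ultimately have "invariant U"
    by (simp add: invariant_def)
  moreover have "W \<inter> U = {0}"
    using q_W cfun.subspace_0[OF sW] cfun.subspace_0[OF \<open>cfun.subspace U\<close>] by (auto simp: U_def)
  moreover have "\<exists>w\<in>W. \<exists>u\<in>U. v = w + u" if "v \<in> V" for v
  proof (intro bexI)
    show "v = q v + (v - q v)"
      by simp
    have "q v \<in> V"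
      using q_in assms(3) by blast
    then show "v - q v \<in> U"
      using that cfun.subspace_diff[OF sV] clinear_diff[OF q_lin] q_W[OF q_in] by (simp add: U_def)
  qed (rule q_in)
  ultimately show ?thesis
    using that[of U] by (auto simp: U_def)
qed

lemma irreducible_iff:
  "irreducible_rep (sym N) act W \<longleftrightarrow>
    W \<noteq> {0} \<and> (\<forall>U. invariant U \<and> U \<subseteq> W \<longrightarrow> U = {0} \<or> U = W)"
  by (simp add: irreducible_rep_def subrep_iff)

text \<open>A nonzero invariant subspace of least dimension is irreducible; \<open>maschke\<close>
  splits it off and leaves a complement of smaller dimension. It becomes the last summand, so that
  the indices from the induction hypothesis stay unchanged.\<close>

lemma exists_decomposition:
  assumes "finite_dim V" "invariant V"
  shows "\<exists>k W. irreducible_decomposition (sym N) act V k W"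
  using assms
proof (induction "cfun.dim V" arbitrary: V rule: less_induct)
  case less
  have sV: "cfun.subspace V"
    using less.prems by (simp add: invariant_def)
  show ?case
  proof (cases "V = {0}")
    case True
    then have "irreducible_decomposition (sym N) act V 0 (\<lambda>_. {})"
      by (auto simp: irreducible_decomposition_def bij_betw_def)
    then show ?thesis
      by blast
  next
    case False
    define P where "P W \<longleftrightarrow> invariant W \<and> W \<subseteq> V \<and> W \<noteq> {0}" for W
    have "P V"
      using False less.prems by (simp add: P_def)
    then obtain W0 where W0: "P W0" "\<And>W. P W \<Longrightarrow> cfun.dim W0 \<le> cfun.dim W"
      using ex_has_least_nat[of P V cfun.dim] by blast
    have sW0: "cfun.subspace W0"
      using W0(1) by (simp add: P_def invariant_def)
    have irr: "irreducible_rep (sym N) act W0"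
      unfolding irreducible_iff
    proof (intro conjI allI impI)
      show "W0 \<noteq> {0}"
        using W0 by (simp add: P_def)
      fix U assume U: "invariant U \<and> U \<subseteq> W0"
      show "U = {0} \<or> U = W0"
      proof (cases "U = {0}")
        case False
        then have "P U"
          using U W0(1) unfolding P_def by blast
        then have "U = W0"
          using U W0 sW0 less.prems finite_dim_subset
          by (intro subspace_dim_eq) (auto simp: P_def invariant_def intro: finite_dim_subset)
        then show ?thesis ..
      qed simp
    qed
    obtain U where U: "invariant U" "U \<subseteq> V" "W0 \<inter> U = {0}"
      "\<And>v. v \<in> V \<Longrightarrow> \<exists>w\<in>W0. \<exists>u\<in>U. v = w + u"
      using maschke[of W0 V] W0(1) less.prems unfolding P_def by blast
    have sU: "cfun.subspace U"
      using U by (simp add: invariant_def)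
    have "U \<noteq> V"
      using U(3) W0(1) unfolding P_def by blast
    then have "cfun.dim U < cfun.dim V"
      using subspace_dim_eq[OF less.prems(1) U(2) sU sV] by linarith
    then obtain k W where "irreducible_decomposition (sym N) act U k W"
      using less.hyps[of U] U finite_dim_subset less.prems(1) by blast
    then have W: "\<And>j. j < k \<Longrightarrow> invariant (W j) \<and> W j \<subseteq> U \<and> irreducible_rep (sym N) act (W j)"
      and bij: "bij_betw (\<lambda>w. \<Sum>j<k. w j) (PiE {..<k} W) U"
      by (auto simp: irreducible_decomposition_def subrep_iff)
    define W' where "W' = W(k := W0)"
    have W'_lt: "W' j = W j" if "j < k" for j
      using that by (simp add: W'_def)
    have restr: "restrict w {..<k} \<in> PiE {..<k} W" "(\<Sum>j<k. restrict w {..<k} j) = (\<Sum>j<k. w j)"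
       "w k \<in> W0" "(\<Sum>j<k. w j) \<in> U"
      if "w \<in> PiE {..<Suc k} W'" for w
    proof -
      show *: "restrict w {..<k} \<in> PiE {..<k} W"
        using that W'_lt by (fastforce simp: PiE_iff)
      show **: "(\<Sum>j<k. restrict w {..<k} j) = (\<Sum>j<k. w j)"
        by (intro sum.cong) auto
      show "w k \<in> W0"
        using PiE_mem[OF that, of k] by (simp add: W'_def)
      show "(\<Sum>j<k. w j) \<in> U"
        using bij_betwE[OF bij] * ** by (metis (no_types, lifting))
    qed
    have "bij_betw (\<lambda>w. \<Sum>j<Suc k. w j) (PiE {..<Suc k} W') V"
      unfolding bij_betw_def
    proof (intro conjI inj_onI subset_antisym subsetI)
      fix w w' assume w: "w \<in> PiE {..<Suc k} W'" "w' \<in> PiE {..<Suc k} W'"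
        and eq: "(\<Sum>j<Suc k. w j) = (\<Sum>j<Suc k. w' j)"
      have "w k - w' k = (\<Sum>j<k. w' j) - (\<Sum>j<k. w j)"
        using eq by (simp add: algebra_simps)
      moreover have "w k - w' k \<in> W0"
        by (intro cfun.subspace_diff[OF sW0] restr(3) w)
      moreover have "(\<Sum>j<k. w' j) - (\<Sum>j<k. w j) \<in> U"
        by (intro cfun.subspace_diff[OF sU] restr(4) w)
      ultimately have "w k - w' k \<in> W0 \<inter> U"
        by simp
      then have wk: "w k = w' k"
        using U(3) by simp
      then have "(\<Sum>j<k. w j) = (\<Sum>j<k. w' j)"
        using eq by simp
      then have "restrict w {..<k} = restrict w' {..<k}"
        using restr[OF w(1)] restr[OF w(2)] bij unfolding bij_betw_def inj_on_def
        by (metis (no_types, lifting))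
      then have "w j = w' j" if "j < k" for j
        using that by (metis lessThan_iff restrict_apply')
      then show "w = w'"
        using w wk by (intro PiE_ext[OF w]) (auto simp: less_Suc_eq)
    next
      fix v assume "v \<in> (\<lambda>w. \<Sum>j<Suc k. w j) ` PiE {..<Suc k} W'"
      then obtain w where w: "w \<in> PiE {..<Suc k} W'" "v = (\<Sum>j<k. w j) + w k"
        by auto
      then show "v \<in> V"
        unfolding w(2) using restr(3,4)[OF w(1)] U(2) W0(1)
        by (intro cfun.subspace_add[OF sV]) (auto simp: P_def)
    next
      fix v assume "v \<in> V"
      then obtain u w0 where u: "w0 \<in> W0" "u \<in> U" "v = w0 + u"
        using U(4) by blast
      then obtain w where w: "w \<in> PiE {..<k} W" "u = (\<Sum>j<k. w j)"
        using bij by (auto simp: bij_betw_def)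
      have "w(k := w0) \<in> PiE {..<Suc k} W'"
        using w u by (auto simp: PiE_iff W'_def extensional_def less_Suc_eq)
      moreover have "v = (\<Sum>j<Suc k. (w(k := w0)) j)"
        using w u by simp
      ultimately show "v \<in> (\<lambda>w. \<Sum>j<Suc k. w j) ` PiE {..<Suc k} W'"
        by blast
    qed
    moreover have "subrep (sym N) act V (W' j) \<and> irreducible_rep (sym N) act (W' j)"
      if "j < Suc k" for j
      using that W W0(1) U(2) irr by (auto simp: less_Suc_eq W'_def subrep_iff P_def)
    ultimately show ?thesis
      unfolding irreducible_decomposition_def by blast
  qed
qed

text \<open>A nonzero fixed vector spans an invariant line, which fills an irreducible
  \<open>W\<close>. Conversely an isomorphism to the trivial representation forces every vector of
  \<open>W\<close> to be fixed.\<close>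

lemma irreducible_trivial_iff:
  assumes "invariant W" "irreducible_rep (sym N) act W"
  shows "rep_iso (sym N) act W trivial_act trivial_space \<longleftrightarrow>
    (\<exists>e\<in>fixed_space (sym N) act W. e \<noteq> 0 \<and> W = range (\<lambda>c. cscale c e))"
    and "e \<in> fixed_space (sym N) act W \<Longrightarrow> e \<noteq> 0 \<Longrightarrow> W = range (\<lambda>c. cscale c e)"
proof -
  have sW: "cfun.subspace W"
    using assms by (simp add: invariant_def)
  show *: "W = range (\<lambda>c. cscale c e)" if e: "e \<in> fixed_space (sym N) act W" "e \<noteq> 0" for e
  proof -
    have line: "range (\<lambda>c. cscale c e) = cfun.span {e}"
      by (simp add: cfun.span_singleton)
    have "act g (cscale c e) = cscale c e" if "g \<in> sym N" for g c
      using e clinear_scale[OF act_linear[OF that]] that unfolding fixed_space_def by simp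
    then have "act g v \<in> cfun.span {e}" if "g \<in> sym N" "v \<in> cfun.span {e}" for g v
      using that unfolding line[symmetric] by (metis (mono_tags, lifting) imageE rangeI)
    then have "invariant (cfun.span {e})"
      by (simp add: invariant_def)
    moreover have "cfun.span {e} \<subseteq> W"
      using e sW by (intro cfun.span_minimal) (auto simp: fixed_space_def)
    moreover have "cfun.span {e} \<noteq> {0}"
      using e(2) cfun.span_base[of e "{e}"] by blast
    ultimately show ?thesis
      using assms(2) line unfolding irreducible_iff by blast
  qed
  show "rep_iso (sym N) act W trivial_act trivial_space \<longleftrightarrow>
    (\<exists>e\<in>fixed_space (sym N) act W. e \<noteq> 0 \<and> W = range (\<lambda>c. cscale c e))"
  proof
    assume "rep_iso (sym N) act W trivial_act trivial_space"
    then obtain \<phi> where bij: "bij_betw \<phi> W (UNIV :: (unit \<Rightarrow> complex) set)"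
      and sc: "\<And>c v. v \<in> W \<Longrightarrow> \<phi> (cscale c v) = cscale c (\<phi> v)"
      and tr: "\<And>g v. g \<in> sym N \<Longrightarrow> v \<in> W \<Longrightarrow> \<phi> (act g v) = \<phi> v"
      unfolding rep_iso_def trivial_act_def trivial_space_def by blast
    have inj: "inj_on \<phi> W"
      using bij by (simp add: bij_betw_def)
    obtain e where e: "e \<in> W" "\<phi> e = (\<lambda>_. 1)"
      using bij by (metis UNIV_I bij_betw_def imageE)
    have fixed: "act g v = v" if "g \<in> sym N" "v \<in> W" for g v
      using inj tr[OF that] that assms(1) unfolding inj_on_def invariant_def by blast
    have "e \<noteq> 0"
    proof
      assume "e = 0"
      then have "\<phi> e = cscale 0 (\<phi> e)"
        using sc[OF e(1), of 0] by (simp del: cscale_apply)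
      then show False
        using e(2) by (simp add: fun_eq_iff)
    qed
    moreover have "e \<in> fixed_space (sym N) act W"
      using e(1) fixed by (simp add: fixed_space_def)
    ultimately show "\<exists>e\<in>fixed_space (sym N) act W. e \<noteq> 0 \<and> W = range (\<lambda>c. cscale c e)"
      using * by blast
  next
    assume "\<exists>e\<in>fixed_space (sym N) act W. e \<noteq> 0 \<and> W = range (\<lambda>c. cscale c e)"
    then obtain e where e: "e \<in> fixed_space (sym N) act W" "e \<noteq> 0" "W = range (\<lambda>c. cscale c e)"
      by blast
    obtain x where x: "e x \<noteq> 0"
      using e(2) by (auto simp: fun_eq_iff)
    \<comment> \<open>The coordinate along \<open>e\<close>, read off at one point \<open>x\<close>
      where \<open>e\<close> does not vanish.\<close>
    define \<phi> where "\<phi> v = (\<lambda>_ :: unit. v x / e x)" for v :: "'x \<Rightarrow> complex"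
    have \<phi>: "\<phi> (cscale c e) = (\<lambda>_. c)" for c
      using x by (simp add: \<phi>_def)
    have "bij_betw \<phi> W UNIV"
      unfolding bij_betw_def
    proof
      show "inj_on \<phi> W"
        using \<phi> unfolding e(3) inj_on_def by (metis (no_types, lifting) rangeE)
      have "f = \<phi> (cscale (f ()) e)" for f
        unfolding \<phi> by (simp add: fun_eq_iff)
      then show "\<phi> ` W = UNIV"
        unfolding e(3) by blast
    qed
    moreover have "act g v = v" if "g \<in> sym N" "v \<in> W" for g v
      using that e clinear_scale[OF act_linear[OF that(1)]] by (auto simp: fixed_space_def)
    ultimately show "rep_iso (sym N) act W trivial_act trivial_space"
      unfolding rep_iso_def trivial_act_def trivial_space_def
      by (intro exI[of _ \<phi>]) (auto simp: \<phi>_def fun_eq_iff add_divide_distrib)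
  qed
qed

text \<open>One fixed vector per trivial summand gives a basis of the fixed space: components are
  unique, so the components of a fixed vector are fixed, and a nonzero one can occur only in a
  trivial summand. As the right-hand side does not mention \<open>W\<close>, the count is the same
  for every decomposition.\<close>

lemma decomposition_count:
  assumes "invariant V" "irreducible_decomposition (sym N) act V k W"
  shows "card {j. j < k \<and> rep_iso (sym N) act (W j) trivial_act trivial_space} =
    cfun.dim (fixed_space (sym N) act V)"
proof -
  have sV: "cfun.subspace V"
    using assms(1) by (simp add: invariant_def)
  have W: "\<And>j. j < k \<Longrightarrow> invariant (W j)" "\<And>j. j < k \<Longrightarrow> W j \<subseteq> V"
      "\<And>j. j < k \<Longrightarrow> irreducible_rep (sym N) act (W j)"
    and bij: "bij_betw (\<lambda>w. \<Sum>j<k. w j) (PiE {..<k} W) V"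
    using assms(2) by (auto simp: irreducible_decomposition_def subrep_iff)
  have sW: "\<And>j. j < k \<Longrightarrow> cfun.subspace (W j)"
    using W(1) by (simp add: invariant_def)
  \<comment> \<open>\<open>PiE\<close> contains only extensional functions, so uniqueness is carried
    over to arbitrary families by restriction.\<close>
  have uniq: "w j = w' j" if "\<And>j. j < k \<Longrightarrow> w j \<in> W j" "\<And>j. j < k \<Longrightarrow> w' j \<in> W j"
    "(\<Sum>j<k. w j) = (\<Sum>j<k. w' j)" "j < k" for w w' j
  proof -
    have "(\<Sum>j<k. restrict w {..<k} j) = (\<Sum>j<k. restrict w' {..<k} j)"
      using that(3) by simp
    moreover have "restrict w {..<k} \<in> PiE {..<k} W" "restrict w' {..<k} \<in> PiE {..<k} W"
      using that by auto
    ultimately have "restrict w {..<k} = restrict w' {..<k}"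
      using bij unfolding bij_betw_def inj_on_def by blast
    then show ?thesis
      using that(4) by (metis lessThan_iff restrict_apply')
  qed
  define J where "J = {j. j < k \<and> rep_iso (sym N) act (W j) trivial_act trivial_space}"
  have "\<forall>j\<in>J. \<exists>e. e \<in> fixed_space (sym N) act (W j) \<and> e \<noteq> 0 \<and> W j = range (\<lambda>c. cscale c e)"
    using irreducible_trivial_iff(1) W unfolding J_def by blast
  then obtain e where e: "\<And>j. j \<in> J \<Longrightarrow> e j \<in> fixed_space (sym N) act (W j)"
     "\<And>j. j \<in> J \<Longrightarrow> e j \<noteq> 0" "\<And>j. j \<in> J \<Longrightarrow> W j = range (\<lambda>c. cscale c (e j))"
    by metis
  have J: "J \<subseteq> {..<k}" "finite J"
    by (auto simp: J_def)
  have zero: "c j = 0" if "(\<Sum>j\<in>J. cscale (c j) (e j)) = 0" "j \<in> J" for c j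
  proof -
    let ?w = "\<lambda>j. if j \<in> J then cscale (c j) (e j) else 0"
    have "(\<Sum>j<k. ?w j) = (\<Sum>j\<in>J. cscale (c j) (e j))"
      using J by (simp add: sum.If_cases Int_absorb1)
    moreover have "?w j \<in> W j" if "j < k" for j
      using that e(3)[of j] sW[OF that] cfun.subspace_0 by auto
    ultimately have "?w j = (\<lambda>_. 0) j"
      using uniq[of ?w "\<lambda>_. 0" j] that J cfun.subspace_0[OF sW] by auto
    then show ?thesis
      using that(2) e(2) by (auto simp: cfun.scale_eq_0_iff simp del: cscale_apply)
  qed
  have inj: "inj_on e J"
  proof (rule inj_onI, rule ccontr)
    fix i j assume ij: "i \<in> J" "j \<in> J" "e i = e j" "i \<noteq> j"
    let ?c = "\<lambda>l. if l = i then 1 else if l = j then -1 else (0 :: complex)"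
    have "(\<Sum>l\<in>J. cscale (?c l) (e l)) = (\<Sum>l\<in>J. if l = i then e i else 0) - (\<Sum>l\<in>J. if l = j then e j else 0)"
      unfolding sum_subtractf[symmetric] using ij(4) by (intro sum.cong) auto
    also have "\<dots> = 0"
      using J ij by simp
    finally show False
      using zero[of ?c i] ij(1) by simp
  qed
  have ind: "cfun.independent (e ` J)"
  proof (rule cfun.independent_if_scalars_zero)
    fix f x assume 0: "(\<Sum>x\<in>e ` J. cscale (f x) x) = 0" and "x \<in> e ` J"
    then obtain j where "j \<in> J" "x = e j"
      by blast
    then show "f x = 0"
      using zero[of "\<lambda>j. f (e j)" j] 0 inj by (simp add: sum.reindex)
  qed (use J in simp)
  have sub: "cfun.subspace (fixed_space (sym N) act V)"
    unfolding cfun.subspace_def fixed_space_def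
    using sV clinear_add[OF act_linear] clinear_scale[OF act_linear] clinear_zero[OF act_linear]
    by (auto simp: cfun.subspace_def)
  have "cfun.span (e ` J) = fixed_space (sym N) act V"
  proof (intro cfun.span_subspace sub subsetI)
    fix v assume "v \<in> e ` J"
    then show "v \<in> fixed_space (sym N) act V"
      using e(1) W(2) J(1) unfolding fixed_space_def by blast
  next
    fix v assume v: "v \<in> fixed_space (sym N) act V"
    then have "v \<in> (\<lambda>w. \<Sum>j<k. w j) ` PiE {..<k} W"
      using bij by (simp add: bij_betw_def fixed_space_def)
    then obtain w where w: "w \<in> PiE {..<k} W" "v = (\<Sum>j<k. w j)"
      by blast
    have wW: "w j \<in> W j" if "j < k" for j
      using w(1) that by auto
    have fixed: "act g (w j) = w j" if "g \<in> sym N" "j < k" for g j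
    proof (rule uniq[OF _ wW _ that(2)])
      show "act g (w j) \<in> W j" if "j < k" for j
        using W(1)[OF that] wW[OF that] \<open>g \<in> sym N\<close> by (simp add: invariant_def)
      show "(\<Sum>j<k. act g (w j)) = (\<Sum>j<k. w j)"
        using clinear_sum[OF act_linear[OF that(1)], of w "{..<k}"] v that(1)
        unfolding fixed_space_def w(2) by simp
    qed
    have "w j \<in> cfun.span (e ` J)" if "j < k" for j
    proof (cases "w j = 0")
      case False
      have "w j \<in> fixed_space (sym N) act (W j)"
        using fixed that wW by (simp add: fixed_space_def)
      then have "j \<in> J"
        using irreducible_trivial_iff[OF W(1,3)[OF that]] False that unfolding J_def by blast
      have "w j \<in> range (\<lambda>c. cscale c (e j))"
        using wW[OF that] unfolding e(3)[OF \<open>j \<in> J\<close>] .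
      then obtain c where "w j = cscale c (e j)"
        by blast
      then show ?thesis
        using \<open>j \<in> J\<close> by (simp add: cfun.span_base cfun.span_scale del: cscale_apply)
    qed (simp add: cfun.span_zero)
    then show "v \<in> cfun.span (e ` J)"
      unfolding w(2) by (intro cfun.span_sum) auto
  qed
  then have "cfun.dim (fixed_space (sym N) act V) = card (e ` J)"
    using cfun.dim_span_eq_card_independent[OF ind] by simp
  then show ?thesis
    using inj by (simp add: card_image J_def)
qed

lemma multiplicity_trivial:
  assumes "finite_dim V" "invariant V"
  shows "multiplicity_rep (sym N) trivial_act trivial_space act V =
    cfun.dim (fixed_space (sym N) act V)"
  unfolding multiplicity_rep_def
proof (rule the_equality)
  obtain k W where "irreducible_decomposition (sym N) act V k W"
    using exists_decomposition[OF assms] by blast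
  then show "\<exists>k W. irreducible_decomposition (sym N) act V k W \<and>
      cfun.dim (fixed_space (sym N) act V) =
      card {j. j < k \<and> rep_iso (sym N) act (W j) trivial_act trivial_space}"
    using decomposition_count[OF assms(2)] by (intro exI[of _ k] exI[of _ W]) simp
next
  fix r assume "\<exists>k W. irreducible_decomposition (sym N) act V k W \<and>
      r = card {j. j < k \<and> rep_iso (sym N) act (W j) trivial_act trivial_space}"
  then show "r = cfun.dim (fixed_space (sym N) act V)"
    using decomposition_count[OF assms(2)] by (elim exE conjE) simp
qed

end

section \<open>Specht modules of two-column shape\<close>

definition two_col_shape :: "nat \<Rightarrow> nat \<Rightarrow> nat list" where
  "two_col_shape p c = replicate p 2 @ replicate c 1"

text \<open>The tableau is filled row by row starting with 0, so in the \<open>p\<close> rows of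
  length 2 the first entry is the even one, while the entries from \<open>2 * p\<close> on are alone
  in their rows.\<close>

definition first_col :: "nat \<Rightarrow> nat \<Rightarrow> nat set" where
  "first_col p c = {x. x < 2 * p + c \<and> (x < 2 * p \<longrightarrow> even x)}"

definition row_partner :: "nat \<Rightarrow> nat \<Rightarrow> nat" where
  "row_partner p x = (if x < 2 * p then if even x then x + 1 else x - 1 else x)"

text \<open>
  An element of a Specht module is, up to the sign, a function \<open>h\<close> of the set of entries in the first
  column; these are the Garnir relations in terms of \<open>h\<close>.
\<close>

definition garnir :: "nat \<Rightarrow> nat \<Rightarrow> (nat set \<Rightarrow> complex) \<Rightarrow> bool" where
  "garnir N q h \<longleftrightarrow> (\<forall>S. S \<subseteq> {..<N} \<and> card S = Suc q \<longrightarrow> (\<Sum>s\<in>S. h (S - {s})) = 0)"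

abbreviation csign :: "perm \<Rightarrow> complex" where
  "csign \<sigma> \<equiv> of_int (sign \<sigma>)"

lemma sym_permutation: "g \<in> sym N \<Longrightarrow> permutation g"
  unfolding sym_def permutation_permutes by blast

lemma csign_comp: "g \<in> sym N \<Longrightarrow> h \<in> sym N \<Longrightarrow> csign (g \<circ> h) = csign g * csign h"
  by (simp add: sign_compose sym_permutation)

lemma csign_inv: "g \<in> sym N \<Longrightarrow> csign (inv g) = csign g"
  by (simp add: sign_inverse sym_permutation)

lemma csign_square [simp]: "csign g * csign g = 1"
  by (metis of_int_1 of_int_mult sign_idempotent)

lemma sym_lt_iff: "g \<in> sym N \<Longrightarrow> g x < N \<longleftrightarrow> x < N"
  unfolding sym_def by (metis lessThan_iff mem_Collect_eq permutes_in_image)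

lemma sym_outside: "g \<in> sym N \<Longrightarrow> \<not> x < N \<Longrightarrow> g x = x"
  unfolding sym_def by (metis lessThan_iff mem_Collect_eq permutes_not_in)

lemma sym_eq_iff: "g \<in> sym N \<Longrightarrow> g x = g y \<longleftrightarrow> x = y"
  using sym_bij by (metis bij_is_inj injD)

lemma sym_inj_on: "g \<in> sym N \<Longrightarrow> inj_on g A"
  by (auto simp: inj_on_def sym_eq_iff)

lemma transpose_in_sym: "x < N \<Longrightarrow> y < N \<Longrightarrow> transpose x y \<in> sym N"
  by (simp add: sym_def permutes_swap_id)

section \<open>Rows and columns of the tableau filled row by row\<close>

lemma sum_list_two_col [simp]: "sum_list (two_col_shape p c) = 2 * p + c"
  by (simp add: two_col_shape_def sum_list_replicate)

lemma sum_list_take_two_col: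
  "sum_list (take r (two_col_shape p c)) = 2 * min r p + min (r - p) c"
  by (simp add: two_col_shape_def sum_list_replicate)

lemma row_of_two_col:
  assumes "x < 2 * p + c"
  shows "row_of (two_col_shape p c) x = (if x < 2 * p then x div 2 else x - p)"
  unfolding row_of_def sum_list_take_two_col
  by (rule Least_equality) (use assms in \<open>auto simp: min_def split: if_splits\<close>)

lemma col_of_two_col:
  assumes "x < 2 * p + c"
  shows "col_of (two_col_shape p c) x = (if x \<in> first_col p c then 0 else 1)"
proof (cases "x < 2 * p")
  case True
  then have "x div 2 \<le> p"
    by linarith
  then have "col_of (two_col_shape p c) x = x - 2 * (x div 2)"
    using True assms by (simp add: col_of_def row_of_two_col sum_list_take_two_col)
  also have "\<dots> = x mod 2"
    by (simp add: minus_mult_div_eq_mod)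
  finally show ?thesis
    using True assms by (simp add: first_col_def mod2_eq_if)
next
  case False
  then show ?thesis
    using assms by (simp add: col_of_def row_of_two_col sum_list_take_two_col first_col_def)
qed

lemma row_of_eq_iff:
  assumes "x < 2 * p + c" "y < 2 * p + c"
  shows "row_of (two_col_shape p c) y = row_of (two_col_shape p c) x \<longleftrightarrow> y = x \<or> y = row_partner p x"
  unfolding row_of_two_col[OF assms(1)] row_of_two_col[OF assms(2)] row_partner_def
proof (cases "x < 2 * p"; cases "y < 2 * p")
  assume "x < 2 * p" "y < 2 * p"
  moreover have "y div 2 = x div 2 \<longleftrightarrow> y = x \<or> y = (if even x then x + 1 else x - 1)"
    by presburger
  ultimately show "(if y < 2 * p then y div 2 else y - p) = (if x < 2 * p then x div 2 else x - p) \<longleftrightarrow>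
    y = x \<or> y = (if x < 2 * p then if even x then x + 1 else x - 1 else x)"
    by simp
next
  assume xy: "x < 2 * p" "\<not> y < 2 * p"
  then have "x div 2 < y - p" if "y \<noteq> x"
    by linarith
  moreover have "x + 1 < 2 * p" if "even x"
    using xy(1) that by presburger
  ultimately show "(if y < 2 * p then y div 2 else y - p) = (if x < 2 * p then x div 2 else x - p) \<longleftrightarrow>
    y = x \<or> y = (if x < 2 * p then if even x then x + 1 else x - 1 else x)"
    using xy by auto
next
  assume xy: "\<not> x < 2 * p" "y < 2 * p"
  then have "y div 2 < x - p"
    by linarith
  then show "(if y < 2 * p then y div 2 else y - p) = (if x < 2 * p then x div 2 else x - p) \<longleftrightarrow>
    y = x \<or> y = (if x < 2 * p then if even x then x + 1 else x - 1 else x)"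
    using xy by auto
next
  assume "\<not> x < 2 * p" "\<not> y < 2 * p"
  then show "(if y < 2 * p then y div 2 else y - p) = (if x < 2 * p then x div 2 else x - p) \<longleftrightarrow>
    y = x \<or> y = (if x < 2 * p then if even x then x + 1 else x - 1 else x)"
    by auto
qed

locale two_columns =
  fixes p c :: nat
begin

abbreviation N where "N \<equiv> 2 * p + c"
abbreviation q where "q \<equiv> p + c"
abbreviation Q where "Q \<equiv> first_col p c"
abbreviation \<mu> where "\<mu> \<equiv> two_col_shape p c"
abbreviation C where "C \<equiv> {\<sigma> \<in> sym N. \<sigma> ` Q = Q}"
abbreviation R where "R \<equiv> {\<sigma> \<in> sym N. \<forall>x<N. \<sigma> x = x \<or> \<sigma> x = row_partner p x}"

lemma Q_subset: "Q \<subseteq> {..<N}"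
  by (auto simp: first_col_def)

lemma finite_Q [simp]: "finite Q"
  using Q_subset finite_subset by blast

lemma card_Q: "card Q = q"
proof -
  have "Q = (\<lambda>i. 2 * i) ` {..<p} \<union> {2 * p..<2 * p + c}"
    by (auto simp: first_col_def elim!: evenE)
  also have "card \<dots> = card ((\<lambda>i. 2 * i) ` {..<p}) + card {2 * p..<2 * p + c}"
    by (rule card_Un_disjoint) auto
  also have "\<dots> = q"
    by (simp add: card_image inj_on_def)
  finally show ?thesis .
qed

text \<open>With only two columns, a permutation of the entries that maps the first column onto
  itself also preserves the second.\<close>

lemma col_stab_eq: "col_stab \<mu> = C"
proof -
  have "(\<forall>x<N. col_of \<mu> (\<sigma> x) = col_of \<mu> x) \<longleftrightarrow> \<sigma> ` Q = Q" if \<sigma>: "\<sigma> \<in> sym N" for \<sigma>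
  proof
    assume *: "\<forall>x<N. col_of \<mu> (\<sigma> x) = col_of \<mu> x"
    have "\<sigma> x \<in> Q" if "x \<in> Q" for x
    proof -
      have "x < N"
        using that Q_subset by auto
      then show ?thesis
        using * that col_of_two_col[of x p c] col_of_two_col[of "\<sigma> x" p c] sym_lt_iff[OF \<sigma>]
        by (auto split: if_splits)
    qed
    then have "\<sigma> ` Q \<subseteq> Q"
      by blast
    then show "\<sigma> ` Q = Q"
      using card_subset_eq[of Q "\<sigma> ` Q"] card_image[OF sym_inj_on[OF \<sigma>]] by simp
  next
    assume *: "\<sigma> ` Q = Q"
    show "\<forall>x<N. col_of \<mu> (\<sigma> x) = col_of \<mu> x"
    proof (intro allI impI)
      fix x assume "x < N"
      have "\<sigma> x \<in> Q \<longleftrightarrow> x \<in> Q"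
        using * sym_eq_iff[OF \<sigma>] by (metis imageE imageI)
      then show "col_of \<mu> (\<sigma> x) = col_of \<mu> x"
        using col_of_two_col \<open>x < N\<close> sym_lt_iff[OF \<sigma>] by simp
    qed
  qed
  then show ?thesis
    unfolding col_stab_def by auto
qed

lemma row_stab_eq: "row_stab \<mu> = R"
  unfolding row_stab_def sum_list_two_col using row_of_eq_iff sym_lt_iff by blast

lemma row_partner_props:
  shows "row_partner p (row_partner p x) = x"
    and "x \<in> Q \<Longrightarrow> row_partner p x = x \<or> row_partner p x \<notin> Q"
    and "x < N \<Longrightarrow> x \<notin> Q \<Longrightarrow> row_partner p x \<in> Q"
    and "row_partner p x < N \<longleftrightarrow> x < N"
  by (auto simp: row_partner_def first_col_def elim!: evenE oddE)

lemma finite_R [simp]: "finite R" and finite_C [simp]: "finite C"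
  by simp_all

lemma R_comp: "g \<in> R \<Longrightarrow> h \<in> R \<Longrightarrow> g \<circ> h \<in> R"
  by (auto simp: sym_comp sym_lt_iff row_partner_props) (metis row_partner_props(1) sym_lt_iff)+

lemma R_inv: "g \<in> R \<Longrightarrow> inv g \<in> R"
proof -
  assume g: "g \<in> R"
  have "inv g x = x \<or> inv g x = row_partner p x" if "x < N" for x
  proof -
    have "g (inv g x) = x" "inv g x < N"
      using g that sym_inv sym_lt_iff sym_bij by (auto simp: bij_is_surj surj_f_inv_f)
    then have "x = inv g x \<or> x = row_partner p (inv g x)"
      using g by (metis (mono_tags, lifting) mem_Collect_eq)
    then show ?thesis
      using row_partner_props(1) by metis
  qed
  then show "inv g \<in> R"
    using g sym_inv by simp
qed

lemma C_inv: "g \<in> C \<Longrightarrow> inv g \<in> C"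
  using sym_inv sym_bij by (auto simp: bij_is_inj) (metis bij_is_inj image_inv_f_f inv_f_f imageI)+

lemma C_comp: "g \<in> C \<Longrightarrow> h \<in> C \<Longrightarrow> g \<circ> h \<in> C"
  by (simp only: mem_Collect_eq sym_comp image_comp[symmetric])

lemma transpose_in_R: "x < N \<Longrightarrow> transpose x (row_partner p x) \<in> R"
  by (auto simp: transpose_in_sym row_partner_props transpose_def)

text \<open>Substituting \<open>\<kappa>\<close> for
  \<open>inv \<rho> \<circ> (inv \<sigma> \<circ> \<tau>)\<close> in the double convolution, and
  then inverting \<open>\<kappa>\<close> and \<open>\<rho>\<close>, puts the row sum innermost:
  \<open>f\<close> is first summed over rows and then antisymmetrized over columns.\<close>

lemma young_apply:
  assumes "\<tau> \<in> sym N"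
  shows "alg_mult N f (young_symmetrizer \<mu>) \<tau> = (\<Sum>\<kappa>\<in>C. \<Sum>\<rho>\<in>R. csign \<kappa> * f (\<tau> \<circ> \<kappa> \<circ> \<rho>))"
proof -
  have restr: "(\<Sum>\<kappa>\<in>{g \<in> sym N. P g}. F \<kappa>) = (\<Sum>\<kappa>\<in>sym N. if P \<kappa> then F \<kappa> else 0)"
    for F :: "perm \<Rightarrow> complex" and P
    by (simp add: sum.inter_filter)
  have a: "row_sym \<mu> g = (if g \<in> R then 1 else 0)" for g
    by (simp add: row_sym_def row_stab_eq)
  have b: "col_antisym \<mu> g = (if g \<in> C then csign g else 0)" for g
    by (simp add: col_antisym_def col_stab_eq)
  have "alg_mult N f (young_symmetrizer \<mu>) \<tau> =
      (\<Sum>\<sigma>\<in>sym N. f \<sigma> * (\<Sum>\<rho>\<in>sym N. row_sym \<mu> \<rho> * col_antisym \<mu> (inv \<rho> \<circ> (inv \<sigma> \<circ> \<tau>))))"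
    using assms by (simp add: alg_mult_def young_symmetrizer_def sym_comp sym_inv)
  also have "\<dots> = (\<Sum>\<rho>\<in>sym N. \<Sum>\<sigma>\<in>sym N. row_sym \<mu> \<rho> * (f \<sigma> * col_antisym \<mu> (inv \<rho> \<circ> (inv \<sigma> \<circ> \<tau>))))"
    by (simp add: sum_distrib_left mult.left_commute, rule sum.swap)
  also have "\<dots> = (\<Sum>\<rho>\<in>sym N. \<Sum>\<kappa>\<in>sym N. row_sym \<mu> \<rho> * (f (\<tau> \<circ> inv \<kappa> \<circ> inv \<rho>) * col_antisym \<mu> \<kappa>))"
  proof (rule sum.cong[OF refl])
    fix \<rho> assume \<rho>: "\<rho> \<in> sym N"
    show "(\<Sum>\<sigma>\<in>sym N. row_sym \<mu> \<rho> * (f \<sigma> * col_antisym \<mu> (inv \<rho> \<circ> (inv \<sigma> \<circ> \<tau>)))) =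
        (\<Sum>\<kappa>\<in>sym N. row_sym \<mu> \<rho> * (f (\<tau> \<circ> inv \<kappa> \<circ> inv \<rho>) * col_antisym \<mu> \<kappa>))"
    proof (rule sum.reindex_bij_witness[of _ "\<lambda>\<kappa>. \<tau> \<circ> inv \<kappa> \<circ> inv \<rho>" "\<lambda>\<sigma>. inv \<rho> \<circ> (inv \<sigma> \<circ> \<tau>)"])
      fix \<sigma> assume \<sigma>: "\<sigma> \<in> sym N"
      have "inv (inv \<rho> \<circ> (inv \<sigma> \<circ> \<tau>)) = inv \<tau> \<circ> \<sigma> \<circ> \<rho>"
        using \<sigma> \<rho> assms by (simp add: o_inv_distrib sym_bij sym_inv sym_comp sym_inv_inv bij_comp bij_imp_bij_inv inv_inv_eq)
      then show "\<tau> \<circ> inv (inv \<rho> \<circ> (inv \<sigma> \<circ> \<tau>)) \<circ> inv \<rho> = \<sigma>"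
        using \<rho> assms by (simp add: o_assoc sym_comp_inv) (simp add: o_assoc[symmetric] sym_comp_inv)
      then show "row_sym \<mu> \<rho> * (f (\<tau> \<circ> inv (inv \<rho> \<circ> (inv \<sigma> \<circ> \<tau>)) \<circ> inv \<rho>)
          * col_antisym \<mu> (inv \<rho> \<circ> (inv \<sigma> \<circ> \<tau>))) =
        row_sym \<mu> \<rho> * (f \<sigma> * col_antisym \<mu> (inv \<rho> \<circ> (inv \<sigma> \<circ> \<tau>)))"
        by simp
      show "inv \<rho> \<circ> (inv \<sigma> \<circ> \<tau>) \<in> sym N"
        using \<sigma> \<rho> assms by (simp add: sym_comp sym_inv)
    next
      fix \<kappa> assume \<kappa>: "\<kappa> \<in> sym N"
      have "inv (\<tau> \<circ> inv \<kappa> \<circ> inv \<rho>) = \<rho> \<circ> (\<kappa> \<circ> inv \<tau>)"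
        using \<kappa> \<rho> assms by (simp add: o_inv_distrib sym_bij bij_comp bij_imp_bij_inv inv_inv_eq)
      then show "inv \<rho> \<circ> (inv (\<tau> \<circ> inv \<kappa> \<circ> inv \<rho>) \<circ> \<tau>) = \<kappa>"
        using \<rho> assms by (simp add: o_assoc sym_inv_comp) (simp add: o_assoc[symmetric] sym_inv_comp)
      show "\<tau> \<circ> inv \<kappa> \<circ> inv \<rho> \<in> sym N"
        using \<kappa> \<rho> assms by (simp add: sym_comp sym_inv)
    qed
  qed
  also have "\<dots> = (\<Sum>\<rho>\<in>R. \<Sum>\<kappa>\<in>C. csign \<kappa> * f (\<tau> \<circ> inv \<kappa> \<circ> inv \<rho>))"
    unfolding restr a b by (intro sum.cong refl) (auto intro!: sum.cong)
  also have "\<dots> = (\<Sum>\<rho>\<in>R. \<Sum>\<kappa>\<in>C. csign \<kappa> * f (\<tau> \<circ> inv \<kappa> \<circ> \<rho>))"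
    by (rule sum.reindex_bij_witness[of _ inv inv]) (use R_inv sym_inv_inv in blast)+
  also have "\<dots> = (\<Sum>\<rho>\<in>R. \<Sum>\<kappa>\<in>C. csign \<kappa> * f (\<tau> \<circ> \<kappa> \<circ> \<rho>))"
  proof (rule sum.cong[OF refl])
    fix \<rho>
    show "(\<Sum>\<kappa>\<in>C. csign \<kappa> * f (\<tau> \<circ> inv \<kappa> \<circ> \<rho>)) = (\<Sum>\<kappa>\<in>C. csign \<kappa> * f (\<tau> \<circ> \<kappa> \<circ> \<rho>))"
      by (rule sum.reindex_bij_witness[of _ inv inv]) (use C_inv sym_inv_inv csign_inv in auto)
  qed
  finally show ?thesis
    by (subst sum.swap) simp
qed

text \<open>
  The sum cancels under the sign-reversing involution that exchanges the entry \<open>s\<close>, which is not in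
  the first column, with the other entry of its row.
\<close>

lemma garnir_of_row_invariant:
  assumes "\<And>\<tau> \<rho>. \<tau> \<in> sym N \<Longrightarrow> \<rho> \<in> R \<Longrightarrow> y (\<tau> \<circ> \<rho>) = y \<tau>"
  shows "garnir N q (\<lambda>B. \<Sum>\<tau>\<in>{\<tau> \<in> sym N. \<tau> ` Q = B}. csign \<tau> * y \<tau>)"
  unfolding garnir_def
proof (intro allI impI)
  fix S assume S: "S \<subseteq> {..<N} \<and> card S = Suc q"
  have "finite S"
    using S by (metis card.infinite nat.distinct(1))
  define A where "A = (SIGMA s:S. {\<tau> \<in> sym N. \<tau> ` Q = S - {s}})"
  define g where "g = (\<lambda>(s :: nat, \<tau>). csign \<tau> * y \<tau>)"
  define flip where "flip = (\<lambda>(s, \<tau> :: perm). (\<tau> (row_partner p (inv \<tau> s)),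
    \<tau> \<circ> transpose (inv \<tau> s) (row_partner p (inv \<tau> s))))"
  have flip: "flip x \<in> A" "flip (flip x) = x" "g (flip x) = - g x" if "x \<in> A" for x
  proof -
    obtain s \<tau> where x: "x = (s, \<tau>)" "s \<in> S" "\<tau> \<in> sym N" "\<tau> ` Q = S - {s}"
      using \<open>x \<in> A\<close> unfolding A_def by blast
    define p0 where "p0 = inv \<tau> s"
    define u where "u = row_partner p p0"
    have s: "\<tau> p0 = s"
      using x(3) sym_bij by (simp add: p0_def bij_is_surj surj_f_inv_f)
    have p0: "p0 < N" "p0 \<notin> Q"
      using s x S sym_lt_iff[OF x(3)] by auto
    then have u: "u \<in> Q" "u < N" "u \<noteq> p0"
      using row_partner_props unfolding u_def by metis+
    have t: "transpose p0 u \<in> R" "transpose p0 u \<in> sym N"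
      using transpose_in_R[OF p0(1)] by (simp_all add: u_def)
    define \<tau>' where "\<tau>' = \<tau> \<circ> transpose p0 u"
    have \<tau>': "\<tau>' \<in> sym N"
      using x(3) t by (simp add: \<tau>'_def sym_comp)
    have fl: "flip x = (\<tau> u, \<tau>')"
      by (simp add: x(1) flip_def \<tau>'_def p0_def u_def)
    have "transpose p0 u ` Q = insert p0 (Q - {u})"
      using u p0 by (auto simp: transpose_def image_iff)
    then have "\<tau>' ` Q = \<tau> ` insert p0 (Q - {u})"
      by (simp only: \<tau>'_def image_comp[symmetric])
    also have "\<dots> = insert s (\<tau> ` Q - {\<tau> u})"
      using s sym_eq_iff[OF x(3)] by auto
    also have "\<dots> = S - {\<tau> u}"
      using x s u sym_eq_iff[OF x(3)] by auto
    finally have *: "\<tau>' ` Q = S - {\<tau> u}" .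
    have "\<tau> u \<in> S"
      using u(1) x(4) by blast
    then show "flip x \<in> A"
      using * \<tau>' unfolding fl by (simp add: A_def)
    have inv: "inv \<tau>' (\<tau> u) = p0"
      using \<tau>' sym_bij by (metis \<tau>'_def bij_is_inj comp_apply inv_f_f transpose_apply_first)
    have "flip (\<tau> u, \<tau>') = (\<tau>' u, \<tau>' \<circ> transpose p0 u)"
      by (simp only: flip_def prod.case inv u_def[symmetric])
    also have "\<dots> = x"
      by (simp add: \<tau>'_def x(1) s o_assoc[symmetric])
    finally show "flip (flip x) = x"
      by (simp only: fl)
    have "csign \<tau>' = - csign \<tau>"
      using csign_comp[OF x(3) t(2)] u(3) by (simp add: \<tau>'_def sign_swap_id)
    then show "g (flip x) = - g x"
      using assms[OF x(3) t(1)] unfolding fl by (simp add: x(1) g_def \<tau>'_def)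
  qed
  have "(\<Sum>s\<in>S. \<Sum>\<tau>\<in>{\<tau> \<in> sym N. \<tau> ` Q = S - {s}}. csign \<tau> * y \<tau>) = sum g A"
    unfolding A_def g_def using \<open>finite S\<close> by (subst sum.Sigma) auto
  also have "sum g A = sum (\<lambda>x. - g x) A"
    by (rule sum.reindex_bij_witness[of _ flip flip]) (auto simp: flip)
  then have "sum g A = 0"
    by (simp add: sum_negf)
  finally show "(\<Sum>s\<in>S. \<Sum>\<tau>\<in>{\<tau> \<in> sym N. \<tau> ` Q = S - {s}}. csign \<tau> * y \<tau>) = 0" .
qed

section \<open>Specht modules as solution spaces of the Garnir relations\<close>

lemma sum_left_coset:
  assumes "\<tau> \<in> sym N"
  shows "(\<Sum>\<kappa>\<in>C. F (\<tau> \<circ> \<kappa>)) = (\<Sum>\<sigma>\<in>{\<sigma> \<in> sym N. \<sigma> ` Q = \<tau> ` Q}. F \<sigma>)"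
proof (rule sum.reindex_bij_witness[of _ "\<lambda>\<sigma>. inv \<tau> \<circ> \<sigma>" "\<lambda>\<kappa>. \<tau> \<circ> \<kappa>"])
  have inv: "inv \<tau> ` \<tau> ` A = A" for A
    using assms sym_bij bij_is_inj by (metis image_inv_f_f)
  fix \<sigma> assume "\<sigma> \<in> {\<sigma> \<in> sym N. \<sigma> ` Q = \<tau> ` Q}"
  then show "inv \<tau> \<circ> \<sigma> \<in> C"
    using assms inv by (simp only: mem_Collect_eq sym_comp sym_inv image_comp[symmetric])
next
  fix \<kappa> assume "\<kappa> \<in> C"
  then show "\<tau> \<circ> \<kappa> \<in> {\<sigma> \<in> sym N. \<sigma> ` Q = \<tau> ` Q}"
    using assms by (simp only: mem_Collect_eq sym_comp image_comp[symmetric])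
qed (use assms in \<open>auto simp: o_assoc sym_inv_comp sym_comp_inv\<close>)

text \<open>The row sum \<open>y\<close> is invariant under \<open>R\<close> on the right. The
  signed sum of \<open>y\<close> over a left coset of \<open>C\<close> depends, up to the sign of
  \<open>\<tau>\<close>, only on the image of \<open>Q\<close>, and
  \<open>garnir_of_row_invariant\<close> applies to it.\<close>

lemma specht_subset:
  assumes "F \<in> specht \<mu>"
  obtains h where "\<And>\<tau>. F \<tau> = (if \<tau> \<in> sym N then csign \<tau> * h (\<tau> ` Q) else 0)" "garnir N q h"
proof -
  obtain f where F: "F = alg_mult N f (young_symmetrizer \<mu>)"
    using assms by (auto simp: specht_def)
  define y where "y \<tau> = (\<Sum>\<rho>\<in>R. f (\<tau> \<circ> \<rho>))" for \<tau>
  have y: "y (\<tau> \<circ> \<rho>) = y \<tau>" if "\<rho> \<in> R" for \<tau> \<rho>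
  proof -
    have \<rho>: "\<rho> \<in> sym N"
      using that by simp
    have "inv \<rho> \<circ> \<sigma> \<in> R" "\<rho> \<circ> \<sigma> \<in> R" if "\<sigma> \<in> R" for \<sigma>
      using R_comp R_inv \<open>\<rho> \<in> R\<close> that by blast+
    then show ?thesis
      unfolding y_def
      by (intro sum.reindex_bij_witness[of _ "\<lambda>\<sigma>. inv \<rho> \<circ> \<sigma>" "\<lambda>\<sigma>. \<rho> \<circ> \<sigma>"])
        (simp_all add: o_assoc sym_inv_comp[OF \<rho>] sym_comp_inv[OF \<rho>] del: mem_Collect_eq)
  qed
  define h where "h B = (\<Sum>\<tau>\<in>{\<tau> \<in> sym N. \<tau> ` Q = B}. csign \<tau> * y \<tau>)" for B
  have "F \<tau> = csign \<tau> * h (\<tau> ` Q)" if \<tau>: "\<tau> \<in> sym N" for \<tau>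
  proof -
    have "F \<tau> = (\<Sum>\<kappa>\<in>C. csign \<kappa> * y (\<tau> \<circ> \<kappa>))"
      unfolding F young_apply[OF \<tau>] y_def by (simp add: sum_distrib_left)
    also have "\<dots> = (\<Sum>\<kappa>\<in>C. csign \<tau> * (csign (\<tau> \<circ> \<kappa>) * y (\<tau> \<circ> \<kappa>)))"
    proof (rule sum.cong[OF refl])
      fix \<kappa> assume "\<kappa> \<in> C"
      then have "csign \<tau> * csign (\<tau> \<circ> \<kappa>) = (csign \<tau> * csign \<tau>) * csign \<kappa>"
        using csign_comp[OF \<tau>] by simp
      then show "csign \<kappa> * y (\<tau> \<circ> \<kappa>) = csign \<tau> * (csign (\<tau> \<circ> \<kappa>) * y (\<tau> \<circ> \<kappa>))"
        by (simp only: csign_square mult.assoc[symmetric] mult_1_left)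
    qed
    also have "\<dots> = csign \<tau> * h (\<tau> ` Q)"
      using sum_left_coset[OF \<tau>, of "\<lambda>\<sigma>. csign \<sigma> * y \<sigma>"] by (simp add: sum_distrib_left[symmetric] h_def)
    finally show ?thesis .
  qed
  moreover have "F \<tau> = 0" if "\<tau> \<notin> sym N" for \<tau>
    using that by (simp add: F alg_mult_def)
  moreover have "garnir N q h"
    unfolding h_def using garnir_of_row_invariant y by blast
  ultimately show ?thesis
    using that[of h] by simp
qed

text \<open>An element of \<open>R\<close> is a product of disjoint transpositions inside rows, each
  of which carries exactly one entry of \<open>Q\<close> out of \<open>Q\<close>; the induction
  undoes one of them at a time.\<close>

lemma sign_row_stab: "\<rho> \<in> R \<Longrightarrow> csign \<rho> = (-1) ^ card (\<rho> ` Q - Q)"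
proof (induction "card (\<rho> ` Q - Q)" arbitrary: \<rho>)
  case 0
  then have \<rho>: "\<rho> \<in> sym N" "\<And>x. x < N \<Longrightarrow> \<rho> x = x \<or> \<rho> x = row_partner p x" "\<rho> ` Q \<subseteq> Q"
    by auto
  have Q: "\<rho> x = x" if "x \<in> Q" for x
  proof -
    have "x < N" "\<rho> x \<in> Q"
      using \<rho>(3) that Q_subset by auto
    then show ?thesis
      using \<rho>(2)[of x] row_partner_props(2)[OF that] by metis
  qed
  have "\<rho> x = x" for x
  proof (cases "x < N \<and> x \<notin> Q")
    case True
    then have "\<rho> (row_partner p x) = row_partner p x"
      using Q row_partner_props(3) by blast
    then have "\<rho> x \<noteq> row_partner p x"
      using sym_eq_iff[OF \<rho>(1)] True row_partner_props(3) by metis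
    then show ?thesis
      using \<rho>(2) True by blast
  qed (use Q sym_outside[OF \<rho>(1)] in blast)
  then have "\<rho> = id"
    by auto
  then show ?case
    by simp
next
  case (Suc t)
  then have \<rho>: "\<rho> \<in> sym N" "\<And>x. x < N \<Longrightarrow> \<rho> x = x \<or> \<rho> x = row_partner p x"
    by auto
  have "\<rho> ` Q - Q \<noteq> {}"
    using Suc.hyps(2) by force
  then obtain u where u: "u \<in> Q" "\<rho> u \<notin> Q"
    by blast
  define v where "v = row_partner p u"
  have uN: "u < N"
    using u Q_subset by auto
  have v: "\<rho> u = v" "v \<notin> Q" "v \<noteq> u" "v < N" "row_partner p v = u"
    using \<rho>(2)[OF uN] u row_partner_props uN unfolding v_def by auto
  have \<rho>v: "\<rho> v = u"
    using \<rho>(2)[OF v(4)] v sym_eq_iff[OF \<rho>(1)] by metis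
  define \<rho>' where "\<rho>' = \<rho> \<circ> transpose u v"
  have \<rho>': "\<rho>' \<in> R"
    using R_comp[OF Suc.prems transpose_in_R[OF uN]] by (simp only: \<rho>'_def v_def)
  have "\<rho>' x = (if x = u then u else \<rho> x)" if "x \<in> Q" for x
    using that v \<rho>v by (auto simp: \<rho>'_def transpose_def)
  then have "\<rho>' ` Q = insert u (\<rho> ` (Q - {u}))"
    using u by (auto simp: image_iff)
  moreover have "\<rho> ` Q = insert v (\<rho> ` (Q - {u}))" "v \<notin> \<rho> ` (Q - {u})"
    using u v sym_eq_iff[OF \<rho>(1)] by auto
  ultimately have "\<rho> ` Q - Q = insert v (\<rho>' ` Q - Q)" "v \<notin> \<rho>' ` Q - Q"
    using u v by auto
  then have card: "card (\<rho> ` Q - Q) = Suc (card (\<rho>' ` Q - Q))"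
    by simp
  then have "csign \<rho>' = (-1) ^ t"
    using Suc.hyps(1)[of \<rho>'] Suc.hyps(2) \<rho>' by simp
  moreover have "csign \<rho> = - csign \<rho>'"
    using csign_comp[OF \<rho>(1) transpose_in_sym[OF uN v(4)]] v(3) by (simp add: \<rho>'_def sign_swap_id)
  ultimately show ?case
    using Suc.hyps(2)[symmetric] by simp
qed

text \<open>
  The column average of a solution of the Garnir relations depends on \<open>D\<close> only through the number
  \<open>t\<close> of its elements outside \<open>Q\<close>; one Garnir relation compares \<open>t\<close> with \<open>t - 1\<close>.
\<close>

definition garnir_ratio :: "nat \<Rightarrow> real" where
  "garnir_ratio t = (\<Prod>j<t. real (Suc j) / real (q - j))"

text \<open>For these \<open>t\<close> the ratio is the reciprocal of the binomial coefficient
  \<open>q choose t\<close>. Its positivity is what keeps the eigenvalue \<open>young_scalar\<close>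
  from vanishing.\<close>

lemma garnir_ratio_pos: "t \<le> q \<Longrightarrow> garnir_ratio t > 0"
  unfolding garnir_ratio_def by (intro prod_pos) auto

lemma column_average:
  assumes h: "garnir N q h" and \<tau>: "\<tau> \<in> sym N"
    and D: "D \<subseteq> {..<N}" "card D = q"
  shows "(\<Sum>\<kappa>\<in>C. h (\<tau> ` \<kappa> ` D)) =
    (-1) ^ card (D - Q) * of_real (garnir_ratio (card (D - Q))) * (of_nat (card C) * h (\<tau> ` Q))"
  using D
proof (induction "card (D - Q)" arbitrary: D)
  define \<Phi> where "\<Phi> D = (\<Sum>\<kappa>\<in>C. h (\<tau> ` \<kappa> ` D))" for D
  {
    case (0 D)
    then have "finite D"
      using finite_subset by blast
    then have "D \<subseteq> Q"
      using 0 by auto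
    then have "D = Q"
      using 0 card_Q by (simp add: card_subset_eq)
    then show ?case
      by (simp add: garnir_ratio_def)
  next
    case (Suc t D)
    \<comment> \<open>The sum over \<open>C\<close> absorbs a transposition inside one column, so
      \<open>\<Phi>\<close> does not see which entries of a column are taken, only how many.\<close>
    have \<Phi>_swap: "\<Phi> (transpose a b ` E) = \<Phi> E" if "a < N" "b < N" "a \<in> Q \<longleftrightarrow> b \<in> Q" for a b E
    proof -
      have t: "transpose a b \<in> C"
        using that transpose_in_sym by (auto simp: transpose_def image_iff)
      have t2: "transpose a b \<circ> transpose a b = id"
        by simp
      have "\<kappa> \<circ> transpose a b \<in> C" if "\<kappa> \<in> C" for \<kappa>
        using C_comp[OF that t] .
      then show ?thesis
        unfolding \<Phi>_def
        by (intro sum.reindex_bij_witness[of _ "\<lambda>\<kappa>. \<kappa> \<circ> transpose a b" "\<lambda>\<kappa>. \<kappa> \<circ> transpose a b"])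
          (simp_all add: image_comp o_assoc[symmetric] t2 del: mem_Collect_eq)
    qed
    have finD: "finite D"
      using Suc.prems finite_subset by blast
    have "card (D \<inter> Q) + card (D - Q) = q"
      using card_Int_Diff[OF finD, of Q] Suc.prems by simp
    then have cDQ: "card (D \<inter> Q) = q - Suc t" "Suc t \<le> q"
      using Suc.hyps(2) by simp_all
    then have "card (D \<inter> Q) < card Q"
      using card_Q by simp
    then obtain x where x: "x \<in> Q" "x \<notin> D"
      by (metis Int_absorb1 less_irrefl subsetI)
    have xN: "x < N"
      using x Q_subset by auto
    have "D - Q \<noteq> {}"
      using Suc.hyps(2) by force
    then obtain s0 where s0: "s0 \<in> D" "s0 \<notin> Q"
      by blast
    have s0N: "s0 < N"
      using s0 Suc.prems by auto
    \<comment> \<open>Adding a missing entry \<open>x\<close> of \<open>Q\<close> gives a set of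
      \<open>q + 1\<close> entries, whose Garnir relation is averaged over \<open>C\<close>.
      Deleting an entry of \<open>Q\<close> from \<open>S\<close> gives the value
      \<open>\<Phi> D\<close>; deleting one outside \<open>Q\<close> gives the value for
      \<open>t\<close> instead of \<open>Suc t\<close> entries outside \<open>Q\<close>.\<close>
    define S where "S = insert x D"
    have finS: "finite S" and SN: "S \<subseteq> {..<N}" and cS: "card S = Suc q"
      using x finD xN Suc.prems by (auto simp: S_def)
    have "(\<Sum>s\<in>S. \<Phi> (S - {s})) = (\<Sum>\<kappa>\<in>C. \<Sum>s\<in>S. h (\<tau> ` \<kappa> ` (S - {s})))"
      unfolding \<Phi>_def by (rule sum.swap)
    also have "\<dots> = 0"
    proof (rule sum.neutral, rule ballI)
      fix \<kappa> assume "\<kappa> \<in> C"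
      then have *: "\<tau> \<circ> \<kappa> \<in> sym N"
        using \<tau> sym_comp by simp
      have "(\<Sum>s\<in>S. h (\<tau> ` \<kappa> ` (S - {s}))) = (\<Sum>s\<in>S. h ((\<tau> \<circ> \<kappa>) ` S - {(\<tau> \<circ> \<kappa>) s}))"
        by (intro sum.cong refl arg_cong[of _ _ h])
          (simp only: image_comp image_set_diff[OF bij_is_inj[OF sym_bij[OF *]]] image_insert image_empty)
      also have "\<dots> = (\<Sum>s\<in>(\<tau> \<circ> \<kappa>) ` S. h ((\<tau> \<circ> \<kappa>) ` S - {s}))"
        by (subst sum.reindex[OF sym_inj_on[OF *]]) simp
      also have "\<dots> = 0"
      proof -
        have "(\<tau> \<circ> \<kappa>) ` S \<subseteq> {..<N}"
          using SN sym_lt_iff[OF *] by (auto simp del: comp_apply)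
        moreover have "card ((\<tau> \<circ> \<kappa>) ` S) = Suc q"
          using card_image[OF sym_inj_on[OF *]] cS by simp
        ultimately show ?thesis
          using h unfolding garnir_def by blast
      qed
      finally show "(\<Sum>s\<in>S. h (\<tau> ` \<kappa> ` (S - {s}))) = 0" .
    qed
    finally have "(\<Sum>s\<in>S \<inter> Q. \<Phi> (S - {s})) + (\<Sum>s\<in>S - Q. \<Phi> (S - {s})) = 0"
      using sum.Int_Diff[OF finS, of "\<lambda>s. \<Phi> (S - {s})" Q] by simp
    moreover have "\<Phi> (S - {s}) = \<Phi> D" if "s \<in> S \<inter> Q" for s
    proof -
      have "S - {s} = transpose x s ` D"
        using that x by (auto simp: S_def transpose_def image_iff)
      then show ?thesis
        using \<Phi>_swap[of x s D] that x xN SN by auto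
    qed
    moreover have "\<Phi> (S - {s}) = \<Phi> (S - {s0})" if "s \<in> S - Q" for s
    proof -
      have "S - {s} = transpose s0 s ` (S - {s0})"
        using that s0 by (auto simp: S_def transpose_def image_iff)
      then show ?thesis
        using \<Phi>_swap[of s0 s "S - {s0}"] that s0 s0N SN by auto
    qed
    ultimately have "of_nat (card (S \<inter> Q)) * \<Phi> D + of_nat (card (S - Q)) * \<Phi> (S - {s0}) = 0"
      by simp
    moreover have "S \<inter> Q = insert x (D \<inter> Q)" "S - Q = D - Q"
      using x by (auto simp: S_def)
    \<comment> \<open>Of the entries of \<open>D\<close>, \<open>q - Suc t\<close> lie in
      \<open>Q\<close>, and \<open>x\<close> is one more.\<close>
    moreover have "card (insert x (D \<inter> Q)) = q - t"
      using cDQ x finD by simp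
    ultimately have rel: "of_nat (q - t) * \<Phi> D + of_nat (Suc t) * \<Phi> (S - {s0}) = 0"
      unfolding Suc.hyps(2) by (simp only:)
    have "(S - {s0}) - Q = (D - Q) - {s0}"
      using x by (auto simp: S_def)
    then have cE: "card ((S - {s0}) - Q) = t"
      using s0 finD Suc.hyps(2)[symmetric] by simp
    have "S - {s0} \<subseteq> {..<N}" "card (S - {s0}) = q"
      using SN cS finS s0 by (auto simp: S_def)
    then have IH: "\<Phi> (S - {s0}) = (-1) ^ t * of_real (garnir_ratio t) * (of_nat (card C) * h (\<tau> ` Q))"
      using Suc.hyps(1)[of "S - {s0}"] cE unfolding \<Phi>_def by simp
    have nz: "of_nat (q - t) \<noteq> (0 :: complex)"
      using cDQ(2) by (subst of_nat_eq_0_iff) linarith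
    have solve: "u = - (b / a) * v" if "a * u + b * v = 0" "a \<noteq> 0" for a b u v :: complex
    proof -
      have "a * u = - (b * v)"
        using that(1) by (simp add: eq_neg_iff_add_eq_0)
      then have "u = - (b * v) / a"
        using that(2) by (metis nonzero_mult_div_cancel_left)
      then show ?thesis
        by simp
    qed
    have ratio: "complex_of_real (garnir_ratio (Suc t)) =
        of_nat (Suc t) / of_nat (q - t) * of_real (garnir_ratio t)"
      by (simp add: garnir_ratio_def)
    have "\<Phi> D = - (of_nat (Suc t) / of_nat (q - t)) * \<Phi> (S - {s0})"
      by (rule solve[OF rel nz])
    also have "\<dots> = (-1) ^ Suc t * of_real (garnir_ratio (Suc t)) * (of_nat (card C) * h (\<tau> ` Q))"
      unfolding IH ratio by simp
    finally show ?case
      using Suc.hyps(2) by (simp add: \<Phi>_def)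
  }
qed

text \<open>The eigenvalue of right multiplication by the Young symmetrizer on the solutions of the
  Garnir relations; it is the product of the hook lengths of the shape.\<close>

definition young_scalar :: real where
  "young_scalar = real (card C) * (\<Sum>\<rho>\<in>R. garnir_ratio (card (\<rho> ` Q - Q)))"

lemma young_scalar_pos: "young_scalar > 0"
proof -
  have id: "id \<in> R" "id \<in> C"
    by auto
  have pos: "garnir_ratio (card (\<rho> ` Q - Q)) > 0" if "\<rho> \<in> R" for \<rho>
  proof -
    have "card (\<rho> ` Q - Q) \<le> card (\<rho> ` Q)"
      by (intro card_mono) auto
    also have "\<dots> \<le> q"
      using card_image_le[of Q \<rho>] card_Q by simp
    finally show ?thesis
      by (rule garnir_ratio_pos)
  qed
  have "R \<noteq> {}"
    using id(1) by blast
  then have "(\<Sum>\<rho>\<in>R. garnir_ratio (card (\<rho> ` Q - Q))) > 0"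
    by (rule sum_pos[OF finite_R _ pos])
  moreover have "card C > 0"
    using id(2) finite_C card_gt_0_iff by blast
  ultimately show ?thesis
    by (simp add: young_scalar_def)
qed

text \<open>\<open>column_average\<close> evaluates the sum over \<open>C\<close> for each row
  permutation \<open>\<rho>\<close>. The sign that it produces cancels the sign of
  \<open>\<rho>\<close> by \<open>sign_row_stab\<close>, so that all contributions to
  \<open>young_scalar\<close> are positive.\<close>

lemma young_eigen:
  assumes F: "\<And>\<tau>. F \<tau> = (if \<tau> \<in> sym N then csign \<tau> * h (\<tau> ` Q) else 0)" and h: "garnir N q h"
  shows "alg_mult N F (young_symmetrizer \<mu>) = cscale (of_real young_scalar) F"
proof
  fix \<tau>
  show "alg_mult N F (young_symmetrizer \<mu>) \<tau> = cscale (of_real young_scalar) F \<tau>"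
  proof (cases "\<tau> \<in> sym N")
    case \<tau>: True
    have "alg_mult N F (young_symmetrizer \<mu>) \<tau> =
        (\<Sum>\<kappa>\<in>C. \<Sum>\<rho>\<in>R. csign \<tau> * (csign \<rho> * h (\<tau> ` \<kappa> ` \<rho> ` Q)))"
      unfolding young_apply[OF \<tau>]
    proof (intro sum.cong refl)
      fix \<kappa> \<rho> assume "\<kappa> \<in> C" "\<rho> \<in> R"
      then have \<kappa>\<rho>: "\<kappa> \<in> sym N" "\<rho> \<in> sym N"
        by auto
      have "csign \<kappa> * csign (\<tau> \<circ> \<kappa> \<circ> \<rho>) = (csign \<kappa> * csign \<kappa>) * csign \<tau> * csign \<rho>"
        using csign_comp[OF sym_comp[OF \<tau> \<kappa>\<rho>(1)] \<kappa>\<rho>(2)] csign_comp[OF \<tau> \<kappa>\<rho>(1)]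
        by (simp only: ac_simps)
      then have "csign \<kappa> * csign (\<tau> \<circ> \<kappa> \<circ> \<rho>) = csign \<tau> * csign \<rho>"
        by (simp only: csign_square mult_1_left)
      then show "csign \<kappa> * F (\<tau> \<circ> \<kappa> \<circ> \<rho>) = csign \<tau> * (csign \<rho> * h (\<tau> ` \<kappa> ` \<rho> ` Q))"
        using \<tau> \<kappa>\<rho> by (simp add: F sym_comp image_comp mult.assoc[symmetric])
    qed
    also have "\<dots> = csign \<tau> * (\<Sum>\<rho>\<in>R. csign \<rho> * (\<Sum>\<kappa>\<in>C. h (\<tau> ` \<kappa> ` \<rho> ` Q)))"
      by (subst sum.swap) (simp add: sum_distrib_left)
    also have "(\<Sum>\<rho>\<in>R. csign \<rho> * (\<Sum>\<kappa>\<in>C. h (\<tau> ` \<kappa> ` \<rho> ` Q))) =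
        (\<Sum>\<rho>\<in>R. of_real (garnir_ratio (card (\<rho> ` Q - Q))) * (of_nat (card C) * h (\<tau> ` Q)))"
    proof (rule sum.cong[OF refl])
      fix \<rho> assume \<rho>: "\<rho> \<in> R"
      then have sym: "\<rho> \<in> sym N"
        by simp
      have D: "\<rho> ` Q \<subseteq> {..<N}" "card (\<rho> ` Q) = q"
        using Q_subset sym_lt_iff[OF sym] card_image[OF sym_inj_on[OF sym]] card_Q by auto
      have "(-1) ^ k * ((-1) ^ k * a) = a" for a :: complex and k :: nat
        by (simp add: mult.assoc[symmetric] power_add[symmetric])
      then show "csign \<rho> * (\<Sum>\<kappa>\<in>C. h (\<tau> ` \<kappa> ` \<rho> ` Q)) =
          of_real (garnir_ratio (card (\<rho> ` Q - Q))) * (of_nat (card C) * h (\<tau> ` Q))"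
        unfolding column_average[OF h \<tau> D] sign_row_stab[OF \<rho>] by (simp only: mult.assoc)
    qed
    also have "\<dots> = of_real young_scalar * h (\<tau> ` Q)"
      by (simp add: young_scalar_def sum_distrib_right sum_distrib_left algebra_simps)
    finally have "alg_mult N F (young_symmetrizer \<mu>) \<tau> = csign \<tau> * (of_real young_scalar * h (\<tau> ` Q))" .
    moreover have "F \<tau> = csign \<tau> * h (\<tau> ` Q)"
      using \<tau> by (simp add: F)
    ultimately show ?thesis
      by simp
  next
    case False
    then show ?thesis
      by (simp add: F[of \<tau>] alg_mult_def)
  qed
qed

lemma cscale_alg_mult: "cscale a (alg_mult n f y) = alg_mult n (cscale a f) y"
  by (auto simp: alg_mult_def fun_eq_iff sum_distrib_left mult.assoc)

text \<open>A solution of the Garnir relations is an eigenvector of right multiplication by the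
  symmetrizer with nonzero eigenvalue, hence lies in the left ideal; the other inclusion is
  \<open>specht_subset\<close>.\<close>

lemma specht_iff:
  "F \<in> specht \<mu> \<longleftrightarrow>
    (\<exists>h. (\<forall>\<tau>. F \<tau> = (if \<tau> \<in> sym N then csign \<tau> * h (\<tau> ` Q) else 0)) \<and> garnir N q h)"
proof
  assume "F \<in> specht \<mu>"
  then show "\<exists>h. (\<forall>\<tau>. F \<tau> = (if \<tau> \<in> sym N then csign \<tau> * h (\<tau> ` Q) else 0)) \<and> garnir N q h"
    using specht_subset by metis
next
  assume "\<exists>h. (\<forall>\<tau>. F \<tau> = (if \<tau> \<in> sym N then csign \<tau> * h (\<tau> ` Q) else 0)) \<and> garnir N q h"
  then obtain h where h: "\<And>\<tau>. F \<tau> = (if \<tau> \<in> sym N then csign \<tau> * h (\<tau> ` Q) else 0)" "garnir N q h"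
    by blast
  have "F = cscale (1 / of_real young_scalar) (alg_mult N F (young_symmetrizer \<mu>))"
    unfolding young_eigen[OF h] using young_scalar_pos by (simp add: fun_eq_iff)
  also have "\<dots> = alg_mult N (cscale (1 / of_real young_scalar) F) (young_symmetrizer \<mu>)"
    by (rule cscale_alg_mult)
  also have "\<dots> \<in> specht \<mu>"
    unfolding specht_def sum_list_two_col using h(1) by (intro imageI) (simp add: group_algebra_def)
  finally show "F \<in> specht \<mu>" .
qed

text \<open>Right multiplication by the symmetrizer, divided by \<open>young_scalar\<close>, is a
  projection onto the Specht module, and \<open>E\<close> is its kernel. It lets membership in a
  tensor product be tested one argument at a time.\<close>

lemma specht_reproducing_kernel:
  obtains E where "\<And>\<sigma>. \<sigma> \<in> sym N \<Longrightarrow> (\<lambda>\<tau>. E \<tau> \<sigma>) \<in> specht \<mu>"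
    "\<And>F \<tau>. F \<in> specht \<mu> \<Longrightarrow> F \<tau> = (\<Sum>\<sigma>\<in>sym N. E \<tau> \<sigma> * F \<sigma>)"
proof
  let ?E = "\<lambda>\<tau> \<sigma>. if \<tau> \<in> sym N then young_symmetrizer \<mu> (inv \<sigma> \<circ> \<tau>) / of_real young_scalar else 0"
  show "(\<lambda>\<tau>. ?E \<tau> \<sigma>) \<in> specht \<mu>" if "\<sigma> \<in> sym N" for \<sigma>
  proof -
    \<comment> \<open>The product of this multiple of the unit mass at \<open>\<sigma>\<close> with
      the symmetrizer is the column of \<open>?E\<close> at \<open>\<sigma>\<close>.\<close>
    let ?f = "\<lambda>\<tau>. if \<tau> = \<sigma> then 1 / complex_of_real young_scalar else 0"
    have "(\<lambda>\<tau>. ?E \<tau> \<sigma>) = alg_mult N ?f (young_symmetrizer \<mu>)"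
    proof
      fix \<tau>
      have "(\<Sum>g\<in>sym N. ?f g * young_symmetrizer \<mu> (inv g \<circ> \<tau>)) =
          (\<Sum>g\<in>sym N. if g = \<sigma> then young_symmetrizer \<mu> (inv \<sigma> \<circ> \<tau>) / of_real young_scalar else 0)"
        by (intro sum.cong) auto
      then show "?E \<tau> \<sigma> = alg_mult N ?f (young_symmetrizer \<mu>) \<tau>"
        using that by (simp add: alg_mult_def)
    qed
    then show ?thesis
      using that by (simp add: specht_def group_algebra_def)
  qed
  show "F \<tau> = (\<Sum>\<sigma>\<in>sym N. ?E \<tau> \<sigma> * F \<sigma>)" if "F \<in> specht \<mu>" for F \<tau>
  proof -
    obtain h where h: "\<And>\<tau>. F \<tau> = (if \<tau> \<in> sym N then csign \<tau> * h (\<tau> ` Q) else 0)" "garnir N q h"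
      using specht_subset \<open>F \<in> specht \<mu>\<close> by blast
    show ?thesis
    proof (cases "\<tau> \<in> sym N")
      case True
      have "(\<Sum>\<sigma>\<in>sym N. ?E \<tau> \<sigma> * F \<sigma>) = alg_mult N F (young_symmetrizer \<mu>) \<tau> / of_real young_scalar"
        using True by (simp add: alg_mult_def sum_divide_distrib mult.commute)
      then show ?thesis
        unfolding young_eigen[OF h] using young_scalar_pos by simp
    qed (simp add: h(1))
  qed
qed

end

section \<open>Alternating functions of words\<close>

text \<open>An element of the exterior algebra is modelled by its coefficient function on words of
  letters, required to be alternating. \<open>contr x\<close> is the interior product with the
  letter \<open>x\<close>, and \<open>wedge x\<close> below is exterior multiplication by
  it.\<close>

definition contr :: "'a \<Rightarrow> ('a list \<Rightarrow> complex) \<Rightarrow> 'a list \<Rightarrow> complex" where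
  "contr x G = (\<lambda>w. G (x # w))"

text \<open>The recursion is the canonical anticommutation relation between \<open>contr y\<close> and \<open>wedge x\<close>.\<close>

fun wedge :: "'a \<Rightarrow> ('a list \<Rightarrow> complex) \<Rightarrow> 'a list \<Rightarrow> complex" where
  "wedge x G [] = 0"
| "wedge x G (y # w) = (if x = y then G w else 0) - wedge x (contr y G) w"

definition alternating :: "('a list \<Rightarrow> complex) \<Rightarrow> bool" where
  "alternating G \<longleftrightarrow> (\<forall>u x y v. G (u @ x # y # v) = - G (u @ y # x # v))"

lemma alternatingD: "alternating G \<Longrightarrow> G (u @ x # y # v) = - G (u @ y # x # v)"
  unfolding alternating_def by blast

lemma contr_apply [simp]: "contr x G w = G (x # w)"
  by (simp add: contr_def)

lemma alternating_contr: "alternating G \<Longrightarrow> alternating (contr x G)"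
  unfolding alternating_def contr_def by (metis append_Cons)

lemma alternating_iff_contr:
  "alternating G \<longleftrightarrow> (\<forall>x y w. G (x # y # w) = - G (y # x # w)) \<and> (\<forall>x. alternating (contr x G))"
proof
  assume "alternating G"
  moreover from this have "G (x # y # w) = - G (y # x # w)" for x y w
    using append_Nil unfolding alternating_def by metis
  ultimately show "(\<forall>x y w. G (x # y # w) = - G (y # x # w)) \<and> (\<forall>x. alternating (contr x G))"
    by (blast intro: alternating_contr)
next
  assume *: "(\<forall>x y w. G (x # y # w) = - G (y # x # w)) \<and> (\<forall>x. alternating (contr x G))"
  show "alternating G"
    unfolding alternating_def
  proof (intro allI)
    fix u x y v
    show "G (u @ x # y # v) = - G (u @ y # x # v)"
    proof (cases u)
      case Nil
      then show ?thesis
        using * by (metis append_Nil)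
    next
      case (Cons z u')
      have "contr z G (u' @ x # y # v) = - contr z G (u' @ y # x # v)"
        using * unfolding alternating_def by blast
      with Cons show ?thesis
        by simp
    qed
  qed
qed

lemma alternating_swap_front: "alternating G \<Longrightarrow> G (x # y # w) = - G (y # x # w)"
  by (meson alternating_iff_contr)

lemma contr_contr: "alternating G \<Longrightarrow> contr x (contr y G) = (\<lambda>w. - contr y (contr x G) w)"
  unfolding contr_def by (rule ext) (rule alternating_swap_front)

lemma contr_cond [simp]: "contr x (\<lambda>w. if b then G w else 0) = (\<lambda>w. if b then contr x G w else 0)"
  and contr_uminus [simp]: "contr x (\<lambda>w. - G w) = (\<lambda>w. - contr x G w)"
  and contr_add [simp]: "contr x (\<lambda>w. F w + G w) = (\<lambda>w. contr x F w + contr x G w)"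
  and contr_diff [simp]: "contr x (\<lambda>w. F w - G w) = (\<lambda>w. contr x F w - contr x G w)"
  and contr_scale [simp]: "contr x (\<lambda>w. c * G w) = (\<lambda>w. c * contr x G w)"
  and contr_sum [simp]: "contr x (\<lambda>w. \<Sum>i\<in>I. H i w) = (\<lambda>w. \<Sum>i\<in>I. contr x (H i) w)"
  by (auto simp: contr_def fun_eq_iff)

lemma wedge_add: "wedge x (\<lambda>w. F w + G w) w = wedge x F w + wedge x G w"
  by (induction w arbitrary: F G) (auto simp del: contr_apply)

lemma wedge_scale: "wedge x (\<lambda>w. c * G w) w = c * wedge x G w"
  by (induction w arbitrary: G) (auto simp: algebra_simps simp del: contr_apply)

lemma wedge_uminus: "wedge x (\<lambda>w. - G w) w = - wedge x G w"
  using wedge_scale[of x "-1" G w] by simp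

lemma wedge_diff: "wedge x (\<lambda>w. F w - G w) w = wedge x F w - wedge x G w"
  using wedge_add[of x F "\<lambda>w. - G w" w] by (simp add: wedge_uminus)

lemma wedge_zero [simp]: "wedge x (\<lambda>w. 0) w = 0"
  using wedge_scale[of x 0 "\<lambda>w. 0" w] by simp

lemma wedge_cond: "wedge x (\<lambda>w. if b then G w else 0) w = (if b then wedge x G w else 0)"
  by (cases b) auto

lemma wedge_sum: "wedge x (\<lambda>w. \<Sum>i\<in>I. H i w) w = (\<Sum>i\<in>I. wedge x (H i) w)"
  by (induction I rule: infinite_finite_induct) (auto simp: wedge_add)

lemmas wedge_linear = wedge_add wedge_scale wedge_uminus wedge_diff wedge_sum wedge_cond

lemma contr_wedge [simp]:
  "contr y (wedge x G) = (\<lambda>w. (if x = y then G w else 0) - wedge x (contr y G) w)"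
  by (simp add: contr_def)

lemma alternating_wedge: "alternating G \<Longrightarrow> alternating (wedge x G)"
proof -
  have "wedge x G (u @ y # z # v) = - wedge x G (u @ z # y # v)" if "alternating G" for u y z v G
    using that
  proof (induction u arbitrary: G)
    case Nil
    then have "contr z (contr y G) = (\<lambda>w. - contr y (contr z G) w)"
      by (rule contr_contr)
    then have "wedge x (contr z (contr y G)) v = - wedge x (contr y (contr z G)) v"
      by (simp only: wedge_uminus)
    then show ?case
      by (simp)
  next
    case (Cons a u)
    have "wedge x (contr a G) (u @ y # z # v) = - wedge x (contr a G) (u @ z # y # v)"
      by (rule Cons.IH[OF alternating_contr[OF Cons.prems]])
    moreover have "G (u @ y # z # v) = - G (u @ z # y # v)"
      using Cons.prems by (rule alternatingD)
    ultimately show ?case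
      by simp
  qed
  then show "alternating G \<Longrightarrow> alternating (wedge x G)"
    unfolding alternating_def by blast
qed

lemma alternating_sum:
  "(\<And>i. i \<in> I \<Longrightarrow> alternating (H i)) \<Longrightarrow> alternating (\<lambda>w. \<Sum>i\<in>I. c i * H i w)"
  unfolding alternating_def[of "\<lambda>w. \<Sum>i\<in>I. c i * H i w"] sum_negf[symmetric]
  by (intro allI sum.cong refl) (metis alternatingD mult_minus_right)

text \<open>Homogeneity for an arbitrary additive statistic of the letters. One notion serves for
  the degree, for the alphabet and for the \<open>sl_2\<close> weights, so that only one pair of
  rules for \<open>contr\<close> and \<open>wedge\<close> is needed.\<close>

definition word_support :: "('a \<Rightarrow> int) \<Rightarrow> int \<Rightarrow> ('a list \<Rightarrow> complex) \<Rightarrow> bool" where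
  "word_support k c G \<longleftrightarrow> (\<forall>w. G w \<noteq> 0 \<longrightarrow> sum_list (map k w) = c)"

lemma word_support_contr: "word_support k c G \<Longrightarrow> word_support k (c - k x) (contr x G)"
  by (auto simp: word_support_def)

lemma word_support_wedge: "word_support k c G \<Longrightarrow> word_support k (c + k x) (wedge x G)"
proof -
  have "wedge x G w \<noteq> 0 \<Longrightarrow> sum_list (map k w) = c + k x" if "word_support k c G" for w G c
    using that
  proof (induction w arbitrary: G c)
    case (Cons y w)
    have "wedge x (contr y G) w \<noteq> 0 \<Longrightarrow> sum_list (map k w) = c - k y + k x"
      using Cons.IH[of "contr y G" "c - k y"] word_support_contr[OF Cons.prems(2)] by blast
    moreover have "wedge x (contr y G) w \<noteq> 0 \<or> x = y \<and> G w \<noteq> 0"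
      using Cons.prems(1) by (auto split: if_splits)
    ultimately show ?case
      using Cons.prems(2) by (auto simp: word_support_def)
  qed simp
  then show "word_support k c G \<Longrightarrow> word_support k (c + k x) (wedge x G)"
    by (simp add: word_support_def)
qed

lemma word_support_sum:
  "(\<And>i. i \<in> I \<Longrightarrow> word_support k c (H i)) \<Longrightarrow> word_support k c (\<lambda>w. \<Sum>i\<in>I. a i * H i w)"
  unfolding word_support_def by (metis (no_types, lifting) mult_eq_0_iff sum.neutral)

text \<open>Induction on the word: its first letter contributes once, and for the other letters the
  sign in the recursion of \<open>wedge\<close> cancels the sign from exchanging two
  contractions.\<close>

lemma number_operator:
  assumes "finite X" "alternating G" "set w \<subseteq> X"
  shows "(\<Sum>x\<in>X. wedge x (contr x G) w) = of_nat (length w) * G w"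
  using assms(2,3)
proof (induction w arbitrary: G)
  case (Cons z w)
  have "contr z (contr x G) = (\<lambda>w. - contr x (contr z G) w)" for x
    using Cons.prems(1) by (rule contr_contr)
  then have *: "wedge x (contr z (contr x G)) w = - wedge x (contr x (contr z G)) w" for x
    by (simp only: wedge_uminus)
  have "(\<Sum>x\<in>X. wedge x (contr x G) (z # w)) =
      (\<Sum>x\<in>X. if x = z then G (z # w) else 0) + (\<Sum>x\<in>X. wedge x (contr x (contr z G)) w)"
    unfolding sum.distrib[symmetric] by (intro sum.cong) (auto simp: *)
  also have "(\<Sum>x\<in>X. wedge x (contr x (contr z G)) w) = of_nat (length w) * contr z G w"
    using Cons.prems by (intro Cons.IH alternating_contr) auto
  also have "(\<Sum>x\<in>X. if x = z then G (z # w) else 0) = G (z # w)"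
    using Cons.prems(2) assms(1) by simp
  finally show ?case
    by (simp add: algebra_simps)
qed simp

section \<open>The inner product on words of a given length\<close>

definition words :: "'a set \<Rightarrow> nat \<Rightarrow> 'a list set" where
  "words X N = {w. set w \<subseteq> X \<and> length w = N}"

text \<open>The sum runs over words, not sets, so each monomial of degree \<open>N\<close> is
  counted with all its orderings. This is why \<open>wedge x\<close> and \<open>contr x\<close> are
  adjoint only up to the factor \<open>Suc N\<close>.\<close>

definition word_inner ::
    "'a set \<Rightarrow> nat \<Rightarrow> ('a list \<Rightarrow> complex) \<Rightarrow> ('a list \<Rightarrow> complex) \<Rightarrow> complex" where
  "word_inner X N F G = (\<Sum>w\<in>words X N. F w * cnj (G w))"

lemma finite_words [simp]: "finite X \<Longrightarrow> finite (words X N)"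
  unfolding words_def by (rule finite_lists_length_eq)

lemma word_inner_0: "word_inner X 0 F G = F [] * cnj (G [])"
proof -
  have "words X 0 = {[]}"
    by (auto simp: words_def)
  then show ?thesis
    by (simp add: word_inner_def)
qed

lemma word_inner_Suc:
  assumes "finite X"
  shows "word_inner X (Suc N) F G = (\<Sum>y\<in>X. word_inner X N (contr y F) (contr y G))"
proof -
  have "words X (Suc N) = (\<lambda>(y, w). y # w) ` (X \<times> words X N)"
    by (auto simp: words_def length_Suc_conv image_iff)
  moreover have "inj_on (\<lambda>(y, w). y # w) (X \<times> words X N)"
    by (auto simp: inj_on_def)
  ultimately have "word_inner X (Suc N) F G =
      (\<Sum>(y, w)\<in>X \<times> words X N. contr y F w * cnj (contr y G w))"
    by (simp add: word_inner_def sum.reindex case_prod_unfold)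
  also have "\<dots> = (\<Sum>y\<in>X. word_inner X N (contr y F) (contr y G))"
    using assms by (simp add: sum.cartesian_product word_inner_def)
  finally show ?thesis .
qed

lemma word_inner_diff_right:
  "word_inner X N F (\<lambda>w. G w - H w) = word_inner X N F G - word_inner X N F H"
  by (simp add: word_inner_def algebra_simps sum_subtractf)

lemma word_inner_uminus_left: "word_inner X N (\<lambda>w. - F w) G = - word_inner X N F G"
  by (simp add: word_inner_def sum_negf)

lemma word_inner_sum_scale_left:
  "word_inner X N (\<lambda>w. \<Sum>i\<in>I. c i * H i w) G = (\<Sum>i\<in>I. c i * word_inner X N (H i) G)"
  by (simp add: word_inner_def sum_distrib_right sum_distrib_left sum.swap[of _ I] mult.assoc)

lemma word_inner_sum_scale_right:
  "word_inner X N G (\<lambda>w. \<Sum>i\<in>I. c i * H i w) = (\<Sum>i\<in>I. cnj (c i) * word_inner X N G (H i))"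
  by (simp add: word_inner_def sum_distrib_right sum_distrib_left sum.swap[of _ I] algebra_simps)

lemma word_inner_commute: "word_inner X N G F = cnj (word_inner X N F G)"
  by (simp add: word_inner_def mult.commute)

lemma word_inner_cond_right:
  "word_inner X N F (\<lambda>w. if b then G w else 0) = (if b then word_inner X N F G else 0)"
  by (simp add: word_inner_def)

definition word_norm2 :: "'a set \<Rightarrow> nat \<Rightarrow> ('a list \<Rightarrow> complex) \<Rightarrow> real" where
  "word_norm2 X N G = (\<Sum>w\<in>words X N. (cmod (G w))\<^sup>2)"

lemma word_inner_self: "word_inner X N G G = of_real (word_norm2 X N G)"
  unfolding word_inner_def word_norm2_def of_real_sum
  by (intro sum.cong) (auto simp: complex_norm_square[symmetric])

lemma word_norm2_nonneg: "0 \<le> word_norm2 X N G"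
  by (simp add: word_norm2_def sum_nonneg)

lemma word_norm2_eq_0_iff:
  "finite X \<Longrightarrow> word_norm2 X N G = 0 \<longleftrightarrow> (\<forall>w\<in>words X N. G w = 0)"
  by (simp add: word_norm2_def sum_nonneg_eq_0_iff)

text \<open>Splitting off the first letter, the letter \<open>x\<close> itself supplies one copy of
  the right-hand side, and the induction hypothesis supplies the others after \<open>contr x\<close>
  and \<open>contr y\<close> are exchanged.\<close>

lemma word_inner_wedge:
  assumes "finite X" "x \<in> X" "alternating F"
  shows "word_inner X (Suc N) F (wedge x G) = of_nat (Suc N) * word_inner X N (contr x F) G"
  using assms(3)
proof (induction N arbitrary: F G)
  case 0
  have "word_inner X (Suc 0) F (wedge x G) = (\<Sum>y\<in>X. if x = y then F [x] * cnj (G []) else 0)"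
    unfolding word_inner_Suc[OF assms(1)] by (intro sum.cong) (auto simp: word_inner_0)
  then show ?case
    using assms by (simp add: word_inner_0)
next
  case (Suc N)
  have *: "contr x (contr y F) = (\<lambda>w. - contr y (contr x F) w)" for y
    using Suc.prems by (rule contr_contr)
  have "word_inner X (Suc (Suc N)) F (wedge x G) =
     (\<Sum>y\<in>X. if x = y then word_inner X (Suc N) (contr y F) G else 0)
     - (\<Sum>y\<in>X. word_inner X (Suc N) (contr y F) (wedge x (contr y G)))"
    unfolding word_inner_Suc[OF assms(1), of "Suc N"] sum_subtractf[symmetric]
    by (intro sum.cong) (auto simp: word_inner_diff_right word_inner_cond_right)
  also have "(\<Sum>y\<in>X. word_inner X (Suc N) (contr y F) (wedge x (contr y G))) =
      (\<Sum>y\<in>X. of_nat (Suc N) * word_inner X N (contr x (contr y F)) (contr y G))"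
    by (intro sum.cong refl Suc.IH alternating_contr Suc.prems)
  also have "\<dots> = - of_nat (Suc N) * word_inner X (Suc N) (contr x F) G"
    unfolding * word_inner_Suc[OF assms(1), of N] word_inner_uminus_left
    by (simp only: mult_minus_left mult_minus_right sum_negf sum_distrib_left)
  finally show ?case
    using assms by (simp add: algebra_simps del: contr_apply)
qed

section \<open>The Lefschetz operators of a symplectic form\<close>

text \<open>The letters are a basis of a symplectic space, paired by \<open>dual\<close> with
  coefficients 1 or -1. As \<open>eps\<close> changes sign under \<open>dual\<close>, the two orders
  of a pair contribute equally to the form instead of cancelling, and no letter is its own dual.
  \<open>n0\<close> counts the dual pairs and is the middle degree of the exterior algebra.\<close>

locale symplectic_letters =
  fixes X :: "'a set" and dual :: "'a \<Rightarrow> 'a" and eps :: "'a \<Rightarrow> complex" and n0 :: nat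
  assumes finite_X [simp]: "finite X"
    and dual_in [simp]: "x \<in> X \<Longrightarrow> dual x \<in> X"
    and dual_dual [simp]: "x \<in> X \<Longrightarrow> dual (dual x) = x"
    and eps_dual [simp]: "x \<in> X \<Longrightarrow> eps (dual x) = - eps x"
    and eps_square: "eps x * eps x = 1"
    and cnj_eps [simp]: "cnj (eps x) = eps x"
    and card_X: "card X = 2 * n0"
begin

definition lower :: "('a list \<Rightarrow> complex) \<Rightarrow> 'a list \<Rightarrow> complex" where
  "lower G = (\<lambda>w. \<Sum>x\<in>X. eps x * contr x (contr (dual x) G) w)"

text \<open>Multiplication by the form, with \<open>lower\<close> as its adjoint up to a factor
  depending on the degree. Summing over all letters counts every dual pair twice.\<close>

definition lift :: "('a list \<Rightarrow> complex) \<Rightarrow> 'a list \<Rightarrow> complex" where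
  "lift G = (\<lambda>w. \<Sum>x\<in>X. eps x * wedge (dual x) (wedge x G) w)"

lemma alternating_lower: "alternating G \<Longrightarrow> alternating (lower G)"
  unfolding lower_def by (intro alternating_sum alternating_contr)

lemma alternating_lift: "alternating G \<Longrightarrow> alternating (lift G)"
  unfolding lift_def by (intro alternating_sum alternating_wedge)

lemma word_support_lower:
  assumes "word_support k c G" "\<And>x. x \<in> X \<Longrightarrow> k x + k (dual x) = e"
  shows "word_support k (c - e) (lower G)"
  unfolding lower_def
proof (rule word_support_sum)
  fix x assume "x \<in> X"
  with assms(2)[of x] have "c - k (dual x) - k x = c - e"
    by simp
  then show "word_support k (c - e) (contr x (contr (dual x) G))"
    using word_support_contr[OF word_support_contr[OF assms(1)]] by metis
qed

lemma word_support_lift: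
  assumes "word_support k c G" "\<And>x. x \<in> X \<Longrightarrow> k x + k (dual x) = e"
  shows "word_support k (c + e) (lift G)"
  unfolding lift_def
proof (rule word_support_sum)
  fix x assume "x \<in> X"
  with assms(2)[of x] have "c + k x + k (dual x) = c + e"
    by simp
  then show "word_support k (c + e) (wedge (dual x) (wedge x G))"
    using word_support_wedge[OF word_support_wedge[OF assms(1)]] by metis
qed

text \<open>Contraction by \<open>z\<close> meets the form in the summands \<open>x = z\<close> and
  \<open>x = dual z\<close>; both give the same term, whence the factor 2.\<close>

lemma contr_lift:
  assumes "z \<in> X"
  shows "lift G (z # w) = lift (contr z G) w - 2 * eps z * wedge (dual z) G w"
proof -
  have eq: "dual x = z \<longleftrightarrow> x = dual z" if "x \<in> X" for x
    using that assms by (metis dual_dual)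
  have "lift G (z # w) = (\<Sum>x\<in>X. (if x = dual z then eps x * wedge x G w else 0)
      - (if x = z then eps x * wedge (dual x) G w else 0)
      + eps x * wedge (dual x) (wedge x (contr z G)) w)"
    unfolding lift_def
    by (intro sum.cong) (auto simp: wedge_linear eq algebra_simps simp del: contr_apply)
  also have "\<dots> = eps (dual z) * wedge (dual z) G w - eps z * wedge (dual z) G w + lift (contr z G) w"
    using assms by (simp add: sum.distrib sum_subtractf lift_def)
  finally show ?thesis
    using assms by (simp add: algebra_simps)
qed

lemma sum_dual: "(\<Sum>x\<in>X. h (dual x)) = (\<Sum>x\<in>X. h x)"
  by (rule sum.reindex_bij_witness[of _ dual dual]) auto

text \<open>Carrying both contractions past \<open>lift\<close> with \<open>contr_lift\<close>
  leaves \<open>2 * G\<close> for each of the \<open>2 * n0\<close> letters, minus terms that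
  \<open>sum_dual\<close> and \<open>number_operator\<close> turn into a multiple of the degree. The
  factor 4 reflects the double count of pairs in both operators.\<close>

lemma commutator:
  assumes "alternating G" "set w \<subseteq> X"
  shows "lower (lift G) w = lift (lower G) w + 4 * (of_nat n0 - of_nat (length w)) * G w"
proof -
  have num: "(\<Sum>x\<in>X. wedge x (contr x G) w) = of_nat (length w) * G w"
    using number_operator[OF finite_X assms] .
  have lift2: "lift G (dual y # y # w) = lift (contr y (contr (dual y) G)) w
      - 2 * eps y * wedge (dual y) (contr (dual y) G) w + 2 * eps y * (G w - wedge y (contr y G) w)"
    if "y \<in> X" for y
    using that by (simp add: contr_lift)
  have "lower (lift G) w = (\<Sum>y\<in>X. eps y * lift (contr y (contr (dual y) G)) w
      + 2 * G w - 2 * wedge (dual y) (contr (dual y) G) w - 2 * wedge y (contr y G) w)"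
    unfolding lower_def
  proof (rule sum.cong[OF refl])
    fix y assume "y \<in> X"
    have "eps y * (a - 2 * eps y * b + 2 * eps y * c) = eps y * a - 2 * (eps y * eps y) * b
       + 2 * (eps y * eps y) * c" for a b c
      by (simp add: algebra_simps)
    then show "eps y * contr y (contr (dual y) (lift G)) w = eps y * lift (contr y (contr (dual y) G)) w
      + 2 * G w - 2 * wedge (dual y) (contr (dual y) G) w - 2 * wedge y (contr y G) w"
      unfolding contr_apply lift2[OF \<open>y \<in> X\<close>, unfolded contr_apply] by (simp add: eps_square)
  qed
  also have "\<dots> = (\<Sum>y\<in>X. eps y * lift (contr y (contr (dual y) G)) w) + 4 * of_nat n0 * G w
      - 4 * (of_nat (length w) * G w)"
    using sum_dual[of "\<lambda>y. 2 * wedge y (contr y G) w"]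
    by (simp add: sum.distrib sum_subtractf card_X sum_distrib_left[symmetric] num)
  also have "(\<Sum>y\<in>X. eps y * lift (contr y (contr (dual y) G)) w) = lift (lower G) w"
    unfolding lift_def lower_def wedge_linear
    by (simp only: wedge_linear sum_distrib_left, subst sum.swap)
      (simp add: wedge_linear algebra_simps sum_distrib_left)
  finally show ?thesis
    by (simp add: algebra_simps)
qed

text \<open>Two uses of \<open>word_inner_wedge\<close>; the coefficients \<open>eps\<close> are
  real, so conjugation leaves them unchanged.\<close>

lemma word_inner_lift:
  assumes "alternating F"
  shows "word_inner X (N + 2) F (lift G) = of_nat (N + 2) * of_nat (N + 1) * word_inner X N (lower F) G"
proof -
  have "word_inner X (N + 2) F (lift G) =
      (\<Sum>x\<in>X. eps x * word_inner X (Suc (Suc N)) F (wedge (dual x) (wedge x G)))"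
    by (simp add: lift_def word_inner_sum_scale_right)
  also have "\<dots> = (\<Sum>x\<in>X. eps x * (of_nat (N + 2) * (of_nat (N + 1)
      * word_inner X N (contr x (contr (dual x) F)) G)))"
  proof (intro sum.cong refl arg_cong2[where f = "(*)"])
    fix x assume "x \<in> X"
    then show "word_inner X (Suc (Suc N)) F (wedge (dual x) (wedge x G)) =
        of_nat (N + 2) * (of_nat (N + 1) * word_inner X N (contr x (contr (dual x) F)) G)"
      using assms by (simp add: word_inner_wedge alternating_contr del: of_nat_Suc)
  qed
  also have "\<dots> = of_nat (N + 2) * of_nat (N + 1) * word_inner X N (lower F) G"
    unfolding lower_def word_inner_sum_scale_left sum_distrib_left
    by (intro sum.cong) (auto simp: algebra_simps)
  finally show ?thesis .
qed

text \<open>Pairing \<open>commutator\<close> with \<open>G\<close> expresses the norm of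
  \<open>lift G\<close> by those of \<open>lower G\<close> and \<open>G\<close>. The remainder
  \<open>r\<close> is \<open>N * (N - 1)\<close> times the squared norm of \<open>lower G\<close> in
  degree \<open>N - 2\<close>; it is left existential so that \<open>N < 2\<close>, where
  \<open>r = 0\<close>, needs no separate statement.\<close>

lemma word_norm2_lift:
  assumes "alternating G"
  shows "\<exists>r\<ge>0. word_norm2 X (N + 2) (lift G) =
      real (N + 2) * real (N + 1) * (r + 4 * (real n0 - real N) * word_norm2 X N G)
      \<and> ((\<forall>w. lower G w = 0) \<longrightarrow> r = 0)"
proof -
  obtain r where r: "r \<ge> 0" "word_inner X N (lift (lower G)) G = of_real r"
     "(\<forall>w. lower G w = 0) \<longrightarrow> r = 0"
  proof (cases "N \<ge> 2")
    case False
    \<comment> \<open>A word of fewer than two letters has no room for the form.\<close>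
    then have "lift H w = 0" if "w \<in> words X N" for w H
      using that unfolding lift_def words_def
      by (cases w; cases "tl w") (auto intro!: sum.neutral simp: wedge_linear)
    then have "word_inner X N (lift (lower G)) G = 0"
      by (simp add: word_inner_def)
    then show ?thesis
      using that[of 0] by simp
  next
    case True
    then obtain M where M: "N = M + 2"
      using le_Suc_ex by (metis add.commute)
    have "word_inner X N (lift (lower G)) G =
        cnj (of_nat (M + 2) * of_nat (M + 1) * word_inner X M (lower G) (lower G))"
      unfolding M using word_inner_lift[OF assms] by (metis word_inner_commute)
    also have "\<dots> = of_real (real (M + 2) * real (M + 1) * word_norm2 X M (lower G))"
      by (simp add: word_inner_self)
    finally show ?thesis
      using that[of "real (M + 2) * real (M + 1) * word_norm2 X M (lower G)"]
      by (simp add: word_norm2_nonneg) (simp add: word_norm2_def)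
  qed
  have "complex_of_real (word_norm2 X (N + 2) (lift G)) =
      of_nat (N + 2) * of_nat (N + 1) * word_inner X N (lower (lift G)) G"
    using word_inner_lift[OF alternating_lift[OF assms]] by (metis word_inner_self)
  also have "word_inner X N (lower (lift G)) G = word_inner X N (lift (lower G)) G
      + 4 * (of_nat n0 - of_nat N) * word_inner X N G G"
    unfolding word_inner_def sum_distrib_left sum.distrib[symmetric]
    by (intro sum.cong refl) (auto simp: commutator[OF assms] words_def algebra_simps)
  also have "\<dots> = of_real (r + 4 * (real n0 - real N) * word_norm2 X N G)"
    by (simp add: r(2) word_inner_self)
  finally have "complex_of_real (word_norm2 X (N + 2) (lift G)) =
      of_real (real (N + 2) * real (N + 1) * (r + 4 * (real n0 - real N) * word_norm2 X N G))"
    by simp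
  then have "word_norm2 X (N + 2) (lift G) =
      real (N + 2) * real (N + 1) * (r + 4 * (real n0 - real N) * word_norm2 X N G)"
    using of_real_eq_iff by blast
  with r show ?thesis
    by blast
qed

text \<open>Below degree \<open>n0\<close> both terms in \<open>word_norm2_lift\<close> are
  nonnegative, so a vanishing \<open>lift G\<close> forces the norm of \<open>G\<close> to
  vanish.\<close>

lemma lift_eq_0_imp:
  assumes "alternating G" "N < n0" "\<And>w. lift G w = 0" "w \<in> words X N"
  shows "G w = 0"
proof -
  obtain r where r: "r \<ge> 0" "word_norm2 X (N + 2) (lift G) =
      real (N + 2) * real (N + 1) * (r + 4 * (real n0 - real N) * word_norm2 X N G)"
    using word_norm2_lift[OF assms(1)] by blast
  have "word_norm2 X (N + 2) (lift G) = 0"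
    using assms(3) by (simp add: word_norm2_def)
  then have "r + 4 * (real n0 - real N) * word_norm2 X N G = 0"
    using r(2) by auto
  moreover have "4 * (real n0 - real N) * word_norm2 X N G \<ge> 0"
    using assms(2) word_norm2_nonneg[of X N G] by simp
  ultimately have "4 * (real n0 - real N) * word_norm2 X N G = 0"
    using r(1) by linarith
  then have "word_norm2 X N G = 0"
    using assms(2) by simp
  then show ?thesis
    using assms(4) by (simp add: word_norm2_eq_0_iff)
qed

text \<open>If \<open>lower G\<close> vanishes, then \<open>r = 0\<close>, and above degree
  \<open>n0\<close> the squared norm of \<open>lift G\<close> is a negative multiple of that of
  \<open>G\<close>; so both are zero.\<close>

lemma lower_eq_0_imp:
  assumes "alternating G" "n0 < N" "\<And>w. lower G w = 0" "w \<in> words X N"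
  shows "G w = 0"
proof -
  have "word_norm2 X (N + 2) (lift G) =
      real (N + 2) * real (N + 1) * (4 * (real n0 - real N) * word_norm2 X N G)"
    using word_norm2_lift[OF assms(1), of N] assms(3) by auto
  then have "0 \<le> real (N + 2) * real (N + 1) * (4 * (real n0 - real N) * word_norm2 X N G)"
    by (metis word_norm2_nonneg)
  moreover have "0 < real (N + 2) * real (N + 1)"
    by simp
  ultimately have "0 \<le> 4 * (real n0 - real N) * word_norm2 X N G"
    by (meson zero_le_mult_iff not_less)
  moreover have "4 * (real n0 - real N) < 0"
    using assms(2) by simp
  ultimately have "word_norm2 X N G \<le> 0"
    by (meson zero_le_mult_iff not_less)
  then have "word_norm2 X N G = 0"
    using word_norm2_nonneg[of X N G] by simp
  then show ?thesis
    using assms(4) by (simp add: word_norm2_eq_0_iff)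
qed

end

section \<open>Highest weight vectors of the exterior algebra\<close>

text \<open>
  The letters \<open>x \<subseteq> {..<d}\<close> are the weight vectors of the \<open>d\<close>-fold tensor power of the plane, and
  \<open>raise i\<close> is the raising operator of the \<open>i\<close>-th copy of \<open>sl_2\<close>, extended as a derivation.
\<close>

fun raise :: "nat \<Rightarrow> (nat set list \<Rightarrow> complex) \<Rightarrow> nat set list \<Rightarrow> complex" where
  "raise i G [] = 0"
| "raise i G (x # w) = (if i \<in> x then G ((x - {i}) # w) else 0) + raise i (contr x G) w"

lemma raise_add: "raise i (\<lambda>w. F w + G w) w = raise i F w + raise i G w"
  by (induction w arbitrary: F G) (auto simp del: contr_apply)

lemma raise_scale: "raise i (\<lambda>w. c * G w) w = c * raise i G w"
  by (induction w arbitrary: G) (auto simp: algebra_simps simp del: contr_apply)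

lemma raise_uminus: "raise i (\<lambda>w. - G w) w = - raise i G w"
  using raise_scale[of i "-1" G w] by simp

lemma raise_diff: "raise i (\<lambda>w. F w - G w) w = raise i F w - raise i G w"
  using raise_add[of i F "\<lambda>w. - G w" w] by (simp add: raise_uminus)

lemma raise_zero [simp]: "raise i (\<lambda>w. 0) w = 0"
  using raise_scale[of i 0 "\<lambda>w. 0" w] by simp

lemma raise_cond: "raise i (\<lambda>w. if b then G w else 0) w = (if b then raise i G w else 0)"
  by (cases b) auto

lemma raise_sum: "raise i (\<lambda>w. \<Sum>j\<in>I. H j w) w = (\<Sum>j\<in>I. raise i (H j) w)"
  by (induction I rule: infinite_finite_induct) (auto simp: raise_add)

lemmas raise_linear = raise_add raise_scale raise_uminus raise_diff raise_sum raise_cond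

lemma contr_raise:
  "contr x (raise i G) = (\<lambda>w. (if i \<in> x then contr (x - {i}) G w else 0) + raise i (contr x G) w)"
  by (simp add: fun_eq_iff)

text \<open>The derivation rule. On a letter seen as a vector the raising operator adds
  \<open>i\<close>; \<open>raise\<close> itself removes \<open>i\<close> because it acts on
  coefficient functions.\<close>

lemma raise_wedge:
  "raise i (wedge x G) w = wedge x (raise i G) w + (if i \<notin> x then wedge (insert i x) G w else 0)"
proof (induction w arbitrary: G)
  case (Cons z w)
  have eq: "i \<in> z \<and> x = z - {i} \<longleftrightarrow> i \<notin> x \<and> insert i x = z"
    by auto
  have "raise i (wedge x G) (z # w) =
      (if i \<in> z then (if x = z - {i} then G w else 0) - wedge x (contr (z - {i}) G) w else 0)
      + ((if x = z then raise i G w else 0) - (wedge x (raise i (contr z G)) w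
      + (if i \<notin> x then wedge (insert i x) (contr z G) w else 0)))"
    by (simp add: raise_linear Cons.IH del: contr_apply)
  moreover have "wedge x (raise i G) (z # w) + (if i \<notin> x then wedge (insert i x) G (z # w) else 0) =
      (if x = z then raise i G w else 0) - ((if i \<in> z then wedge x (contr (z - {i}) G) w else 0)
      + wedge x (raise i (contr z G)) w) + (if i \<notin> x then (if insert i x = z then G w else 0) -
      wedge (insert i x) (contr z G) w else 0)"
    by (simp add: contr_raise wedge_linear del: contr_apply)
  ultimately show ?case
    using eq by auto
qed simp

definition letter_weight :: "nat \<Rightarrow> nat set \<Rightarrow> int" where
  "letter_weight i x = (if i \<in> x then 1 else -1)"

definition hw_space :: "nat \<Rightarrow> nat \<Rightarrow> (nat \<Rightarrow> int) \<Rightarrow> (nat set list \<Rightarrow> complex) set" where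
  "hw_space d N c = {G. alternating G \<and> (\<forall>w. G w \<noteq> 0 \<longrightarrow> w \<in> words (Pow {..<d}) N) \<and>
     (\<forall>i<d. word_support (letter_weight i) (c i) G) \<and> (\<forall>i<d. \<forall>w. raise i G w = 0)}"

text \<open>Up to a global sign, the coefficients of the \<open>d\<close>-th tensor power of the
  area form of the plane, which pairs each letter with its complement.\<close>

definition subset_sign :: "nat set \<Rightarrow> complex" where
  "subset_sign x = (-1) ^ card x"

locale odd_cube =
  fixes d :: nat
  assumes odd_d: "odd d"

sublocale odd_cube \<subseteq> symplectic_letters "Pow {..<d}" "\<lambda>x. {..<d} - x" subset_sign "2 ^ (d - 1)"
proof
  fix x :: "nat set" assume x: "x \<in> Pow {..<d}"
  show "subset_sign ({..<d} - x) = - subset_sign x"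
  proof -
    have "card ({..<d} - x) + card x = d"
      using x by (metis Diff_partition Pow_iff add.commute card_Diff_subset card_lessThan
          card_mono finite_lessThan finite_subset le_add_diff_inverse2)
    \<comment> \<open>The exponents add up to \<open>d\<close>, which is odd.\<close>
    then have "subset_sign ({..<d} - x) * subset_sign x = -1"
      using odd_d unfolding subset_sign_def power_add[symmetric] by simp
    then show ?thesis
      by (auto simp: subset_sign_def minus_one_power_iff split: if_splits)
  qed
next
  have "d \<noteq> 0"
    using odd_d by (rule contrapos_pn) simp
  then show "card (Pow {..<d}) = 2 * 2 ^ (d - 1)"
    by (cases d) (auto simp: card_Pow)
qed (auto simp: subset_sign_def power_add[symmetric] minus_one_power_iff)

context odd_cube
begin

text \<open>Pairs \<open>x\<close> with \<open>x - {i}\<close>, the two weight vectors that the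
  \<open>i\<close>-th \<open>sl_2\<close> exchanges; the unwanted terms of
  \<open>raise_lower\<close> and \<open>raise_lift\<close> cancel within such a pair.\<close>

lemma sum_letters_split:
  assumes "i < d"
  shows "(\<Sum>x\<in>Pow {..<d}. h x) = (\<Sum>x\<in>{x\<in>Pow {..<d}. i \<in> x}. h x + h (x - {i}))"
proof -
  have "(\<Sum>x\<in>Pow {..<d}. h x) = (\<Sum>x\<in>{x\<in>Pow {..<d}. i \<in> x}. h x) + (\<Sum>x\<in>{x\<in>Pow {..<d}. i \<notin> x}. h x)"
    by (subst sum.union_disjoint[symmetric]) (auto intro!: sum.cong)
  also have "(\<Sum>x\<in>{x\<in>Pow {..<d}. i \<notin> x}. h x) = (\<Sum>x\<in>{x\<in>Pow {..<d}. i \<in> x}. h (x - {i}))"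
    by (rule sum.reindex_bij_witness[of _ "\<lambda>x. x - {i}" "insert i"]) (use assms in auto)
  finally show ?thesis
    by (simp add: sum.distrib)
qed

lemma subset_sign_remove:
  assumes "i \<in> x" "x \<subseteq> {..<d}"
  shows "subset_sign (x - {i}) = - subset_sign x"
proof -
  have "card x = Suc (card (x - {i}))"
    using assms by (metis card.remove finite_lessThan finite_subset)
  then show ?thesis
    by (simp add: subset_sign_def)
qed

text \<open>Besides \<open>lower (raise i G)\<close> there remain the terms in which
  \<open>raise i\<close> acts on one of the two contracted letters. Those for \<open>x\<close> and
  for \<open>x - {i}\<close> contain the same value of \<open>G\<close> with opposite
  \<open>subset_sign\<close>.\<close>

lemma raise_lower:
  assumes "i < d"
  shows "raise i (lower G) w = lower (raise i G) w"
proof -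
  have "raise i (lower G) w = (\<Sum>x\<in>Pow {..<d}. subset_sign x * raise i (contr x (contr ({..<d} - x) G)) w)"
    by (simp add: lower_def raise_linear del: contr_apply)
  also have "\<dots> = (\<Sum>x\<in>Pow {..<d}. subset_sign x * contr x (contr ({..<d} - x) (raise i G)) w
      - subset_sign x * ((if i \<notin> x then G (({..<d} - x - {i}) # x # w) else 0)
        + (if i \<in> x then G (({..<d} - x) # (x - {i}) # w) else 0)))"
    using assms by (intro sum.cong) (auto simp: algebra_simps)
  also have "\<dots> = lower (raise i G) w - (\<Sum>x\<in>Pow {..<d}.
      subset_sign x * ((if i \<notin> x then G (({..<d} - x - {i}) # x # w) else 0)
        + (if i \<in> x then G (({..<d} - x) # (x - {i}) # w) else 0)))"
    by (simp add: sum_subtractf lower_def)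
  also have "(\<Sum>x\<in>Pow {..<d}.
      subset_sign x * ((if i \<notin> x then G (({..<d} - x - {i}) # x # w) else 0)
        + (if i \<in> x then G (({..<d} - x) # (x - {i}) # w) else 0))) = 0"
  proof (subst sum_letters_split[OF assms], intro sum.neutral ballI)
    fix x assume "x \<in> {x \<in> Pow {..<d}. i \<in> x}"
    then have x: "i \<in> x" "x \<subseteq> {..<d}"
      by auto
    have "{..<d} - (x - {i}) - {i} = {..<d} - x"
      using x by auto
    with x show "subset_sign x * ((if i \<notin> x then G (({..<d} - x - {i}) # x # w) else 0)
        + (if i \<in> x then G (({..<d} - x) # (x - {i}) # w) else 0)) +
       subset_sign (x - {i}) * ((if i \<notin> x - {i} then G (({..<d} - (x - {i}) - {i}) # (x - {i}) # w) else 0)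
        + (if i \<in> x - {i} then G (({..<d} - (x - {i})) # (x - {i} - {i}) # w) else 0)) = 0"
      by (simp add: subset_sign_remove)
  qed
  finally show ?thesis
    by simp
qed

text \<open>The same cancellation as for \<open>lower\<close>, now with \<open>i\<close> inserted
  into one of the two multiplied letters.\<close>

lemma raise_lift:
  assumes "i < d"
  shows "raise i (lift G) w = lift (raise i G) w"
proof -
  have fn: "raise i (wedge x G) =
      (\<lambda>w. wedge x (raise i G) w + (if i \<notin> x then wedge (insert i x) G w else 0))" for x
    by (simp add: fun_eq_iff raise_wedge)
  have "raise i (lift G) w = (\<Sum>x\<in>Pow {..<d}. subset_sign x * raise i (wedge ({..<d} - x) (wedge x G)) w)"
    by (simp add: lift_def raise_linear)
  also have "\<dots> = (\<Sum>x\<in>Pow {..<d}. subset_sign x * wedge ({..<d} - x) (wedge x (raise i G)) w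
      + subset_sign x * ((if i \<in> x then wedge (insert i ({..<d} - x)) (wedge x G) w else 0)
        + (if i \<notin> x then wedge ({..<d} - x) (wedge (insert i x) G) w else 0)))"
    using assms by (intro sum.cong) (auto simp: raise_wedge[of i "{..<d} - _"] fn wedge_linear algebra_simps)
  also have "\<dots> = lift (raise i G) w + (\<Sum>x\<in>Pow {..<d}.
      subset_sign x * ((if i \<in> x then wedge (insert i ({..<d} - x)) (wedge x G) w else 0)
        + (if i \<notin> x then wedge ({..<d} - x) (wedge (insert i x) G) w else 0)))"
    by (simp add: sum.distrib lift_def)
  also have "(\<Sum>x\<in>Pow {..<d}.
      subset_sign x * ((if i \<in> x then wedge (insert i ({..<d} - x)) (wedge x G) w else 0)
        + (if i \<notin> x then wedge ({..<d} - x) (wedge (insert i x) G) w else 0))) = 0"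
  proof (subst sum_letters_split[OF assms], intro sum.neutral ballI)
    fix x assume "x \<in> {x \<in> Pow {..<d}. i \<in> x}"
    then have x: "i \<in> x" "x \<subseteq> {..<d}"
      by auto
    have "{..<d} - (x - {i}) = insert i ({..<d} - x)" "insert i (x - {i}) = x"
      using x assms by auto
    with x show "subset_sign x * ((if i \<in> x then wedge (insert i ({..<d} - x)) (wedge x G) w else 0)
        + (if i \<notin> x then wedge ({..<d} - x) (wedge (insert i x) G) w else 0)) +
       subset_sign (x - {i}) * ((if i \<in> x - {i} then wedge (insert i ({..<d} - (x - {i}))) (wedge (x - {i}) G) w else 0)
        + (if i \<notin> x - {i} then wedge ({..<d} - (x - {i})) (wedge (insert i (x - {i})) G) w else 0)) = 0"
      by (simp add: subset_sign_remove)
  qed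
  finally show ?thesis
    by simp
qed

lemma letter_weight_dual:
  "i < d \<Longrightarrow> letter_weight i x + letter_weight i ({..<d} - x) = 0"
  by (simp add: letter_weight_def)

text \<open>Counting every letter gives the length, and counting the letters outside
  \<open>X\<close> detects the alphabet. In this form both conditions are handled by
  \<open>word_support_lift\<close> and \<open>word_support_lower\<close>.\<close>

lemma words_iff_supports:
  fixes X :: "'b set"
  shows
  "(\<forall>w. G w \<noteq> 0 \<longrightarrow> w \<in> words X N) \<longleftrightarrow>
   word_support (\<lambda>_. 1) (int N) G \<and> word_support (\<lambda>x. of_bool (x \<notin> X)) 0 G"
proof -
  have "sum_list (map (\<lambda>x. of_bool (x \<notin> X)) w) = (0 :: int) \<longleftrightarrow> set w \<subseteq> X" for w
    by (subst sum_list_nonneg_eq_0_iff) auto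
  moreover have "sum_list (map (\<lambda>_. 1) w) = int (length w)" for w :: "'b list"
    by (induction w) auto
  ultimately show ?thesis
    unfolding word_support_def words_def by auto
qed

lemma lift_hw_space:
  assumes "G \<in> hw_space d N c"
  shows "lift G \<in> hw_space d (N + 2) c"
proof -
  from assms have G: "alternating G" "word_support (\<lambda>_. 1) (int N) G"
    "word_support (\<lambda>x. of_bool (x \<notin> Pow {..<d})) 0 G"
    "\<And>i. i < d \<Longrightarrow> word_support (letter_weight i) (c i) G"
    "\<And>i. i < d \<Longrightarrow> raise i G = (\<lambda>w. 0)"
    unfolding hw_space_def words_iff_supports by (auto simp: fun_eq_iff)
  have "word_support (letter_weight i) (c i) (lift G)" if "i < d" for i
    using word_support_lift[OF G(4), of i 0] letter_weight_dual[OF that] that by simp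
  moreover have "word_support (\<lambda>_. 1) (int (N + 2)) (lift G)"
    using word_support_lift[OF G(2), of 2] by (simp add: add.commute)
  moreover have "word_support (\<lambda>x. of_bool (x \<notin> Pow {..<d})) 0 (lift G)"
    using word_support_lift[OF G(3), of 0] by auto
  moreover have "raise i (lift G) w = 0" if "i < d" for i w
    using raise_lift[OF that, of G w] G(5)[OF that] wedge_zero
    by (simp add: lift_def ext[OF wedge_zero])
  ultimately show ?thesis
    unfolding hw_space_def words_iff_supports using alternating_lift[OF G(1)] by blast
qed

lemma lower_hw_space:
  assumes "G \<in> hw_space d (N + 2) c"
  shows "lower G \<in> hw_space d N c"
proof -
  from assms have G: "alternating G" "word_support (\<lambda>_. 1) (int (N + 2)) G"
    "word_support (\<lambda>x. of_bool (x \<notin> Pow {..<d})) 0 G"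
    "\<And>i. i < d \<Longrightarrow> word_support (letter_weight i) (c i) G"
    "\<And>i. i < d \<Longrightarrow> raise i G = (\<lambda>w. 0)"
    unfolding hw_space_def words_iff_supports by (auto simp: fun_eq_iff)
  have "word_support (letter_weight i) (c i) (lower G)" if "i < d" for i
    using word_support_lower[OF G(4), of i 0] letter_weight_dual[OF that] that by simp
  moreover have "word_support (\<lambda>_. 1) (int N) (lower G)"
    using word_support_lower[OF G(2), of 2] by simp
  moreover have "word_support (\<lambda>x. of_bool (x \<notin> Pow {..<d})) 0 (lower G)"
    using word_support_lower[OF G(3), of 0] by auto
  moreover have "raise i (lower G) w = 0" if "i < d" for i w
    using raise_lower[OF that, of G w] G(5)[OF that] by (simp add: lower_def)
  ultimately show ?thesis
    unfolding hw_space_def words_iff_supports using alternating_lower[OF G(1)] by blast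
qed

end

section \<open>Slices of tensors\<close>

definition tensor_cons :: "('x \<Rightarrow> complex) \<Rightarrow> ('x list \<Rightarrow> complex) \<Rightarrow> 'x list \<Rightarrow> complex" where
  "tensor_cons f F xs = (case xs of [] \<Rightarrow> 0 | x # ys \<Rightarrow> f x * F ys)"

lemma tensor_cons_pure: "tensor_cons f (pure_tensor fs) = pure_tensor (f # fs)"
proof
  fix xs
  show "tensor_cons f (pure_tensor fs) xs = pure_tensor (f # fs) xs"
    by (cases xs) (auto simp: tensor_cons_def pure_tensor_def prod.lessThan_Suc_shift simp del: prod.lessThan_Suc)
qed

lemma tensor_cons_in_tensor_space:
  assumes "f \<in> V" "F \<in> tensor_space Vs"
  shows "tensor_cons f F \<in> tensor_space (V # Vs)"
proof -
  let ?S = "\<lambda>Vs. {pure_tensor fs | fs. length fs = length Vs \<and> (\<forall>i<length Vs. fs ! i \<in> Vs ! i)}"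
  have lin: "clinear (tensor_cons f)"
    by (rule clinearI) (auto simp: tensor_cons_def fun_eq_iff algebra_simps split: list.splits)
  have "tensor_cons f ` ?S Vs \<subseteq> ?S (V # Vs)"
  proof clarify
    fix fs assume "length fs = length Vs" "\<forall>i<length Vs. fs ! i \<in> Vs ! i"
    then show "\<exists>fs'. tensor_cons f (pure_tensor fs) = pure_tensor fs' \<and>
        length fs' = length (V # Vs) \<and> (\<forall>i<length (V # Vs). fs' ! i \<in> (V # Vs) ! i)"
      using assms(1) by (intro exI[of _ "f # fs"]) (auto simp: tensor_cons_pure nth_Cons split: nat.splits)
  qed
  moreover have "tensor_cons f F \<in> cfun.span (tensor_cons f ` ?S Vs)"
    using assms(2) cfun_pair.linear_span_image[OF lin] unfolding tensor_space_def by blast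
  ultimately show ?thesis
    unfolding tensor_space_def using cfun.span_mono by blast
qed

text \<open>Expanding \<open>F\<close> in its first argument by the kernel \<open>E 0\<close> writes
  it as a finite sum of products of a vector of the first space with a function of the other
  arguments, which satisfies the same hypotheses.\<close>

lemma tensor_spaceI:
  assumes "finite X"
    and "\<And>i y. i < length Vs \<Longrightarrow> y \<in> X \<Longrightarrow> (\<lambda>x. E i x y) \<in> Vs ! i"
    and "\<And>xs. length xs \<noteq> length Vs \<Longrightarrow> F xs = 0"
    and "\<And>i xs. i < length Vs \<Longrightarrow> length xs = length Vs \<Longrightarrow>
      F xs = (\<Sum>y\<in>X. E i (xs ! i) y * F (xs[i := y]))"
  shows "F \<in> tensor_space Vs"
  using assms(2-)
proof (induction Vs arbitrary: E F)
  case Nil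
  have "pure_tensor [] \<in> tensor_space []"
    unfolding tensor_space_def by (rule cfun.span_base) auto
  then have "cscale (F []) (pure_tensor []) \<in> tensor_space []"
    unfolding tensor_space_def by (rule cfun.span_scale)
  moreover have "cscale (F []) (pure_tensor []) = F"
    using Nil(2) by (auto simp: fun_eq_iff pure_tensor_def)
  ultimately show ?case
    by (rule back_subst[where P = "\<lambda>f. f \<in> tensor_space []"])
next
  case (Cons V Vs)
  have "(\<lambda>xs. F (y # xs)) \<in> tensor_space Vs" for y
  proof (rule Cons.IH[of "\<lambda>i. E (Suc i)"])
    show "(\<lambda>x. E (Suc i) x y) \<in> Vs ! i" if "i < length Vs" "y \<in> X" for i y
      using Cons.prems(1)[of "Suc i" y] that by simp
    show "F (y # xs) = 0" if "length xs \<noteq> length Vs" for xs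
      using Cons.prems(2)[of "y # xs"] that by simp
    show "F (y # xs) = (\<Sum>z\<in>X. E (Suc i) (xs ! i) z * F (y # xs[i := z]))"
      if "i < length Vs" "length xs = length Vs" for i xs
      using Cons.prems(3)[of "Suc i" "y # xs"] that by simp
  qed
  then have "(\<Sum>y\<in>X. tensor_cons (\<lambda>x. E 0 x y) (\<lambda>xs. F (y # xs))) \<in> tensor_space (V # Vs)"
    unfolding tensor_space_def[of "V # Vs"]
    by (intro cfun.span_sum, fold tensor_space_def)
      (intro tensor_cons_in_tensor_space, use Cons.prems(1)[of 0] in simp)
  moreover have "F = (\<Sum>y\<in>X. tensor_cons (\<lambda>x. E 0 x y) (\<lambda>xs. F (y # xs)))"
  proof
    fix xs
    show "F xs = (\<Sum>y\<in>X. tensor_cons (\<lambda>x. E 0 x y) (\<lambda>xs. F (y # xs))) xs"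
    proof (cases "length xs = length (V # Vs)")
      case True
      then obtain x ys where "xs = x # ys"
        by (cases xs) auto
      then show ?thesis
        using Cons.prems(3)[of 0 xs] True by (simp add: tensor_cons_def)
    next
      case False
      then have "tensor_cons (\<lambda>x. E 0 x y) (\<lambda>xs. F (y # xs)) xs = 0" for y
        using Cons.prems(2) by (cases xs) (auto simp: tensor_cons_def)
      then show ?thesis
        using Cons.prems(2)[OF False] by simp
    qed
  qed
  ultimately show ?case
    by simp
qed

text \<open>Fixing all arguments but one in a pure tensor leaves a multiple of one factor, and both
  properties pass to linear combinations.\<close>

lemma tensor_space_slice:
  fixes F :: "'x list \<Rightarrow> complex"
  assumes "F \<in> tensor_space Vs" "\<And>i. i < length Vs \<Longrightarrow> cfun.subspace (Vs ! i)"
  shows "length xs \<noteq> length Vs \<Longrightarrow> F xs = 0"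
    and "length xs = length Vs \<Longrightarrow> i < length Vs \<Longrightarrow> (\<lambda>y. F (xs[i := y])) \<in> Vs ! i"
proof -
  let ?P = "\<lambda>F. (\<forall>xs. length xs \<noteq> length Vs \<longrightarrow> F xs = 0) \<and>
    (\<forall>xs i. length xs = length Vs \<longrightarrow> i < length Vs \<longrightarrow> (\<lambda>y. F (xs[i := y])) \<in> Vs ! i)"
  have "?P F"
    using assms(1) unfolding tensor_space_def
  proof (induction rule: cfun.span_induct)
    case base
    have "cfun.subspace (Collect ?P)"
      unfolding cfun.subspace_def
    proof (intro conjI ballI allI CollectI impI)
      fix xs :: "'x list" and i
      assume "length xs = length Vs" "i < length Vs"
      then show "(\<lambda>y. (0 :: 'x list \<Rightarrow> complex) (xs[i := y])) \<in> Vs ! i"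
        using cfun.subspace_0[OF assms(2)[of i]] by (simp add: zero_fun_def)
    next
      fix F G :: "'x list \<Rightarrow> complex" and xs :: "'x list" and i
      assume "F \<in> Collect ?P" "G \<in> Collect ?P" and len: "length xs = length Vs" "i < length Vs"
      then have "(\<lambda>y. F (xs[i := y])) \<in> Vs ! i" "(\<lambda>y. G (xs[i := y])) \<in> Vs ! i"
        by auto
      from cfun.subspace_add[OF assms(2)[OF len(2)] this]
      show "(\<lambda>y. (F + G) (xs[i := y])) \<in> Vs ! i"
        by (simp add: plus_fun_def)
    next
      fix F :: "'x list \<Rightarrow> complex" and c and xs :: "'x list" and i
      assume "F \<in> Collect ?P" and len: "length xs = length Vs" "i < length Vs"
      then have "(\<lambda>y. F (xs[i := y])) \<in> Vs ! i"
        by auto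
      from cfun.subspace_scale[OF assms(2)[OF len(2)] this]
      show "(\<lambda>y. cscale c F (xs[i := y])) \<in> Vs ! i"
        by (simp add: cscale_def)
    qed auto
    then show ?case
      .
  next
    case (step F)
    then obtain fs where fs: "F = pure_tensor fs" "length fs = length Vs"
      "\<And>i. i < length Vs \<Longrightarrow> fs ! i \<in> Vs ! i"
      by blast
    have "(\<lambda>y. F (xs[i := y])) \<in> Vs ! i" if "length xs = length Vs" "i < length Vs" for xs i
    proof -
      have "F (xs[i := y]) = (\<Prod>j\<in>{..<length Vs} - {i}. (fs ! j) (xs ! j)) * (fs ! i) y" for y
      proof -
        have "F (xs[i := y]) = (\<Prod>j<length Vs. (fs ! j) (xs[i := y] ! j))"
          using fs that by (simp add: pure_tensor_def)
        also have "\<dots> = (fs ! i) y * (\<Prod>j\<in>{..<length Vs} - {i}. (fs ! j) (xs[i := y] ! j))"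
          using that by (subst prod.remove[of _ i]) auto
        also have "(\<Prod>j\<in>{..<length Vs} - {i}. (fs ! j) (xs[i := y] ! j)) =
            (\<Prod>j\<in>{..<length Vs} - {i}. (fs ! j) (xs ! j))"
          by (intro prod.cong) auto
        finally show ?thesis
          by (simp add: mult.commute)
      qed
      then have "(\<lambda>y. F (xs[i := y])) = cscale (\<Prod>j\<in>{..<length Vs} - {i}. (fs ! j) (xs ! j)) (fs ! i)"
        by (simp add: fun_eq_iff)
      then show ?thesis
        using cfun.subspace_scale[OF assms(2)[OF that(2)] fs(3)[OF that(2)]] by simp
    qed
    moreover have "F xs = 0" if "length xs \<noteq> length Vs" for xs
      using that fs by (simp add: pure_tensor_def)
    ultimately show ?case
      by blast
  qed
  then show "length xs \<noteq> length Vs \<Longrightarrow> F xs = 0"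
    and "length xs = length Vs \<Longrightarrow> i < length Vs \<Longrightarrow> (\<lambda>y. F (xs[i := y])) \<in> Vs ! i"
    by blast+
qed

section \<open>Permuting the letters of a word\<close>

text \<open>Induction on the gap: each letter in between costs two more adjacent swaps, so the sign
  stays -1.\<close>

lemma alternating_swap:
  assumes "alternating G"
  shows "G (u @ x # v @ y # z) = - G (u @ y # v @ x # z)"
proof (induction v arbitrary: u)
  case Nil
  then show ?case
    using alternatingD[OF assms, of u x y z] by simp
next
  case (Cons e v)
  have "G (u @ x # (e # v) @ y # z) = - G (u @ e # x # v @ y # z)"
    using alternatingD[OF assms, of u x e "v @ y # z"] by simp
  also have "G (u @ e # x # v @ y # z) = - G (u @ e # y # v @ x # z)"
    using Cons.IH[of "u @ [e]"] by simp
  also have "G (u @ e # y # v @ x # z) = - G (u @ y # (e # v) @ x # z)"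
    using alternatingD[OF assms, of u e y "v @ x # z"] by simp
  finally show ?case
    by simp
qed

lemma permute_list_transpose:
  assumes "length u = a" "length u + Suc (length v) = b"
  shows "permute_list (transpose a b) (u @ x # v @ y # z) = u @ y # v @ x # z"
proof (rule nth_equalityI)
  fix j assume "j < length (permute_list (transpose a b) (u @ x # v @ y # z))"
  then have j: "j < length (u @ x # v @ y # z)"
    by simp
  then have "permute_list (transpose a b) (u @ x # v @ y # z) ! j =
      (u @ x # v @ y # z) ! transpose a b j"
    by (simp add: permute_list_def del: upt_Suc)
  also have "\<dots> = (u @ y # v @ x # z) ! j"
  proof -
    consider "j < a" | "j = a" | "a < j" "j < b" | "j = b" | "j > b"
      by linarith
    then show ?thesis
    proof cases
      case 3
      then obtain k where "j = Suc (a + k)" "k < length v"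
        using assms less_imp_Suc_add by fastforce
      then show ?thesis
        using 3 assms by (simp add: nth_append transpose_def)
    next
      case 5
      then obtain k where "j = Suc (b + k)"
        using less_imp_Suc_add by fastforce
      then show ?thesis
        using 5 assms by (auto simp: nth_append transpose_def)
    qed (use assms in \<open>auto simp: nth_append transpose_def\<close>)
  qed
  finally show "permute_list (transpose a b) (u @ x # v @ y # z) ! j = (u @ y # v @ x # z) ! j" .
qed simp

lemma alternating_permute_list:
  assumes "alternating G" "\<sigma> \<in> sym (length w)"
  shows "G (permute_list \<sigma> w) = csign \<sigma> * G w"
proof -
  have tr: "G (permute_list (transpose a b) w) = - G w" if "a < b" "b < length w" for a b and w :: "'a list"
  proof -
    have w: "w = take a w @ w ! a # drop (Suc a) w"
      using that by (simp add: id_take_nth_drop)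
    have "drop (Suc a) w = take (b - Suc a) (drop (Suc a) w) @ drop (Suc a) w ! (b - Suc a) # drop (Suc (b - Suc a)) (drop (Suc a) w)"
      using that by (intro id_take_nth_drop) simp
    then have *: "w = take a w @ w ! a # take (b - Suc a) (drop (Suc a) w) @ w ! b # drop (Suc b) w"
      using that w by (simp add: add.commute)
    show ?thesis
      using permute_list_transpose[of "take a w" a "take (b - Suc a) (drop (Suc a) w)" b
          "w ! a" "w ! b" "drop (Suc b) w"] that *[symmetric]
        alternating_swap[OF assms(1), of "take a w" "w ! a" "take (b - Suc a) (drop (Suc a) w)" "w ! b" "drop (Suc b) w"]
      by simp
  qed
  have "\<sigma> permutes {..<length w}"
    using assms(2) by (simp add: sym_def)
  from finite_lessThan this show ?thesis
  proof (induction rule: permutes_rev_induct)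
    case id
    then show ?case
      by simp
  next
    case (swap a b \<sigma>)
    have "G (permute_list (\<sigma> \<circ> transpose a b) w) = G (permute_list (transpose a b) (permute_list \<sigma> w))"
      using swap by (subst permute_list_compose) (auto intro: permutes_swap_id)
    also have "\<dots> = - G (permute_list \<sigma> w)"
      using tr[of a b "permute_list \<sigma> w"] tr[of b a "permute_list \<sigma> w"] swap
      by (cases "a < b") (auto simp: transpose_commute)
    also have "- G (permute_list \<sigma> w) = csign (\<sigma> \<circ> transpose a b) * G w"
      using swap csign_comp[of \<sigma> "length w" "transpose a b"] transpose_in_sym[of a "length w" b]
      by (simp add: sym_def sign_swap_id)
    finally show ?case .
  qed
qed

lemma raise_eq_sum:
  "raise i G w = (\<Sum>j<length w. if i \<in> w ! j then G (w[j := w ! j - {i}]) else 0)"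
  by (induction w arbitrary: G) (auto simp: sum.lessThan_Suc_shift simp del: sum.lessThan_Suc intro!: sum.cong)

lemma sum_letter_weight:
  "sum_list (map (letter_weight i) w) = 2 * int (card {j. j < length w \<and> i \<in> w ! j}) - int (length w)"
proof (induction w rule: rev_induct)
  case (snoc x w)
  have "{j. j < length (w @ [x]) \<and> i \<in> (w @ [x]) ! j} =
      {j. j < length w \<and> i \<in> w ! j} \<union> (if i \<in> x then {length w} else {})"
    by (auto simp: nth_append less_Suc_eq split: if_splits)
  then have "card {j. j < length (w @ [x]) \<and> i \<in> (w @ [x]) ! j} =
      card {j. j < length w \<and> i \<in> w ! j} + (if i \<in> x then 1 else 0)"
    by (auto simp: card_insert_if)
  then show ?case
    using snoc by (auto simp: letter_weight_def)
qed simp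

lemma sym_transitive_on_subsets:
  assumes "A \<subseteq> {..<N}" "B \<subseteq> {..<N}" "card A = card B"
  obtains \<sigma> where "\<sigma> \<in> sym N" "\<sigma> ` A = B"
proof -
  have fin: "finite A" "finite B"
    using assms finite_subset by blast+
  obtain f where f: "bij_betw f A B"
    using finite_same_card_bij[OF fin assms(3)] by blast
  have "card ({..<N} - A) = card ({..<N} - B)"
    using assms fin by (simp add: card_Diff_subset)
  then obtain g where g: "bij_betw g ({..<N} - A) ({..<N} - B)"
    using finite_same_card_bij[of "{..<N} - A" "{..<N} - B"] by auto
  define \<sigma> where "\<sigma> x = (if x \<in> A then f x else if x < N then g x else x)" for x
  have \<sigma>A: "bij_betw \<sigma> A B"
    using f by (rule bij_betw_cong[THEN iffD1, rotated]) (simp add: \<sigma>_def)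
  have "bij_betw \<sigma> ({..<N} - A) ({..<N} - B)"
    using g by (rule bij_betw_cong[THEN iffD1, rotated]) (simp add: \<sigma>_def)
  with \<sigma>A have "bij_betw \<sigma> (A \<union> ({..<N} - A)) (B \<union> ({..<N} - B))"
    by (intro bij_betw_combine) auto
  then have "bij_betw \<sigma> {..<N} {..<N}"
    using assms by (simp add: Un_absorb1)
  then have "\<sigma> permutes {..<N}"
    using assms(1) by (intro bij_imp_permutes) (auto simp: \<sigma>_def)
  moreover have "\<sigma> ` A = B"
    using \<sigma>A by (simp add: bij_betw_def)
  ultimately show ?thesis
    using that by (simp add: sym_def)
qed

section \<open>Kronecker coefficients of two-column partitions\<close>

lemma sym_action_diag_act: "sym_action N diag_act"
proof
  fix g h :: perm and F :: "perm list \<Rightarrow> complex"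
  show "diag_act id F = F"
    by (simp add: diag_act_def)
  assume "g \<in> sym N" "h \<in> sym N"
  then have "inv (g \<circ> h) = inv h \<circ> inv g"
    by (simp add: o_inv_distrib sym_bij)
  then show "diag_act (g \<circ> h) F = diag_act g (diag_act h F)"
    by (simp add: diag_act_def fun_eq_iff comp_def)
qed (auto intro!: clinearI simp: diag_act_def fun_eq_iff)

lemma alternating_if_permute_list:
  fixes G :: "'a list \<Rightarrow> complex"
  assumes "\<And>\<sigma> w. \<sigma> \<in> sym (length w) \<Longrightarrow> G (permute_list \<sigma> w) = csign \<sigma> * G w"
  shows "alternating G"
  unfolding alternating_def
proof (intro allI)
  fix u v :: "'a list" and x y
  let ?t = "transpose (length u) (Suc (length u))"
  have "permute_list ?t (u @ y # [] @ x # v) = u @ x # [] @ y # v"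
    by (rule permute_list_transpose) auto
  then show "G (u @ x # y # v) = - G (u @ y # x # v)"
    using assms[of ?t "u @ y # x # v"] transpose_in_sym[of "length u" "length (u @ y # x # v)" "Suc (length u)"]
    by (simp add: sign_swap_id)
qed

definition columns :: "nat set list \<Rightarrow> nat \<Rightarrow> nat set" where
  "columns w i = {j. j < length w \<and> i \<in> w ! j}"

locale two_column_tuple =
  fixes d N :: nat and p c :: "nat \<Rightarrow> nat"
  assumes odd_tuple: "odd d"
    and size: "i < d \<Longrightarrow> 2 * p i + c i = N"
begin

abbreviation Qs :: "nat \<Rightarrow> nat set" where "Qs i \<equiv> first_col (p i) (c i)"
abbreviation shapes :: "nat list list" where "shapes \<equiv> map (\<lambda>i. two_col_shape (p i) (c i)) [0..<d]"
abbreviation weights :: "nat \<Rightarrow> int" where "weights \<equiv> \<lambda>i. int (c i)"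

text \<open>
  A \<open>d\<close>-tuple \<open>B\<close> of subsets of \<open>{..<N}\<close>, the first columns of \<open>d\<close> tableaux, is the same as the
  word \<open>rows B\<close> of \<open>N\<close> subsets of \<open>{..<d}\<close>, of which \<open>B\<close> is the tuple of \<open>columns\<close>.
\<close>

definition rows :: "(nat \<Rightarrow> nat set) \<Rightarrow> nat set list" where
  "rows B = map (\<lambda>j. {i. i < d \<and> j \<in> B i}) [0..<N]"

definition tuple :: "(nat \<Rightarrow> perm) \<Rightarrow> perm list" where
  "tuple t = map t [0..<d]"

definition tsign :: "(nat \<Rightarrow> perm) \<Rightarrow> complex" where
  "tsign t = (\<Prod>i<d. csign (t i))"

definition valid_word :: "nat set list \<Rightarrow> bool" where
  "valid_word w \<longleftrightarrow> w \<in> words (Pow {..<d}) N \<and> (\<forall>i<d. card (columns w i) = p i + c i)"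

abbreviation sym_tuple :: "(nat \<Rightarrow> perm) \<Rightarrow> bool" where
  "sym_tuple t \<equiv> \<forall>i<d. t i \<in> sym N"

lemma d_pos: "0 < d"
  using odd_tuple by (rule odd_pos)

lemma card_Qs: "i < d \<Longrightarrow> card (Qs i) = p i + c i"
  by (rule two_columns.card_Q)

lemma Qs_subset: "i < d \<Longrightarrow> Qs i \<subseteq> {..<N}"
  using two_columns.Q_subset[of "p i" "c i"] size by simp

lemma specht_iff:
  "i < d \<Longrightarrow> F \<in> specht (two_col_shape (p i) (c i)) \<longleftrightarrow>
    (\<exists>h. (\<forall>\<tau>. F \<tau> = (if \<tau> \<in> sym N then csign \<tau> * h (\<tau> ` Qs i) else 0)) \<and> garnir N (p i + c i) h)"
  using two_columns.specht_iff[of F "p i" "c i"] size by simp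

lemma subspace_specht:
  assumes "i < d"
  shows "cfun.subspace (specht (two_col_shape (p i) (c i)))"
  unfolding cfun.subspace_def
proof (intro conjI ballI allI)
  show "0 \<in> specht (two_col_shape (p i) (c i))"
    unfolding specht_iff[OF assms] by (rule exI[of _ "\<lambda>_. 0"]) (simp add: garnir_def)
next
  fix F G assume "F \<in> specht (two_col_shape (p i) (c i))" "G \<in> specht (two_col_shape (p i) (c i))"
  then obtain h k where "\<forall>\<tau>. F \<tau> = (if \<tau> \<in> sym N then csign \<tau> * h (\<tau> ` Qs i) else 0)" "garnir N (p i + c i) h"
    "\<forall>\<tau>. G \<tau> = (if \<tau> \<in> sym N then csign \<tau> * k (\<tau> ` Qs i) else 0)" "garnir N (p i + c i) k"
    unfolding specht_iff[OF assms] by blast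
  then show "F + G \<in> specht (two_col_shape (p i) (c i))"
    unfolding specht_iff[OF assms]
    by (intro exI[of _ "\<lambda>B. h B + k B"]) (auto simp: garnir_def sum.distrib algebra_simps)
next
  fix a F assume "F \<in> specht (two_col_shape (p i) (c i))"
  then obtain h where "\<forall>\<tau>. F \<tau> = (if \<tau> \<in> sym N then csign \<tau> * h (\<tau> ` Qs i) else 0)" "garnir N (p i + c i) h"
    unfolding specht_iff[OF assms] by blast
  then show "cscale a F \<in> specht (two_col_shape (p i) (c i))"
    unfolding specht_iff[OF assms]
    by (intro exI[of _ "\<lambda>B. a * h B"]) (auto simp: garnir_def sum_distrib_left[symmetric])
qed

lemma specht_translate:
  assumes "i < d" "F \<in> specht (two_col_shape (p i) (c i))" "g \<in> sym N"
  shows "(\<lambda>\<tau>. F (g \<circ> \<tau>)) \<in> specht (two_col_shape (p i) (c i))"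
proof -
  obtain h where h: "\<forall>\<tau>. F \<tau> = (if \<tau> \<in> sym N then csign \<tau> * h (\<tau> ` Qs i) else 0)" "garnir N (p i + c i) h"
    using assms unfolding specht_iff[OF assms(1)] by blast
  have "garnir N (p i + c i) (\<lambda>B. csign g * h (g ` B))"
    unfolding garnir_def
  proof (intro allI impI)
    fix S assume S: "S \<subseteq> {..<N} \<and> card S = Suc (p i + c i)"
    have "(\<Sum>s\<in>S. h (g ` (S - {s}))) = (\<Sum>s\<in>S. h (g ` S - {g s}))"
      by (intro sum.cong refl arg_cong[of _ _ h])
        (simp only: image_set_diff[OF bij_is_inj[OF sym_bij[OF assms(3)]]] image_insert image_empty)
    also have "\<dots> = (\<Sum>s\<in>g ` S. h (g ` S - {s}))"
      by (subst sum.reindex[OF sym_inj_on[OF assms(3)]]) simp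
    also have "\<dots> = 0"
    proof -
      have "g ` S \<subseteq> {..<N}"
        using S sym_lt_iff[OF assms(3)] by auto
      moreover have "card (g ` S) = Suc (p i + c i)"
        using S card_image[OF sym_inj_on[OF assms(3)]] by simp
      ultimately show ?thesis
        using h(2) unfolding garnir_def by blast
    qed
    finally show "(\<Sum>s\<in>S. csign g * h (g ` (S - {s}))) = 0"
      by (simp add: sum_distrib_left[symmetric])
  qed
  moreover have "g \<circ> \<tau> \<in> sym N \<longleftrightarrow> \<tau> \<in> sym N" for \<tau>
  proof
    assume "g \<circ> \<tau> \<in> sym N"
    then have "inv g \<circ> (g \<circ> \<tau>) \<in> sym N"
      using sym_comp sym_inv assms(3) by blast
    then show "\<tau> \<in> sym N"
      using assms(3) by (simp add: o_assoc sym_inv_comp)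
  qed (use sym_comp assms(3) in blast)
  moreover have "csign (g \<circ> \<tau>) * h ((g \<circ> \<tau>) ` A) = csign \<tau> * (csign g * h (g ` \<tau> ` A))"
    if "\<tau> \<in> sym N" for \<tau> A
    using csign_comp[OF assms(3) that] by (simp add: image_comp)
  ultimately show ?thesis
    unfolding specht_iff[OF assms(1)] using h(1)
    by (intro exI[of _ "\<lambda>B. csign g * h (g ` B)"]) simp
qed

section \<open>Slices of the tensor product of Specht modules\<close>

lemma tuple_nth [simp]: "i < d \<Longrightarrow> tuple t ! i = t i"
  and length_tuple [simp]: "length (tuple t) = d"
  by (simp_all add: tuple_def)

lemma tuple_update: "i < d \<Longrightarrow> (tuple t)[i := \<sigma>] = tuple (t(i := \<sigma>))"
  by (rule nth_equalityI) (auto simp: nth_list_update)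

lemma tuple_of_list: "length ts = d \<Longrightarrow> tuple (\<lambda>i. ts ! i) = ts"
  by (rule nth_equalityI) auto

lemma tuple_cong: "(\<And>i. i < d \<Longrightarrow> t i = t' i) \<Longrightarrow> tuple t = tuple t'"
  by (simp add: tuple_def)

text \<open>The kernels for \<open>tensor_spaceI\<close> come from
  \<open>specht_reproducing_kernel\<close>. In this form each factor is governed by its own Garnir
  relations while the other arguments stay fixed.\<close>

lemma tensor_space_iff:
  "F \<in> tensor_space (map specht shapes) \<longleftrightarrow> (\<forall>xs. length xs \<noteq> d \<longrightarrow> F xs = 0) \<and>
    (\<forall>t. \<forall>i<d. (\<lambda>\<sigma>. F (tuple (t(i := \<sigma>)))) \<in> specht (two_col_shape (p i) (c i)))"
proof
  assume F: "F \<in> tensor_space (map specht shapes)"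
  note slice = tensor_space_slice[OF F]
  show "(\<forall>xs. length xs \<noteq> d \<longrightarrow> F xs = 0) \<and>
    (\<forall>t. \<forall>i<d. (\<lambda>\<sigma>. F (tuple (t(i := \<sigma>)))) \<in> specht (two_col_shape (p i) (c i)))"
  proof (intro conjI allI impI)
    show "F xs = 0" if "length xs \<noteq> d" for xs
      using slice(1)[of xs] that subspace_specht by simp
    show "(\<lambda>\<sigma>. F (tuple (t(i := \<sigma>)))) \<in> specht (two_col_shape (p i) (c i))" if "i < d" for t i
      using slice(2)[of "tuple t" i] that subspace_specht by (simp add: tuple_update)
  qed
next
  assume F: "(\<forall>xs. length xs \<noteq> d \<longrightarrow> F xs = 0) \<and>
    (\<forall>t. \<forall>i<d. (\<lambda>\<sigma>. F (tuple (t(i := \<sigma>)))) \<in> specht (two_col_shape (p i) (c i)))"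
  have "\<exists>E. (\<forall>\<sigma>\<in>sym N. (\<lambda>\<tau>. E \<tau> \<sigma>) \<in> specht (two_col_shape (p i) (c i))) \<and>
    (\<forall>F \<tau>. F \<in> specht (two_col_shape (p i) (c i)) \<longrightarrow> F \<tau> = (\<Sum>\<sigma>\<in>sym N. E \<tau> \<sigma> * F \<sigma>))"
    if "i < d" for i
    using two_columns.specht_reproducing_kernel[of "p i" "c i"] size[OF that] by metis
  then obtain E where E: "\<And>i \<sigma>. i < d \<Longrightarrow> \<sigma> \<in> sym N \<Longrightarrow> (\<lambda>\<tau>. E i \<tau> \<sigma>) \<in> specht (two_col_shape (p i) (c i))"
    "\<And>i F \<tau>. i < d \<Longrightarrow> F \<in> specht (two_col_shape (p i) (c i)) \<Longrightarrow> F \<tau> = (\<Sum>\<sigma>\<in>sym N. E i \<tau> \<sigma> * F \<sigma>)"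
    by metis
  show "F \<in> tensor_space (map specht shapes)"
  proof (rule tensor_spaceI[of "sym N" _ E])
    show "F xs = (\<Sum>y\<in>sym N. E i (xs ! i) y * F (xs[i := y]))"
      if "i < length (map specht shapes)" "length xs = length (map specht shapes)" for i xs
    proof -
      have i: "i < d" and xs: "tuple (\<lambda>i. xs ! i) = xs"
        using that tuple_of_list by simp_all
      have "(\<lambda>\<sigma>. F (xs[i := \<sigma>])) \<in> specht (two_col_shape (p i) (c i))"
        using F i tuple_update[OF i, of "\<lambda>i. xs ! i"] xs by simp
      from E(2)[OF i this, of "xs ! i"] show ?thesis
        by simp
    qed
  qed (use E(1) F in auto)
qed

lemma tensor_support:
  assumes "F \<in> tensor_space (map specht shapes)" "F ts \<noteq> 0"
  shows "length ts = d" "i < d \<Longrightarrow> ts ! i \<in> sym N"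
proof -
  show len: "length ts = d"
    using assms unfolding tensor_space_iff by blast
  assume i: "i < d"
  have "(\<lambda>\<sigma>. F (tuple ((\<lambda>j. ts ! j)(i := \<sigma>)))) \<in> specht (two_col_shape (p i) (c i))"
    using assms(1) i unfolding tensor_space_iff by blast
  then obtain h where "\<And>\<tau>. F (tuple ((\<lambda>j. ts ! j)(i := \<tau>))) = (if \<tau> \<in> sym N then csign \<tau> * h (\<tau> ` Qs i) else 0)"
    unfolding specht_iff[OF i] by blast
  from this[of "ts ! i"] show "ts ! i \<in> sym N"
    using assms(2) tuple_of_list[OF len] by (auto split: if_splits)
qed

lemma finite_dim_tensor: "finite_dim (tensor_space (map specht shapes))"
proof (rule finite_dim_supported)
  show "finite {xs. set xs \<subseteq> sym N \<and> length xs = d}"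
    by (rule finite_lists_length_eq) simp
  show "ts \<in> {xs. set xs \<subseteq> sym N \<and> length xs = d}"
    if "F \<in> tensor_space (map specht shapes)" "F ts \<noteq> 0" for F ts
    using tensor_support[OF that] by (auto simp: in_set_conv_nth)
qed

lemma diag_act_tuple:
  "diag_act g F (tuple t) = F (tuple (\<lambda>i. inv g \<circ> t i))"
  by (simp add: diag_act_def tuple_def comp_def)

lemma invariant_tensor: "sym_action.invariant N diag_act (tensor_space (map specht shapes))"
  unfolding sym_action.invariant_def[OF sym_action_diag_act]
proof (intro conjI ballI)
  show "cfun.subspace (tensor_space (map specht shapes))"
    by (simp add: tensor_space_def)
  fix g F assume g: "g \<in> sym N" and F: "F \<in> tensor_space (map specht shapes)"
  show "diag_act g F \<in> tensor_space (map specht shapes)"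
    unfolding tensor_space_iff
  proof (intro conjI allI impI)
    show "diag_act g F xs = 0" if "length xs \<noteq> d" for xs
      using F that unfolding tensor_space_iff by (simp add: diag_act_def)
    fix t :: "nat \<Rightarrow> perm" and i assume i: "i < d"
    let ?t = "\<lambda>j. inv g \<circ> t j"
    have "(\<lambda>\<sigma>. F (tuple (?t(i := \<sigma>)))) \<in> specht (two_col_shape (p i) (c i))"
      using F i unfolding tensor_space_iff by blast
    from specht_translate[OF i this sym_inv[OF g]]
    have "(\<lambda>\<sigma>. F (tuple (?t(i := inv g \<circ> \<sigma>)))) \<in> specht (two_col_shape (p i) (c i))" .
    moreover have "tuple (?t(i := inv g \<circ> \<sigma>)) = tuple (\<lambda>j. inv g \<circ> (t(i := \<sigma>)) j)" for \<sigma>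
      by (rule tuple_cong) simp
    ultimately show "(\<lambda>\<sigma>. diag_act g F (tuple (t(i := \<sigma>)))) \<in> specht (two_col_shape (p i) (c i))"
      by (simp add: diag_act_tuple)
  qed
qed

abbreviation invariants :: "(perm list \<Rightarrow> complex) set" where
  "invariants \<equiv> fixed_space (sym N) diag_act (tensor_space (map specht shapes))"

lemma kronecker_eq_dim: "kronecker shapes = cfun.dim invariants"
proof -
  have "sum_list (hd shapes) = N"
    using d_pos size by (simp add: hd_map)
  then show ?thesis
    unfolding kronecker_def
    using sym_action.multiplicity_trivial[OF sym_action_diag_act finite_dim_tensor invariant_tensor] by simp
qed

section \<open>Words and tuples of column sets\<close>

lemma rows_props:
  shows "length (rows B) = N" "j < N \<Longrightarrow> rows B ! j = {i. i < d \<and> j \<in> B i}"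
    "rows B \<in> words (Pow {..<d}) N"
    "i < d \<Longrightarrow> B i \<subseteq> {..<N} \<Longrightarrow> columns (rows B) i = B i"
  by (auto simp: rows_def words_def columns_def)

lemma rows_columns: "w \<in> words (Pow {..<d}) N \<Longrightarrow> rows (columns w) = w"
  by (rule nth_equalityI) (auto simp: rows_props columns_def words_def dest!: nth_mem)

lemma rows_cong: "(\<And>i. i < d \<Longrightarrow> B i = B' i) \<Longrightarrow> rows B = rows B'"
  unfolding rows_def by (intro map_cong) auto

lemma columns_subset: "length w = N \<Longrightarrow> columns w i \<subseteq> {..<N}"
  by (auto simp: columns_def)

lemma sym_image_subset: "t \<in> sym N \<Longrightarrow> i < d \<Longrightarrow> t ` Qs i \<subseteq> {..<N}"
  using Qs_subset sym_lt_iff by fastforce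

lemma card_sym_image: "t \<in> sym N \<Longrightarrow> i < d \<Longrightarrow> card (t ` Qs i) = p i + c i"
  using card_Qs card_image[OF sym_inj_on] by metis

lemma valid_rows: "sym_tuple t \<Longrightarrow> valid_word (rows (\<lambda>i. t i ` Qs i))"
  unfolding valid_word_def using rows_props(3,4) sym_image_subset card_sym_image by simp

text \<open>The index set \<open>I\<close> makes room for a column of the wrong size: all indices
  serve for valid words, the complement of \<open>{i}\<close> for words whose \<open>i\<close>-th
  column has one element too many.\<close>

lemma valid_word_obtain_tuple:
  assumes "w \<in> words (Pow {..<d}) N" "\<And>i. i < d \<Longrightarrow> i \<in> I \<Longrightarrow> card (columns w i) = p i + c i"
  obtains t where "sym_tuple t" "\<And>i. i < d \<Longrightarrow> i \<in> I \<Longrightarrow> t i ` Qs i = columns w i"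
proof -
  have "\<exists>g. g \<in> sym N \<and> (i \<in> I \<longrightarrow> g ` Qs i = columns w i)" if i: "i < d" for i
  proof (cases "i \<in> I")
    case True
    then show ?thesis
      using sym_transitive_on_subsets[OF Qs_subset[OF i] columns_subset[of w i]] assms i card_Qs[OF i]
      by (metis (mono_tags, lifting) mem_Collect_eq words_def)
  qed (use sym_id in blast)
  then obtain t where "\<And>i. i < d \<Longrightarrow> t i \<in> sym N \<and> (i \<in> I \<longrightarrow> t i ` Qs i = columns w i)"
    by metis
  then show ?thesis
    using that by blast
qed

text \<open>A column of length \<open>p i + c i\<close> among \<open>2 * p i + c i\<close> positions
  means \<open>p i + c i\<close> letters of weight 1 and \<open>p i\<close> of weight -1, a total of
  \<open>c i\<close>.\<close>

lemma valid_word_iff_weights: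
  assumes "w \<in> words (Pow {..<d}) N"
  shows "valid_word w \<longleftrightarrow> (\<forall>i<d. sum_list (map (letter_weight i) w) = weights i)"
proof -
  have len: "length w = N"
    using assms by (simp add: words_def)
  have "card (columns w i) = p i + c i \<longleftrightarrow> sum_list (map (letter_weight i) w) = weights i"
    if "i < d" for i
    unfolding sum_letter_weight len columns_def[symmetric, of w i, unfolded len]
    using size[OF that] len by (auto simp: columns_def)
  then show ?thesis
    using assms by (simp add: valid_word_def)
qed

lemma hw_space_iff:
  "G \<in> hw_space d N weights \<longleftrightarrow> alternating G \<and> (\<forall>w. G w \<noteq> 0 \<longrightarrow> valid_word w) \<and>
    (\<forall>i<d. \<forall>w. raise i G w = 0)"
  unfolding hw_space_def word_support_def
  using valid_word_iff_weights by (auto simp: valid_word_def[of "_ :: nat set list"])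

lemma columns_permute_list:
  assumes "\<sigma> \<in> sym (length w)"
  shows "columns (permute_list \<sigma> w) i = inv \<sigma> ` columns w i"
proof -
  have \<sigma>: "\<sigma> (inv \<sigma> x) = x" "inv \<sigma> (\<sigma> x) = x" for x
    using sym_bij[OF assms] by (simp_all add: bij_is_surj surj_f_inv_f bij_is_inj)
  have lt: "\<sigma> x < length w \<longleftrightarrow> x < length w" "inv \<sigma> x < length w \<longleftrightarrow> x < length w" for x
    by (rule sym_lt_iff[OF assms], rule sym_lt_iff[OF sym_inv[OF assms]])
  have perm: "permute_list \<sigma> w ! j = w ! \<sigma> j" if "j < length w" for j
    using that by (simp add: permute_list_def del: upt_Suc)
  show ?thesis
  proof (rule set_eqI, rule iffI)
    fix j assume "j \<in> columns (permute_list \<sigma> w) i"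
    then have "\<sigma> j \<in> columns w i"
      using lt(1)[of j] by (auto simp: columns_def perm)
    then show "j \<in> inv \<sigma> ` columns w i"
      by (metis \<sigma>(2) imageI)
  next
    fix j assume "j \<in> inv \<sigma> ` columns w i"
    then obtain k where "j = inv \<sigma> k" "k \<in> columns w i"
      by blast
    then show "j \<in> columns (permute_list \<sigma> w) i"
      using lt(2)[of k] by (auto simp: columns_def perm \<sigma>(1))
  qed
qed

lemma valid_word_permute:
  assumes "\<sigma> \<in> sym (length w)"
  shows "valid_word (permute_list \<sigma> w) \<longleftrightarrow> valid_word w"
proof -
  have "set (permute_list \<sigma> w) = set w"
    using assms by (simp add: sym_def)
  moreover have "card (columns (permute_list \<sigma> w) i) = card (columns w i)" for i
    unfolding columns_permute_list[OF assms] by (rule card_image[OF sym_inj_on[OF sym_inv[OF assms]]])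
  ultimately show ?thesis
    by (simp add: valid_word_def words_def)
qed

lemma tsign_square: "tsign t * tsign t = 1"
  unfolding tsign_def prod.distrib[symmetric] by simp

text \<open>Oddness of \<open>d\<close> collapses \<open>csign g ^ d\<close> to
  \<open>csign g\<close>; for even \<open>d\<close> the invariants would give symmetric functions of
  words instead of alternating ones.\<close>

lemma tsign_translate:
  assumes "g \<in> sym N" "sym_tuple t"
  shows "tsign (\<lambda>i. g \<circ> t i) = csign g * tsign t"
proof -
  have "tsign (\<lambda>i. g \<circ> t i) = (\<Prod>i<d. csign g * csign (t i))"
    unfolding tsign_def using assms csign_comp by (intro prod.cong) auto
  also have "\<dots> = csign g ^ d * tsign t"
    by (simp add: prod.distrib tsign_def)
  also have "csign g ^ d = csign g"
    using odd_tuple by (elim oddE) (simp add: power_mult power2_eq_square)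
  finally show ?thesis .
qed

lemma rows_translate:
  assumes "g \<in> sym N"
  shows "rows (\<lambda>i. inv g ` B i) = permute_list g (rows B)"
proof (rule nth_equalityI)
  fix j assume "j < length (rows (\<lambda>i. inv g ` B i))"
  then have j: "j < N"
    by (simp add: rows_props)
  have "j \<in> inv g ` B i \<longleftrightarrow> g j \<in> B i" for i
  proof -
    have inv: "inv g (g j) = j" "g (inv g x) = x" for x
      using sym_bij[OF assms] by (simp_all add: bij_is_inj bij_is_surj surj_f_inv_f)
    show ?thesis
    proof
      assume "g j \<in> B i"
      then show "j \<in> inv g ` B i"
        by (metis imageI inv(1))
    qed (auto simp: inv)
  qed
  then show "rows (\<lambda>i. inv g ` B i) ! j = permute_list g (rows B) ! j"
    using j sym_lt_iff[OF assms] by (simp add: rows_props permute_list_def)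
qed (simp add: rows_props)

section \<open>Invariants are highest weight vectors\<close>

text \<open>The \<open>d\<close> signs are those that \<open>specht_iff\<close> asks for in each
  argument; the other factor depends only on the images of the first columns, encoded as a
  word.\<close>

definition to_tensor :: "(nat set list \<Rightarrow> complex) \<Rightarrow> perm list \<Rightarrow> complex" where
  "to_tensor G ts = (if length ts = d \<and> (\<forall>i<d. ts ! i \<in> sym N)
     then tsign (\<lambda>i. ts ! i) * G (rows (\<lambda>i. (ts ! i) ` Qs i)) else 0)"

lemma to_tensor_tuple:
  "to_tensor G (tuple t) = (if sym_tuple t then tsign t * G (rows (\<lambda>i. t i ` Qs i)) else 0)"
proof -
  have "rows (\<lambda>i. (tuple t ! i) ` Qs i) = rows (\<lambda>i. t i ` Qs i)"
    by (rule rows_cong) simp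
  then show ?thesis
    by (auto simp: to_tensor_def tsign_def)
qed

lemma clinear_to_tensor: "clinear to_tensor"
  by (rule clinearI) (auto simp: to_tensor_def fun_eq_iff algebra_simps)

text \<open>With all arguments but the \<open>i\<close>-th fixed, the Garnir relation for
  \<open>S\<close> is the equation \<open>raise i G = 0\<close> at the word whose
  \<open>i\<close>-th column is \<open>S\<close>.\<close>

lemma to_tensor_in_tensor_space:
  assumes "G \<in> hw_space d N weights"
  shows "to_tensor G \<in> tensor_space (map specht shapes)"
  unfolding tensor_space_iff
proof (intro conjI allI impI)
  show "to_tensor G xs = 0" if "length xs \<noteq> d" for xs
    using that by (simp add: to_tensor_def)
  fix t i assume i: "i < d"
  show "(\<lambda>\<sigma>. to_tensor G (tuple (t(i := \<sigma>)))) \<in> specht (two_col_shape (p i) (c i))"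
  proof (cases "\<forall>j<d. j \<noteq> i \<longrightarrow> t j \<in> sym N")
    case False
    then have "to_tensor G (tuple (t(i := \<sigma>))) = 0" for \<sigma>
      unfolding to_tensor_tuple by auto
    then show ?thesis
      using cfun.subspace_0[OF subspace_specht[OF i]] by (simp add: zero_fun_def)
  next
    case True
    \<comment> \<open>The tuple of column sets with the \<open>i\<close>-th one replaced by
      \<open>b\<close>; \<open>k\<close> below collects the signs of the other arguments.\<close>
    define B where "B b = (\<lambda>j. t j ` Qs j)(i := b)" for b
    define k where "k = (\<Prod>j\<in>{..<d} - {i}. csign (t j))"
    have "to_tensor G (tuple (t(i := \<sigma>))) = (if \<sigma> \<in> sym N then csign \<sigma> * (k * G (rows (B (\<sigma> ` Qs i)))) else 0)" for \<sigma>
    proof -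
      have "tsign (t(i := \<sigma>)) = csign \<sigma> * k"
        unfolding tsign_def k_def using i by (subst prod.remove[of _ i]) (auto intro!: prod.cong)
      moreover have "(\<lambda>j. (t(i := \<sigma>)) j ` Qs j) = B (\<sigma> ` Qs i)"
        by (auto simp: B_def fun_eq_iff)
      moreover have "sym_tuple (t(i := \<sigma>)) \<longleftrightarrow> \<sigma> \<in> sym N"
        using True i by auto
      ultimately show ?thesis
        unfolding to_tensor_tuple by (simp add: mult.assoc)
    qed
    moreover have "garnir N (p i + c i) (\<lambda>b. k * G (rows (B b)))"
      unfolding garnir_def
    proof (intro allI impI)
      fix S assume S: "S \<subseteq> {..<N} \<and> card S = Suc (p i + c i)"
      \<comment> \<open>Deleting \<open>i\<close> from the letter at position \<open>s\<close>
        removes \<open>s\<close> from the \<open>i\<close>-th column, so the sum in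
        \<open>raise\<close> becomes the Garnir sum.\<close>
      have upd: "(rows (B S))[s := rows (B S) ! s - {i}] = rows (B (S - {s}))" if "s < N" for s
        using i that by (intro nth_equalityI) (auto simp: rows_props nth_list_update B_def split: if_splits)
      have mem: "i \<in> rows (B S) ! s \<longleftrightarrow> s \<in> S" if "s < N" for s
        using i that by (simp add: rows_props B_def)
      have "(\<Sum>s\<in>S. G (rows (B (S - {s})))) = (\<Sum>s<N. if s \<in> S then G (rows (B (S - {s}))) else 0)"
        using S by (simp add: sum.If_cases Int_absorb1)
      also have "\<dots> = raise i G (rows (B S))"
        unfolding raise_eq_sum rows_props(1)
        by (intro sum.cong refl) (simp add: upd mem)
      also have "\<dots> = 0"
        using assms i by (simp add: hw_space_def)
      finally show "(\<Sum>s\<in>S. k * G (rows (B (S - {s})))) = 0"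
        by (simp add: sum_distrib_left[symmetric])
    qed
    ultimately show ?thesis
      unfolding specht_iff[OF i] by (intro exI[of _ "\<lambda>b. k * G (rows (B b))"] conjI allI)
  qed
qed

text \<open>A translation by \<open>g\<close> contributes \<open>csign g\<close> twice, once through
  the \<open>d\<close> signs and once through the alternating \<open>G\<close>.\<close>

lemma to_tensor_invariant:
  assumes "G \<in> hw_space d N weights"
  shows "to_tensor G \<in> invariants"
  unfolding fixed_space_def
proof (intro CollectI conjI ballI to_tensor_in_tensor_space[OF assms] ext)
  fix g ts assume g: "g \<in> sym N"
  show "diag_act g (to_tensor G) ts = to_tensor G ts"
  proof (cases "length ts = d")
    case True
    define t where "t = (\<lambda>i. ts ! i)"
    have ts: "ts = tuple t"
      using tuple_of_list[OF True] by (simp add: t_def)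
    have mem: "inv g \<circ> t i \<in> sym N \<longleftrightarrow> t i \<in> sym N" for i
    proof
      assume "inv g \<circ> t i \<in> sym N"
      then have "g \<circ> (inv g \<circ> t i) \<in> sym N"
        using sym_comp g by blast
      then show "t i \<in> sym N"
        using g by (simp add: o_assoc sym_comp_inv)
    qed (use sym_comp sym_inv g in blast)
    show ?thesis
    proof (cases "sym_tuple t")
      case True
      have "rows (\<lambda>i. (inv g \<circ> t i) ` Qs i) = permute_list g (rows (\<lambda>i. t i ` Qs i))"
        using rows_translate[OF g, of "\<lambda>i. t i ` Qs i"] by (simp only: image_comp)
      moreover have "G (permute_list g (rows (\<lambda>i. t i ` Qs i))) = csign g * G (rows (\<lambda>i. t i ` Qs i))"
        using assms g by (intro alternating_permute_list) (simp_all add: hw_space_def rows_props)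
      moreover have "csign g * tsign t * (csign g * z) = (csign g * csign g) * (tsign t * z)" for z
        by (simp only: ac_simps)
      ultimately show ?thesis
        unfolding ts diag_act_tuple to_tensor_tuple mem using True
        by (simp add: tsign_translate[OF sym_inv[OF g] True] csign_inv[OF g])
    next
      case False
      then show ?thesis
        unfolding ts diag_act_tuple to_tensor_tuple mem by auto
    qed
  qed (simp add: diag_act_def to_tensor_def)
qed

lemma inj_on_to_tensor: "inj_on to_tensor (hw_space d N weights)"
proof (rule inj_onI, rule ext)
  fix G H w
  assume GH: "G \<in> hw_space d N weights" "H \<in> hw_space d N weights" "to_tensor G = to_tensor H"
  show "G w = H w"
  proof (cases "valid_word w")
    case True
    then have w: "w \<in> words (Pow {..<d}) N" "\<And>i. i < d \<Longrightarrow> i \<in> UNIV \<Longrightarrow> card (columns w i) = p i + c i"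
      by (auto simp: valid_word_def)
    obtain t where t: "sym_tuple t" "\<And>i. i < d \<Longrightarrow> i \<in> UNIV \<Longrightarrow> t i ` Qs i = columns w i"
      using valid_word_obtain_tuple[OF w] by blast
    have "rows (\<lambda>i. t i ` Qs i) = w"
      using rows_cong[of "\<lambda>i. t i ` Qs i" "columns w"] t(2) rows_columns[OF w(1)] by simp
    then have "tsign t * G w = tsign t * H w"
      using fun_cong[OF GH(3), of "tuple t"] t(1) by (simp add: to_tensor_tuple)
    moreover have "tsign t \<noteq> 0"
      using tsign_square[of t] by auto
    ultimately show ?thesis
      by simp
  next
    case False
    then show ?thesis
      using GH(1,2) unfolding hw_space_iff by metis
  qed
qed

section \<open>From an invariant tensor back to a highest weight vector\<close>

context
  fixes F assumes F: "F \<in> invariants"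
begin

text \<open>Freed of its signs, the tensor depends only on the images of the first columns, and so
  becomes a function of words.\<close>

definition signed :: "(nat \<Rightarrow> perm) \<Rightarrow> complex" where
  "signed t = tsign t * F (tuple t)"

lemma signed_slice:
  assumes "i < d"
  obtains h where "garnir N (p i + c i) h"
    "\<And>\<sigma>. \<sigma> \<in> sym N \<Longrightarrow> signed (t(i := \<sigma>)) = h (\<sigma> ` Qs i)"
proof -
  have "(\<lambda>\<sigma>. F (tuple (t(i := \<sigma>)))) \<in> specht (two_col_shape (p i) (c i))"
    using F assms unfolding fixed_space_def tensor_space_iff by blast
  then obtain h where h: "\<And>\<sigma>. F (tuple (t(i := \<sigma>))) = (if \<sigma> \<in> sym N then csign \<sigma> * h (\<sigma> ` Qs i) else 0)"
    "garnir N (p i + c i) h"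
    unfolding specht_iff[OF assms] by blast
  define k where "k = (\<Prod>j\<in>{..<d} - {i}. csign (t j))"
  have "tsign (t(i := \<sigma>)) = csign \<sigma> * k" for \<sigma>
    unfolding tsign_def k_def using assms by (subst prod.remove[of _ i]) (auto intro!: prod.cong)
  moreover have "csign \<sigma> * k * (csign \<sigma> * z) = (csign \<sigma> * csign \<sigma>) * (k * z)" for \<sigma> z
    by (simp only: ac_simps)
  ultimately have "signed (t(i := \<sigma>)) = k * h (\<sigma> ` Qs i)" if "\<sigma> \<in> sym N" for \<sigma>
    using that by (simp add: signed_def h(1))
  moreover have "garnir N (p i + c i) (\<lambda>b. k * h b)"
    using h(2) by (simp add: garnir_def sum_distrib_left[symmetric])
  ultimately show ?thesis
    using that by blast
qed

text \<open>For a change in one argument this is \<open>signed_slice\<close>. The tuples are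
  exchanged one argument at a time, \<open>mix k\<close> agreeing with \<open>t'\<close> in the
  first \<open>k\<close> of them.\<close>

lemma signed_cong:
  assumes "sym_tuple t" "sym_tuple t'" "\<And>i. i < d \<Longrightarrow> t i ` Qs i = t' i ` Qs i"
  shows "signed t = signed t'"
proof -
  define mix where "mix k = (\<lambda>i. if i < k then t' i else t i)" for k :: nat
  have "k \<le> d \<Longrightarrow> signed (mix k) = signed t" for k
  proof (induction k)
    case 0
    then show ?case
      by (simp add: mix_def)
  next
    case (Suc k)
    then have k: "k < d"
      by simp
    obtain h where h: "\<And>\<sigma>. \<sigma> \<in> sym N \<Longrightarrow> signed ((mix k)(k := \<sigma>)) = h (\<sigma> ` Qs k)"
      using signed_slice[OF k] by blast
    have "(mix k)(k := t' k) = mix (Suc k)" "(mix k)(k := t k) = mix k"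
      by (auto simp: mix_def fun_eq_iff)
    then have "signed (mix (Suc k)) = signed (mix k)"
      using h[of "t' k"] h[of "t k"] assms k by simp
    then show ?case
      using Suc by simp
  qed
  from this[of d] have "signed (mix d) = signed t"
    by simp
  moreover have "signed (mix d) = signed t'"
    unfolding signed_def tsign_def
    by (intro arg_cong2[where f = "(*)"] prod.cong arg_cong[of _ _ F] tuple_cong) (auto simp: mix_def)
  ultimately show ?thesis
    by simp
qed

definition word_tuple :: "nat set list \<Rightarrow> nat \<Rightarrow> perm" where
  "word_tuple w = (SOME t. sym_tuple t \<and> (\<forall>i<d. t i ` Qs i = columns w i))"

text \<open>The choice in \<open>word_tuple\<close> does not matter, by \<open>signed_cong\<close>.
  The value 0 off the valid words is forced by the support conditions of
  \<open>hw_space\<close>.\<close>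

definition of_tensor :: "nat set list \<Rightarrow> complex" where
  "of_tensor w = (if valid_word w then signed (word_tuple w) else 0)"

lemma word_tuple:
  assumes "valid_word w"
  shows "sym_tuple (word_tuple w)" "i < d \<Longrightarrow> word_tuple w i ` Qs i = columns w i"
proof -
  have w: "w \<in> words (Pow {..<d}) N" "\<And>i. i < d \<Longrightarrow> i \<in> UNIV \<Longrightarrow> card (columns w i) = p i + c i"
    using assms by (auto simp: valid_word_def)
  obtain t where "sym_tuple t" "\<And>i. i < d \<Longrightarrow> i \<in> UNIV \<Longrightarrow> t i ` Qs i = columns w i"
    using valid_word_obtain_tuple[OF w] by blast
  then have "sym_tuple t \<and> (\<forall>i<d. t i ` Qs i = columns w i)"
    by blast
  from someI[of "\<lambda>t. sym_tuple t \<and> (\<forall>i<d. t i ` Qs i = columns w i)", OF this]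
  show "sym_tuple (word_tuple w)" "i < d \<Longrightarrow> word_tuple w i ` Qs i = columns w i"
    unfolding word_tuple_def by blast+
qed

lemma of_tensor_eq:
  assumes "valid_word w" "sym_tuple t" "\<And>i. i < d \<Longrightarrow> t i ` Qs i = columns w i"
  shows "of_tensor w = signed t"
proof -
  have "signed (word_tuple w) = signed t"
    by (rule signed_cong[OF word_tuple(1)[OF assms(1)] assms(2)])
      (simp only: word_tuple(2)[OF assms(1)] assms(3))
  then show ?thesis
    using assms(1) by (simp add: of_tensor_def)
qed

text \<open>Permuting the word amounts to the diagonal action on the tuple, which fixes
  \<open>F\<close>; the sign that remains comes from \<open>tsign_translate\<close>.\<close>

lemma of_tensor_alternating: "alternating of_tensor"
proof (rule alternating_if_permute_list)
  fix \<sigma> :: perm and w :: "nat set list"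
  assume \<sigma>: "\<sigma> \<in> sym (length w)"
  show "of_tensor (permute_list \<sigma> w) = csign \<sigma> * of_tensor w"
  proof (cases "valid_word w")
    case False
    then show ?thesis
      using valid_word_permute[OF \<sigma>] by (simp add: of_tensor_def)
  next
    case True
    then have \<sigma>N: "\<sigma> \<in> sym N"
      using \<sigma> by (simp add: valid_word_def words_def)
    let ?t = "word_tuple w"
    note t = word_tuple[OF True]
    have "of_tensor (permute_list \<sigma> w) = signed (\<lambda>i. inv \<sigma> \<circ> ?t i)"
    proof (rule of_tensor_eq)
      show "valid_word (permute_list \<sigma> w)"
        using valid_word_permute[OF \<sigma>] True by simp
      show "sym_tuple (\<lambda>i. inv \<sigma> \<circ> ?t i)"
        using t(1) sym_comp sym_inv[OF \<sigma>N] by blast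
      show "(inv \<sigma> \<circ> ?t i) ` Qs i = columns (permute_list \<sigma> w) i" if "i < d" for i
        unfolding columns_permute_list[OF \<sigma>] t(2)[OF that, symmetric] by (simp only: image_comp)
    qed
    also have "\<dots> = csign \<sigma> * tsign ?t * diag_act \<sigma> F (tuple ?t)"
      unfolding signed_def diag_act_tuple
      by (simp add: tsign_translate[OF sym_inv[OF \<sigma>N] t(1)] csign_inv[OF \<sigma>N])
    also have "diag_act \<sigma> F = F"
      using F \<sigma>N by (simp add: fixed_space_def)
    finally show ?thesis
      using True by (simp add: of_tensor_def signed_def)
  qed
qed

text \<open>Removing \<open>i\<close> from one letter can give a valid word only if the
  \<open>i\<close>-th column is one too long and all other columns have the right length. In that
  case the sum is a Garnir sum; otherwise every term is 0.\<close>

lemma of_tensor_raise: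
  assumes i: "i < d"
  shows "raise i of_tensor w = 0"
proof (cases "w \<in> words (Pow {..<d}) N \<and> (\<forall>k<d. k \<noteq> i \<longrightarrow> card (columns w k) = p k + c k) \<and>
    card (columns w i) = Suc (p i + c i)")
  case True
  then have w: "w \<in> words (Pow {..<d}) N" "\<And>k. k < d \<Longrightarrow> k \<in> - {i} \<Longrightarrow> card (columns w k) = p k + c k"
    and ci: "card (columns w i) = Suc (p i + c i)"
    by auto
  have len: "length w = N"
    using w(1) by (simp add: words_def)
  \<comment> \<open>Nothing is required of \<open>t i\<close>, as the \<open>i\<close>-th column has
    the wrong size; it is overwritten by \<open>\<sigma>\<close> below.\<close>
  obtain t where t: "sym_tuple t" "\<And>k. k < d \<Longrightarrow> k \<in> - {i} \<Longrightarrow> t k ` Qs k = columns w k"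
    using valid_word_obtain_tuple[OF w] by blast
  obtain h where h: "garnir N (p i + c i) h"
    "\<And>\<sigma>. \<sigma> \<in> sym N \<Longrightarrow> signed (t(i := \<sigma>)) = h (\<sigma> ` Qs i)"
    using signed_slice[OF i] by blast
  have slice_term: "of_tensor (w[j := w ! j - {i}]) = h (columns w i - {j})" if j: "j \<in> columns w i" for j
  proof -
    let ?w = "w[j := w ! j - {i}]"
    have jN: "j < N" "j < length w"
      using j len by (auto simp: columns_def)
    have col: "columns ?w k = (if k = i then columns w i - {j} else columns w k)" for k
      using jN by (auto simp: columns_def nth_list_update split: if_splits)
    have fin: "finite (columns w i)"
      using columns_subset[OF len] finite_subset by blast
    then have card: "card (columns w i - {j}) = p i + c i"
      using ci j by simp
    have sub: "columns w i - {j} \<subseteq> {..<N}"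
      using columns_subset[OF len] by blast
    obtain \<sigma> where \<sigma>: "\<sigma> \<in> sym N" "\<sigma> ` Qs i = columns w i - {j}"
      using sym_transitive_on_subsets[OF Qs_subset[OF i] sub] card card_Qs[OF i] by metis
    have "w ! j \<subseteq> {..<d}"
      using w(1) jN by (auto simp: words_def dest: nth_mem)
    then have "?w \<in> words (Pow {..<d}) N"
      using w(1) by (auto simp: words_def dest!: set_update_subset_insert[THEN subsetD])
    then have "valid_word ?w"
      using w(2) card by (simp add: valid_word_def col)
    then have "of_tensor ?w = signed (t(i := \<sigma>))"
      by (rule of_tensor_eq) (use t \<sigma> in \<open>auto simp: col\<close>)
    then show ?thesis
      using h(2)[OF \<sigma>(1)] \<sigma>(2) by simp
  qed
  have "raise i of_tensor w = (\<Sum>j<N. if j \<in> columns w i then h (columns w i - {j}) else 0)"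
    unfolding raise_eq_sum len
    by (intro sum.cong refl) (use slice_term len in \<open>auto simp: columns_def\<close>)
  also have "\<dots> = (\<Sum>j\<in>columns w i. h (columns w i - {j}))"
    using columns_subset[OF len, of i] by (simp add: sum.If_cases Int_absorb1)
  also have "\<dots> = 0"
    using h(1) ci columns_subset[OF len, of i] unfolding garnir_def by blast
  finally show ?thesis .
next
  case False
  have "of_tensor (w[j := w ! j - {i}]) = 0" if j: "j < length w" "i \<in> w ! j" for j
  proof (rule ccontr)
    let ?w = "w[j := w ! j - {i}]"
    assume "of_tensor ?w \<noteq> 0"
    then have v: "valid_word ?w"
      by (metis of_tensor_def)
    have "?w ! j \<in> set ?w"
      using j by (intro nth_mem) simp
    then have "w ! j - {i} \<subseteq> {..<d}"
      using v j by (auto simp: valid_word_def words_def)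
    then have wj: "w ! j \<subseteq> {..<d}"
      using i by auto
    have "w = ?w[j := w ! j]"
      by simp
    then have "set w \<subseteq> insert (w ! j) (set ?w)"
      by (metis set_update_subset_insert)
    then have "w \<in> words (Pow {..<d}) N"
      using v wj by (auto simp: valid_word_def words_def)
    moreover have col: "columns ?w k = (if k = i then columns w i - {j} else columns w k)" for k
      using j by (auto simp: columns_def nth_list_update split: if_splits)
    moreover have "card (columns ?w k) = p k + c k" if "k < d" for k
      using v that by (simp add: valid_word_def)
    moreover have "j \<in> columns w i" "finite (columns w i)"
      using j by (auto simp: columns_def)
    ultimately show False
      using False i by (metis card_Suc_Diff1)
  qed
  then show ?thesis
    unfolding raise_eq_sum by (auto intro!: sum.neutral)
qed

lemma of_tensor_hw_space: "of_tensor \<in> hw_space d N weights"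
  unfolding hw_space_iff using of_tensor_alternating of_tensor_raise
  by (auto simp: of_tensor_def)

lemma to_tensor_of_tensor: "to_tensor of_tensor = F"
proof
  fix ts
  show "to_tensor of_tensor ts = F ts"
  proof (cases "length ts = d \<and> (\<forall>i<d. ts ! i \<in> sym N)")
    case True
    define t where "t = (\<lambda>i. ts ! i)"
    have ts: "ts = tuple t" and t: "sym_tuple t"
      using True tuple_of_list by (simp_all add: t_def)
    have "of_tensor (rows (\<lambda>i. t i ` Qs i)) = signed t"
      by (rule of_tensor_eq[OF valid_rows[OF t] t]) (use t sym_image_subset rows_props(4) in simp)
    moreover have "tsign t * (tsign t * z) = z" for z
      by (simp add: mult.assoc[symmetric] tsign_square)
    ultimately show ?thesis
      unfolding ts to_tensor_tuple using t by (simp add: signed_def)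
  next
    case False
    then have "F ts = 0"
      using F tensor_support[of F ts] unfolding fixed_space_def by blast
    then show ?thesis
      using False by (auto simp: to_tensor_def)
  qed
qed

end

section \<open>The Kronecker coefficient as a dimension\<close>

lemma finite_dim_hw_space: "finite_dim (hw_space d N weights)"
  by (rule finite_dim_supported[of "words (Pow {..<d}) N"]) (auto simp: hw_space_def)

lemma subspace_hw_space: "cfun.subspace (hw_space d N weights)"
  unfolding cfun.subspace_def
proof (intro conjI ballI allI)
  show "0 \<in> hw_space d N weights"
    using raise_zero by (simp add: hw_space_iff alternating_def zero_fun_def)
next
  fix F G assume "F \<in> hw_space d N weights" "G \<in> hw_space d N weights"
  then have F: "alternating F" "\<And>w. F w \<noteq> 0 \<Longrightarrow> valid_word w" "\<And>i w. i < d \<Longrightarrow> raise i F w = 0"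
    and G: "alternating G" "\<And>w. G w \<noteq> 0 \<Longrightarrow> valid_word w" "\<And>i w. i < d \<Longrightarrow> raise i G w = 0"
    unfolding hw_space_iff by blast+
  have "alternating (F + G)"
    unfolding alternating_def
  proof (intro allI)
    fix u x y v
    show "(F + G) (u @ x # y # v) = - (F + G) (u @ y # x # v)"
      using alternatingD[OF F(1), of u x y v] alternatingD[OF G(1), of u x y v] by simp
  qed
  moreover have "valid_word w" if "(F + G) w \<noteq> 0" for w
    using F(2)[of w] G(2)[of w] that by (cases "F w = 0") auto
  moreover have "raise i (F + G) w = 0" if "i < d" for i w
    using raise_add[of i F G w] F(3) G(3) that by (simp add: plus_fun_def)
  ultimately show "F + G \<in> hw_space d N weights"
    unfolding hw_space_iff by blast
next
  fix a F assume "F \<in> hw_space d N weights"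
  then have F: "alternating F" "\<And>w. F w \<noteq> 0 \<Longrightarrow> valid_word w" "\<And>i w. i < d \<Longrightarrow> raise i F w = 0"
    unfolding hw_space_iff by blast+
  have "alternating (cscale a F)"
    unfolding alternating_def
  proof (intro allI)
    fix u x y v
    show "cscale a F (u @ x # y # v) = - cscale a F (u @ y # x # v)"
      using alternatingD[OF F(1), of u x y v] by simp
  qed
  moreover have "valid_word w" if "cscale a F w \<noteq> 0" for w
    using F(2)[of w] that by auto
  moreover have "raise i (cscale a F) w = 0" if "i < d" for i w
    using raise_scale[of i a F w] F(3) that by (simp add: cscale_def)
  ultimately show "cscale a F \<in> hw_space d N weights"
    unfolding hw_space_iff by blast
qed

lemma kronecker_eq_dim_hw_space: "kronecker shapes = cfun.dim (hw_space d N weights)"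
proof -
  have "to_tensor ` hw_space d N weights = invariants"
  proof
    show "to_tensor ` hw_space d N weights \<subseteq> invariants"
      using to_tensor_invariant by blast
    show "invariants \<subseteq> to_tensor ` hw_space d N weights"
    proof
      fix F assume F: "F \<in> invariants"
      show "F \<in> to_tensor ` hw_space d N weights"
        using imageI[OF of_tensor_hw_space[OF F], of to_tensor] to_tensor_of_tensor[OF F] by simp
    qed
  qed
  then show ?thesis
    using kronecker_eq_dim dim_image_inj[OF clinear_to_tensor subspace_hw_space inj_on_to_tensor] by simp
qed

end

section \<open>Monotonicity\<close>

lemma clinear_wedge: "clinear (wedge x)"
  by (rule clinearI) (simp_all add: fun_eq_iff plus_fun_def cscale_def wedge_add wedge_scale)

context odd_cube
begin

lemma clinear_lift: "clinear lift"
  by (rule clinearI)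
    (simp_all add: lift_def fun_eq_iff clinear_add[OF clinear_wedge] clinear_scale[OF clinear_wedge]
      sum.distrib sum_distrib_left algebra_simps)

lemma clinear_lower: "clinear lower"
  by (rule clinearI)
    (simp_all add: lower_def fun_eq_iff sum.distrib sum_distrib_left algebra_simps)

end

lemma inj_on_subspace:
  assumes "clinear T" "cfun.subspace V" "\<And>f. f \<in> V \<Longrightarrow> T f = 0 \<Longrightarrow> f = 0"
  shows "inj_on T V"
proof (rule inj_onI)
  fix f g assume "f \<in> V" "g \<in> V" "T f = T g"
  then have "f - g \<in> V" "T (f - g) = 0"
    using cfun.subspace_diff[OF assms(2)] clinear_diff[OF assms(1)] by simp_all
  then show "f = g"
    using assms(3)[of "f - g"] by simp
qed

text \<open>Both tuples have the same \<open>c\<close>, so the weights agree in degrees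
  \<open>N\<close> and \<open>N + 2\<close>. The asymmetric bounds arise because \<open>lift\<close>
  starts in degree \<open>N\<close> and \<open>lower\<close> in degree \<open>N + 2\<close>.\<close>

lemma hw_space_step:
  assumes "two_column_tuple d N p c" "two_column_tuple d (N + 2) p' c"
  shows "N < 2 ^ (d - 1) \<Longrightarrow>
      cfun.dim (hw_space d N (\<lambda>i. int (c i))) \<le> cfun.dim (hw_space d (N + 2) (\<lambda>i. int (c i)))"
    and "2 ^ (d - 1) < N + 2 \<Longrightarrow>
      cfun.dim (hw_space d (N + 2) (\<lambda>i. int (c i))) \<le> cfun.dim (hw_space d N (\<lambda>i. int (c i)))"
proof -
  interpret low: two_column_tuple d N p c by fact
  interpret high: two_column_tuple d "N + 2" p' c by fact
  interpret odd_cube d by unfold_locales (rule low.odd_tuple)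
  have vanish: "G = 0" if "G \<in> hw_space d M k" "\<And>w. w \<in> words (Pow {..<d}) M \<Longrightarrow> G w = 0" for G M k
    using that by (auto simp: hw_space_def fun_eq_iff)
  show "cfun.dim (hw_space d N low.weights) \<le> cfun.dim (hw_space d (N + 2) low.weights)"
    if N: "N < 2 ^ (d - 1)"
  proof (rule dim_le_of_injective[OF clinear_lift low.subspace_hw_space])
    show "inj_on lift (hw_space d N low.weights)"
    proof (rule inj_on_subspace[OF clinear_lift low.subspace_hw_space])
      fix G assume G: "G \<in> hw_space d N low.weights" "lift G = 0"
      then have "alternating G"
        by (simp add: hw_space_def)
      then show "G = 0"
        using lift_eq_0_imp[OF _ N, of G] G by (intro vanish[OF G(1)]) (simp add: zero_fun_def)
    qed
    show "lift ` hw_space d N low.weights \<subseteq> hw_space d (N + 2) low.weights"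
      using lift_hw_space by blast
  qed (rule high.finite_dim_hw_space high.subspace_hw_space)+
  show "cfun.dim (hw_space d (N + 2) low.weights) \<le> cfun.dim (hw_space d N low.weights)"
    if N: "2 ^ (d - 1) < N + 2"
  proof (rule dim_le_of_injective[OF clinear_lower high.subspace_hw_space])
    show "inj_on lower (hw_space d (N + 2) low.weights)"
    proof (rule inj_on_subspace[OF clinear_lower high.subspace_hw_space])
      fix G assume G: "G \<in> hw_space d (N + 2) low.weights" "lower G = 0"
      then have "alternating G"
        by (simp add: hw_space_def)
      then show "G = 0"
        using lower_eq_0_imp[OF _ N, of G] G by (intro vanish[OF G(1)]) (simp add: zero_fun_def)
    qed
    show "lower ` hw_space d (N + 2) low.weights \<subseteq> hw_space d N low.weights"
      using lower_hw_space by blast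
  qed (rule low.finite_dim_hw_space low.subspace_hw_space)+
qed

section \<open>Partitions with parts at most 2 and the iterates of \<open>rho\<close>\<close>

lemma two_col_shape_conj_part:
  assumes "sorted_wrt (\<ge>) xs" "0 \<notin> set xs" "\<And>x. x \<in> set xs \<Longrightarrow> x \<le> 2"
  shows "xs = two_col_shape (conj_part xs 2) (conj_part xs 1 - conj_part xs 2)
    \<and> conj_part xs 2 \<le> conj_part xs 1"
  using assms
proof (induction xs)
  case Nil
  then show ?case
    by (simp add: two_col_shape_def conj_part_def)
next
  case (Cons x xs)
  then have IH: "xs = two_col_shape (conj_part xs 2) (conj_part xs 1 - conj_part xs 2)"
      "conj_part xs 2 \<le> conj_part xs 1"
    by simp_all
  have "x = 1 \<or> x = 2"
    using Cons.prems(2) Cons.prems(3)[of x] by (auto simp: le_Suc_eq numeral_2_eq_2)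
  then show ?case
  proof
    assume x: "x = 1"
    then have "\<forall>y\<in>set xs. y \<le> 1"
      using Cons.prems(1) by simp
    then have 0: "conj_part xs 2 = 0"
      by (auto simp: conj_part_def filter_empty_conv)
    have "x # xs = replicate (Suc (conj_part xs 1)) 1"
      using IH(1) x unfolding 0 by (simp add: two_col_shape_def)
    then show ?thesis
      using x 0 by (simp add: two_col_shape_def conj_part_def)
  next
    assume "x = 2"
    then show ?thesis
      using IH by (simp add: two_col_shape_def conj_part_def)
  qed
qed

text \<open>Rows of length 2 are added or stripped, so \<open>p\<close> changes and \<open>c\<close>
  does not. The lower bound on \<open>n\<close> ensures that every stripped part equals 2, where
  \<open>inv\<close> really inverts \<open>rho 2\<close>.\<close>

lemma rho_pow_two_col_shape:
  assumes "- int p \<le> n"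
  shows "rho_pow 2 n (two_col_shape p c) = two_col_shape (nat (int p + n)) c"
proof (cases "0 \<le> n")
  case True
  have "(rho 2 ^^ k) (two_col_shape p c) = two_col_shape (p + k) c" for k
    by (induction k) (auto simp: rho_def two_col_shape_def)
  then show ?thesis
    using True by (simp add: rho_pow_def nat_add_distrib)
next
  case False
  have "inj (rho 2)"
    by (auto simp: inj_def rho_def)
  then have inv: "inv (rho 2) (2 # xs) = xs" for xs
    by (metis inv_f_f rho_def)
  have "k \<le> p \<Longrightarrow> (inv (rho 2) ^^ k) (two_col_shape p c) = two_col_shape (p - k) c" for k
  proof (induction k)
    case (Suc k)
    then have "p - k = Suc (p - Suc k)"
      by simp
    then have "two_col_shape (p - k) c = 2 # two_col_shape (p - Suc k) c"
      by (simp add: two_col_shape_def)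
    then show ?case
      using Suc inv by simp
  qed simp
  from this[of "nat (- n)"] show ?thesis
    using False assms by (simp add: rho_pow_def nat_diff_distrib' nat_le_iff)
      (metis add.commute diff_minus_eq_add minus_minus nat_diff_distrib' nat_int of_nat_0_le_iff
        linorder_not_le neg_0_le_iff_le order_less_imp_le)
qed

lemma mono_on_int_steps:
  fixes x :: "int \<Rightarrow> nat"
  assumes "\<And>n. l \<le> n \<Longrightarrow> n < u \<Longrightarrow> x n \<le> x (n + 1)"
  shows "mono_on {l..u} x"
proof (rule mono_onI)
  fix i j assume ij: "i \<in> {l..u}" "j \<in> {l..u}" "i \<le> j"
  from ij(3) have "j \<le> u \<longrightarrow> x i \<le> x j"
  proof (induction j rule: int_ge_induct)
    case (step k)
    then show ?case
      using assms[of k] ij(1) by auto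
  qed simp
  then show "x i \<le> x j"
    using ij by simp
qed

lemma antimono_on_int_steps:
  fixes x :: "int \<Rightarrow> nat"
  assumes "\<And>n. l \<le> n \<Longrightarrow> n < u \<Longrightarrow> x (n + 1) \<le> x n"
  shows "antimono_on {l..u} x"
proof (rule monotone_onI)
  fix i j assume ij: "i \<in> {l..u}" "j \<in> {l..u}" "i \<le> j"
  from ij(3) have "j \<le> u \<longrightarrow> x j \<le> x i"
  proof (induction j rule: int_ge_induct)
    case (step k)
    then show ?case
      using assms[of k] ij(1) by auto
  qed simp
  then show "x j \<le> x i"
    using ij by simp
qed

theorem theorem1p6:
  fixes d m a b :: nat and lam :: "nat list list"
  assumes "d \<ge> 3" and "odd d" and "m \<le> 2 ^ (d - 1)"
    and "length lam = d"
    and "\<And>i. i < d \<Longrightarrow> partition_of m (lam ! i)"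
    and "\<And>i p. i < d \<Longrightarrow> p \<in> set (lam ! i) \<Longrightarrow> p \<le> 2"
    and "a = Max ((\<lambda>i. conj_part (lam ! i) 1) ` {..<d})"
    and "b = Min ((\<lambda>i. conj_part (lam ! i) 2) ` {..<d})"
  shows "unimodal (- int b) (2 ^ (d - 1) - int a)
           (\<lambda>n. kronecker (map (rho_pow 2 n) lam))"
proof -
  define p where "p i = conj_part (lam ! i) 2" for i
  define c where "c i = conj_part (lam ! i) 1 - conj_part (lam ! i) 2" for i
  have lam: "lam ! i = two_col_shape (p i) (c i)" "p i \<le> conj_part (lam ! i) 1" if "i < d" for i
    using two_col_shape_conj_part[of "lam ! i"] assms(5,6)[OF that]
    unfolding p_def c_def partition_of_def by blast+
  have m: "m = 2 * p i + c i" if "i < d" for i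
    using assms(5)[OF that] sum_list_two_col[of "p i" "c i"] lam(1)[OF that] by (simp add: partition_of_def)
  have ne: "{..<d} \<noteq> {}"
    using assms(1) by (simp add: lessThan_empty_iff)
  have b: "b \<le> p i" if "i < d" for i
    unfolding assms(8) p_def using that by (intro Min_le) auto
  have "a \<in> (\<lambda>i. conj_part (lam ! i) 1) ` {..<d}"
    unfolding assms(7) using ne by (intro Max_in) auto
  then obtain i where i: "i < d" "a = conj_part (lam ! i) 1"
    by auto
  then have "a = p i + c i"
    using lam(2)[OF i(1)] by (simp add: c_def p_def)
  then have a: "a \<le> m"
    using m[OF i(1)] by simp
  have tuple: "two_column_tuple d (nat (int m + 2 * n)) (\<lambda>i. nat (int (p i) + n)) c"
    if "- int b \<le> n" for n
  proof
    show "2 * nat (int (p i) + n) + c i = nat (int m + 2 * n)" if "i < d" for i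
      using m[OF that] b[OF that] \<open>- int b \<le> n\<close> by linarith
  qed (rule assms(2))
  let ?x = "\<lambda>n. kronecker (map (rho_pow 2 n) lam)"
  have x: "?x n = cfun.dim (hw_space d (nat (int m + 2 * n)) (\<lambda>i. int (c i)))" if n: "- int b \<le> n" for n
  proof -
    have "map (rho_pow 2 n) lam = map (\<lambda>i. two_col_shape (nat (int (p i) + n)) (c i)) [0..<d]"
    proof (rule nth_equalityI)
      fix i assume "i < length (map (rho_pow 2 n) lam)"
      then have i: "i < d"
        using assms(4) by simp
      have "- int (p i) \<le> n"
        using b[OF i] n by linarith
      then show "map (rho_pow 2 n) lam ! i =
          map (\<lambda>i. two_col_shape (nat (int (p i) + n)) (c i)) [0..<d] ! i"
        using i assms(4) by (simp add: lam(1) rho_pow_two_col_shape)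
    qed (use assms(4) in simp)
    then show ?thesis
      using two_column_tuple.kronecker_eq_dim_hw_space[OF tuple[OF n]] by simp
  qed
  \<comment> \<open>Each partition has at least \<open>b\<close> rows of length 2, so
    \<open>int m + 2 * n\<close> is nonnegative and \<open>nat\<close> does not truncate.\<close>
  have next_size: "nat (int m + 2 * (n + 1)) = nat (int m + 2 * n) + 2" if "- int b \<le> n" for n
  proof -
    have "0 \<le> int m + 2 * n"
      using m[OF i(1)] b[OF i(1)] that by linarith
    then show ?thesis
      by (simp add: nat_add_distrib[symmetric] algebra_simps flip: nat_numeral)
  qed
  have step: "two_column_tuple d (nat (int m + 2 * n) + 2) (\<lambda>i. nat (int (p i) + (n + 1))) c"
    if "- int b \<le> n" for n
    using tuple[of "n + 1"] that unfolding next_size[OF that] by simp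
  define K :: nat where "K = 2 ^ (d - 1)"
  have K: "2 ^ (d - 1) = int K"
    by (simp add: K_def)
  have Kpos: "0 < K"
    by (simp add: K_def)
  have mK: "m \<le> K"
    using assms(3) by (simp add: K_def)
  \<comment> \<open>The least \<open>n\<close> for which \<open>m + 2 * n\<close> reaches the middle
    degree \<open>K\<close>. A step from a smaller \<open>n\<close> starts below \<open>K\<close>,
    where \<open>lift\<close> is injective; a step from \<open>r\<close> or later ends above
    \<open>K\<close>, where \<open>lower\<close> is injective.\<close>
  define r where "r = (int K - int m + 1) div 2"
  have r: "int K - int m \<le> 2 * r" "2 * r \<le> int K - int m + 1"
    unfolding r_def by linarith+
  have "mono_on {- int b..r} ?x"
  proof (rule mono_on_int_steps)
    fix n assume n: "- int b \<le> n" "n < r"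
    then have "nat (int m + 2 * n) < K"
      using r Kpos by linarith
    then show "?x n \<le> ?x (n + 1)"
      using hw_space_step(1)[OF tuple[OF n(1)] step[OF n(1)]] n(1) x[of n] x[of "n + 1"] next_size[of n]
      by (simp add: K_def)
  qed
  moreover have "antimono_on {r..int K - int a} ?x"
  proof (rule antimono_on_int_steps)
    fix n assume n: "r \<le> n"
    then have nb: "- int b \<le> n"
      using r mK by linarith
    then have "K < nat (int m + 2 * n) + 2"
      using n r by linarith
    then show "?x (n + 1) \<le> ?x n"
      using hw_space_step(2)[OF tuple[OF nb] step[OF nb]] nb x[of n] x[of "n + 1"] next_size[of n]
      by (simp add: K_def)
  qed
  \<comment> \<open>From \<open>m \<le> K\<close> it follows that \<open>r\<close> lies between 0
    and \<open>K - m\<close>, and \<open>a \<le> m\<close> puts \<open>K - m\<close> inside the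
    interval.\<close>
  moreover have "r \<in> {- int b..int K - int a}"
    using r a mK by auto
  ultimately show ?thesis
    unfolding unimodal_def K by blast
qed

end
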